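(* Let $P$ be an equational nominal unification problem and $\langle\nabla,\sigma\rangle$ a nominal solution of $P$ with $\mathrm{Vars}(P)\subseteq\mathrm{Dom}(\sigma)$. Then $\langle\nabla,\sigma\rangle$ is a most general unifier of $P$ if and only if $[\sigma]_\nabla$ is a most general unifier of the pattern unification problem $[P]$.
   Context: Nominal setting. Atoms (each of a sort of atoms), variables $X$ with sorts, function symbols $f$; nominal terms $t::=f(t_1,\dots,t_n)\mid a\mid a.t\mid\pi\cdot X$, where a permutation $\pi$ is a finite sequence of swappings $(a\,b)$ of same-sort atoms acting on atoms by $(a\,b)\cdot a=b$, $(a\,b)\cdot b=a$, $(a\,b)\cdot c=c$ otherwise, and on terms homomorphically with $(a\,b)\cdot(c.t)=((a\,b)\cdot c).((a\,b)\cdot t)$, $(a\,b)\cdot(\pi\cdot X)=((a\,b)\pi)\cdot X$. A nominal substitution $\sigma=[X_1\mapsto t_1,\dots]$ has domain $\mathrm{Dom}(\sigma)=\{X_1,\dots\}$ (with $\mathrm{Dom}([X\mapsto X])=\{X\}$) and replaces variables without renaming, $\sigma(\pi\cdot X)=\pi\cdot\sigma(X)$; $(\sigma_1\circ\sigma_2)=[X\mapsto\sigma_1(\sigma_2(X))\mid X\in\mathrm{Dom}(\sigma_1)\cup\mathrm{Dom}(\sigma_2)]$, $\sigma|_V=[X\mapsto\sigma(X)\mid X\in V]$. A freshness environment $\nabla$ is a finite set of constraints $a\#X$; $\nabla\vdash a\#t$, $\nabla\vdash t\approx u$ are the least relations closed under: $\nabla\vdash a\#a'$ if $a\ne a'$;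 $\nabla\vdash a\#\pi\cdot X$ if $(\pi^{-1}\cdot a)\#X\in\nabla$; $\nabla\vdash a\#f(\vec t)$ if all $\nabla\vdash a\#t_i$; $\nabla\vdash a\#a.t$; $\nabla\vdash a\#a'.t$ if $a\ne a'$, $\nabla\vdash a\#t$; $\nabla\vdash a\approx a$; $\nabla\vdash\pi\cdot X\approx\pi'\cdot X$ if $a\#X\in\nabla$ whenever $\pi\cdot a\ne\pi'\cdot a$; $\nabla\vdash f(\vec t)\approx f(\vec t')$ if all $\nabla\vdash t_i\approx t_i'$; $\nabla\vdash a.t\approx a.t'$ if $\nabla\vdash t\approx t'$; $\nabla\vdash a.t\approx a'.t'$ if $a\ne a'$, $\nabla\vdash t\approx(a\,a')\cdot t'$, $\nabla\vdash a\#t'$. An equational nominal unification problem $P$ is a finite set of equations $t\stackrel{?}{\approx}u$, $\mathrm{Vars}(P)$ its variables; a solution is $\langle\nabla,\sigma\rangle$ with $\nabla\vdash\sigma(t)\approx\sigma(u)$ for all equations. $\nabla_2\vdash\sigma(\nabla_1)$ means $\nabla_2\vdash a\#\sigma(X)$ for all $a\#X\in\nabla_1$; $\nabla\vdash\sigma\approx\sigma'$ means $\nabla\vdash\sigma(X)\approx\sigma'(X)$ for all $X\in\mathrm{Dom}(\sigma)\cup\mathrm{Dom}(\sigma')$. $\langle\nabla_1,\sigma_1\rangle$ is more general than $\langle\nabla_2,\sigma_2\rangle$ if some $\sigma'$ satisfies $\nabla_2\vdash\sigma'(\nabla_1)$ and $\nabla_2\vdash(\sigma'\circ\sigma_1)|_{\mathrm{Dom}(\sigma_1)\cup\mathrm{Dom}(\sigma_2)}\approx\sigma_2$;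 a solution is most general if it is more general than every solution that is more general than it. Translation (standing assumption: $\langle a_1,\dots,a_n\rangle$ a fixed ordered list of pairwise distinct atoms, the atoms used in the problem, containing all atoms under consideration). Base types named by sorts, $[\nu]=\nu$, $[\delta]=\delta$, $[\langle\nu\rangle\tau]=\nu\to[\tau]$, $[\tau_1\times\cdots\times\tau_n\to\tau]=[\tau_1]\to\cdots\to[\tau_n]\to[\tau]$; atoms become $\lambda$-variables of the same name, function symbols constants; $[a]_\nabla=a$, $[f(\vec t)]_\nabla=f([t_1]_\nabla,\dots)$, $[a.t]_\nabla=\lambda a.[t]_\nabla$, $[\pi\cdot X]_\nabla=X([\pi\cdot b_1]_\nabla,\dots,[\pi\cdot b_m]_\nabla)$ with $\langle b_1,\dots,b_m\rangle$ the order-preserving sublist of $\langle a_1,\dots,a_n\rangle$ of atoms $a$ with $a\#X\notin\nabla$, $X$ the free $\lambda$-variable of type $[\nu_1]\to\cdots\to[\nu_m]\to[\tau]$ (determined by name and type). $[P]=\{\lambda a_1.\cdots\lambda a_n.[t]_\emptyset\stackrel{?}{=}\lambda a_1.\cdots\lambda a_n.[u]_\emptyset\mid t\stackrel{?}{\approx}u\in P\}$; $[\sigma]_\nabla=\bigcup_{X\in\mathrm{Dom}(\sigma)}[X\mapsto\lambda a_1.\cdots\lambda a_n.[\sigma(X)]_\nabla]$. For $\lambda$-substitutions (equality modulo $\alpha\beta\eta$), $\theta_1$ is more general than $\theta_2$ if some $\theta'$ satisfies $\theta'(\theta_1(X))=\theta_2(X)$ for all $X\in\mathrm{Dom}(\theta_1)\cup\mathrm{Dom}(\theta_2)$;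 a unifier of $[P]$ is most general if it is more general than every unifier of $[P]$ that is more general than it.
   Formalization: Added: ∇ constrains only variables occurring in the range of σ; most general unifiers of [P] are compared only with unifiers whose domain does not use a name of Dom([σ]) at another type; variables have atom or data sorts. Without the first two the claim fails. *)

theory Defs
  imports Main "HOL-Combinatorics.Transposition"
begin

section \<open>Nominal signatures and terms\<close>

text \<open>Sorts of atoms and sorts of data are kept disjoint by their constructors.\<close>

datatype 's base_sort = AtomSort 's | DataSort 's

datatype 's nsort = BaseSort "'s base_sort" | AbsSort 's "'s nsort"

text \<open>
  Variables have a sort of atoms or of data, never an abstraction sort, and there are countably
  many of each sort. The translation is faithful only modulo eta on a variable \<open>Y\<close> of abstraction
  sort: with \<open>a\<close> fresh for \<open>Y\<close>, the lambda-terms for \<open>Y\<close> and \<open>a.Z\<close> are instances of each other,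
  whereas \<open>Y\<close> is strictly more general than \<open>a.Z\<close> as a nominal term.
\<close>

datatype 's nvar = NVar (nvar_name: nat) (nvar_sort: "'s base_sort")

record ('a, 'f, 's) nsig =
  atom_sort :: "'a \<Rightarrow> 's"
  arg_sorts :: "'f \<Rightarrow> 's nsort list"
  res_sort  :: "'f \<Rightarrow> 's nsort"

text \<open>
  A permutation is a list of swappings whose head is applied last. The set function natoms
  collects all atoms of a term, including abstracted ones and those in suspended permutations.
\<close>

type_synonym 'a perm = "('a \<times> 'a) list"

datatype (natoms: 'a, 'f, nvars: 'x) nterm =
    NFun 'f "('a, 'f, 'x) nterm list"
  | NAtm 'a
  | NAbs 'a "('a, 'f, 'x) nterm"
  | NSus "('a \<times> 'a) list" 'x

inductive has_sort ::
  "('a, 'f, 's) nsig \<Rightarrow> ('a, 'f, 's nvar) nterm \<Rightarrow> 's nsort \<Rightarrow> bool"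
  for sg where
  "list_all2 (has_sort sg) ts (arg_sorts sg f) \<Longrightarrow> has_sort sg (NFun f ts) (res_sort sg f)"
| "has_sort sg (NAtm a) (BaseSort (AtomSort (atom_sort sg a)))"
| "has_sort sg t \<tau> \<Longrightarrow> has_sort sg (NAbs a t) (AbsSort (atom_sort sg a) \<tau>)"
| "(\<forall>(a, b) \<in> set \<pi>. atom_sort sg a = atom_sort sg b)
    \<Longrightarrow> has_sort sg (NSus \<pi> X) (BaseSort (nvar_sort X))"

definition perm_atom :: "'a perm \<Rightarrow> 'a \<Rightarrow> 'a" where
  "perm_atom \<pi> c = foldr (\<lambda>(a, b). transpose a b) \<pi> c"

primrec swap_term :: "'a \<times> 'a \<Rightarrow> ('a, 'f, 'x) nterm \<Rightarrow> ('a, 'f, 'x) nterm" where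
  "swap_term s (NFun f ts) = NFun f (map (swap_term s) ts)"
| "swap_term s (NAtm c) = NAtm (transpose (fst s) (snd s) c)"
| "swap_term s (NAbs c t) = NAbs (transpose (fst s) (snd s) c) (swap_term s t)"
| "swap_term s (NSus \<pi> X) = NSus (s # \<pi>) X"

definition perm_term :: "'a perm \<Rightarrow> ('a, 'f, 'x) nterm \<Rightarrow> ('a, 'f, 'x) nterm" where
  "perm_term \<pi> t = foldr swap_term \<pi> t"

section \<open>Freshness and alpha-equivalence\<close>

text \<open>A pair \<open>(a, X)\<close> of an environment is the constraint \<open>a # X\<close>.\<close>

type_synonym ('a, 'x) fenv = "('a \<times> 'x) set"

inductive fresh :: "('a, 'x) fenv \<Rightarrow> 'a \<Rightarrow> ('a, 'f, 'x) nterm \<Rightarrow> bool"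
  for \<Delta> where
  "a \<noteq> a' \<Longrightarrow> fresh \<Delta> a (NAtm a')"
| "(perm_atom (rev \<pi>) a, X) \<in> \<Delta> \<Longrightarrow> fresh \<Delta> a (NSus \<pi> X)"
| "(\<forall>t \<in> set ts. fresh \<Delta> a t) \<Longrightarrow> fresh \<Delta> a (NFun f ts)"
| "fresh \<Delta> a (NAbs a t)"
| "a \<noteq> a' \<Longrightarrow> fresh \<Delta> a t \<Longrightarrow> fresh \<Delta> a (NAbs a' t)"

inductive neq :: "('a, 'x) fenv \<Rightarrow> ('a, 'f, 'x) nterm \<Rightarrow> ('a, 'f, 'x) nterm \<Rightarrow> bool"
  for \<Delta> where
  "neq \<Delta> (NAtm a) (NAtm a)"
| "(\<forall>a. perm_atom \<pi> a \<noteq> perm_atom \<pi>' a \<longrightarrow> (a, X) \<in> \<Delta>) \<Longrightarrow> neq \<Delta> (NSus \<pi> X) (NSus \<pi>' X)"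
| "list_all2 (neq \<Delta>) ts ts' \<Longrightarrow> neq \<Delta> (NFun f ts) (NFun f ts')"
| "neq \<Delta> t t' \<Longrightarrow> neq \<Delta> (NAbs a t) (NAbs a t')"
| "a \<noteq> a' \<Longrightarrow> neq \<Delta> t (swap_term (a, a') t') \<Longrightarrow> fresh \<Delta> a t'
    \<Longrightarrow> neq \<Delta> (NAbs a t) (NAbs a' t')"

section \<open>Nominal substitutions and unification\<close>

text \<open>
  A partial map records the domain explicitly, so \<open>[X \<mapsto> X]\<close> has domain \<open>{X}\<close>.
\<close>

type_synonym ('a, 'f, 'x) nsubst = "'x \<rightharpoonup> ('a, 'f, 'x) nterm"

definition nlookup :: "('a, 'f, 'x) nsubst \<Rightarrow> 'x \<Rightarrow> ('a, 'f, 'x) nterm" where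
  "nlookup \<sigma> X = (case \<sigma> X of None \<Rightarrow> NSus [] X | Some t \<Rightarrow> t)"

primrec napply :: "('a, 'f, 'x) nsubst \<Rightarrow> ('a, 'f, 'x) nterm \<Rightarrow> ('a, 'f, 'x) nterm" where
  "napply \<sigma> (NFun f ts) = NFun f (map (napply \<sigma>) ts)"
| "napply \<sigma> (NAtm a) = NAtm a"
| "napply \<sigma> (NAbs a t) = NAbs a (napply \<sigma> t)"
| "napply \<sigma> (NSus \<pi> X) = perm_term \<pi> (nlookup \<sigma> X)"

definition nsubst_wf :: "('a, 'f, 's) nsig \<Rightarrow> ('a, 'f, 's nvar) nsubst \<Rightarrow> bool" where
  "nsubst_wf sg \<sigma> \<longleftrightarrow>
     finite (dom \<sigma>) \<and> (\<forall>X t. \<sigma> X = Some t \<longrightarrow> has_sort sg t (BaseSort (nvar_sort X)))"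

definition ncomp :: "('a, 'f, 'x) nsubst \<Rightarrow> ('a, 'f, 'x) nsubst \<Rightarrow> ('a, 'f, 'x) nsubst" where
  "ncomp \<sigma>1 \<sigma>2 =
     (\<lambda>X. if X \<in> dom \<sigma>1 \<union> dom \<sigma>2 then Some (napply \<sigma>1 (nlookup \<sigma>2 X)) else None)"

definition nrestrict :: "('a, 'f, 'x) nsubst \<Rightarrow> 'x set \<Rightarrow> ('a, 'f, 'x) nsubst" where
  "nrestrict \<sigma> V = (\<lambda>X. if X \<in> V then Some (nlookup \<sigma> X) else None)"

definition fenv_entails ::
  "('a, 'x) fenv \<Rightarrow> ('a, 'f, 'x) nsubst \<Rightarrow> ('a, 'x) fenv \<Rightarrow> bool" where
  "fenv_entails \<Delta>2 \<sigma> \<Delta>1 \<longleftrightarrow> (\<forall>(a, X) \<in> \<Delta>1. fresh \<Delta>2 a (nlookup \<sigma> X))"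

definition nsubst_eq ::
  "('a, 'x) fenv \<Rightarrow> ('a, 'f, 'x) nsubst \<Rightarrow> ('a, 'f, 'x) nsubst \<Rightarrow> bool" where
  "nsubst_eq \<Delta> \<sigma> \<sigma>' \<longleftrightarrow>
     (\<forall>X \<in> dom \<sigma> \<union> dom \<sigma>'. neq \<Delta> (nlookup \<sigma> X) (nlookup \<sigma>' X))"

type_synonym ('a, 'f, 'x) nproblem = "(('a, 'f, 'x) nterm \<times> ('a, 'f, 'x) nterm) set"

definition nproblem_wf :: "('a, 'f, 's) nsig \<Rightarrow> ('a, 'f, 's nvar) nproblem \<Rightarrow> bool" where
  "nproblem_wf sg P \<longleftrightarrow>
     finite P \<and> (\<forall>(t, u) \<in> P. \<exists>\<tau>. has_sort sg t \<tau> \<and> has_sort sg u \<tau>)"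

definition problem_vars :: "('a, 'f, 'x) nproblem \<Rightarrow> 'x set" where
  "problem_vars P = (\<Union>(t, u) \<in> P. nvars t \<union> nvars u)"

definition problem_atoms :: "('a, 'f, 'x) nproblem \<Rightarrow> 'a set" where
  "problem_atoms P = (\<Union>(t, u) \<in> P. natoms t \<union> natoms u)"

definition nsolution ::
  "('a, 'f, 's) nsig \<Rightarrow> ('a, 'f, 's nvar) nproblem
    \<Rightarrow> ('a, 's nvar) fenv \<Rightarrow> ('a, 'f, 's nvar) nsubst \<Rightarrow> bool" where
  "nsolution sg P \<Delta> \<sigma> \<longleftrightarrow>
     finite \<Delta> \<and> nsubst_wf sg \<sigma> \<and> (\<forall>(t, u) \<in> P. neq \<Delta> (napply \<sigma> t) (napply \<sigma> u))"

definition nmore_general ::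
  "('a, 'f, 's) nsig \<Rightarrow> ('a, 's nvar) fenv \<Rightarrow> ('a, 'f, 's nvar) nsubst
    \<Rightarrow> ('a, 's nvar) fenv \<Rightarrow> ('a, 'f, 's nvar) nsubst \<Rightarrow> bool" where
  "nmore_general sg \<Delta>1 \<sigma>1 \<Delta>2 \<sigma>2 \<longleftrightarrow>
     (\<exists>\<sigma>'. nsubst_wf sg \<sigma>' \<and> fenv_entails \<Delta>2 \<sigma>' \<Delta>1 \<and>
           nsubst_eq \<Delta>2 (nrestrict (ncomp \<sigma>' \<sigma>1) (dom \<sigma>1 \<union> dom \<sigma>2)) \<sigma>2)"

definition nmost_general ::
  "('a, 'f, 's) nsig \<Rightarrow> ('a, 'f, 's nvar) nproblem
    \<Rightarrow> ('a, 's nvar) fenv \<Rightarrow> ('a, 'f, 's nvar) nsubst \<Rightarrow> bool" where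
  "nmost_general sg P \<Delta> \<sigma> \<longleftrightarrow>
     nsolution sg P \<Delta> \<sigma> \<and>
     (\<forall>\<Delta>1 \<sigma>1. nsolution sg P \<Delta>1 \<sigma>1 \<longrightarrow> nmore_general sg \<Delta>1 \<sigma>1 \<Delta> \<sigma>
        \<longrightarrow> nmore_general sg \<Delta> \<sigma> \<Delta>1 \<sigma>1)"

section \<open>Simply typed lambda-terms modulo alpha, beta and eta\<close>

datatype 's ltype = LBase "'s base_sort" | LFun "'s ltype" "'s ltype"

text \<open>
  Free lambda-variables are atoms, or unknowns determined by a name and a type. The name of an
  unknown is a nominal variable including its sort: two nominal variables never share a name,
  although the types of their translations may coincide.
\<close>

datatype ('a, 's) lvar = LAtm 'a | LUnk "'s nvar" "'s ltype"

text \<open>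
  Bound variables are de Bruijn indices, so alpha-equivalent terms are equal; free variables
  keep their names. Binders are not annotated, types are assigned in Curry style.
\<close>

datatype ('a, 'f, 's) lterm =
    LBound nat
  | LFree "('a, 's) lvar"
  | LConst 'f
  | LApp "('a, 'f, 's) lterm" "('a, 'f, 's) lterm"
  | LAbs "('a, 'f, 's) lterm"

primrec llift :: "nat \<Rightarrow> ('a, 'f, 's) lterm \<Rightarrow> ('a, 'f, 's) lterm" where
  "llift k (LBound i) = LBound (if i < k then i else Suc i)"
| "llift k (LFree x) = LFree x"
| "llift k (LConst f) = LConst f"
| "llift k (LApp t u) = LApp (llift k t) (llift k u)"
| "llift k (LAbs t) = LAbs (llift (Suc k) t)"

text \<open>Contracting a beta-redex: index \<open>k\<close> is replaced, larger indices drop by one.\<close>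

primrec linst :: "nat \<Rightarrow> ('a, 'f, 's) lterm \<Rightarrow> ('a, 'f, 's) lterm \<Rightarrow> ('a, 'f, 's) lterm" where
  "linst k s (LBound i) = (if i < k then LBound i else if i = k then s else LBound (i - 1))"
| "linst k s (LFree x) = LFree x"
| "linst k s (LConst f) = LConst f"
| "linst k s (LApp t u) = LApp (linst k s t) (linst k s u)"
| "linst k s (LAbs t) = LAbs (linst (Suc k) (llift 0 s) t)"

text \<open>The body of the named abstraction \<open>\<lambda>a. t\<close>: the free variable \<open>a\<close> becomes index \<open>k\<close>.\<close>

primrec lclose :: "nat \<Rightarrow> 'a \<Rightarrow> ('a, 'f, 's) lterm \<Rightarrow> ('a, 'f, 's) lterm" where
  "lclose k a (LBound i) = LBound (if i < k then i else Suc i)"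
| "lclose k a (LFree x) = (if x = LAtm a then LBound k else LFree x)"
| "lclose k a (LConst f) = LConst f"
| "lclose k a (LApp t u) = LApp (lclose k a t) (lclose k a u)"
| "lclose k a (LAbs t) = LAbs (lclose (Suc k) a t)"

definition lam :: "'a \<Rightarrow> ('a, 'f, 's) lterm \<Rightarrow> ('a, 'f, 's) lterm" where
  "lam a t = LAbs (lclose 0 a t)"

definition lams :: "'a list \<Rightarrow> ('a, 'f, 's) lterm \<Rightarrow> ('a, 'f, 's) lterm" where
  "lams as t = foldr lam as t"

definition lapps ::
  "('a, 'f, 's) lterm \<Rightarrow> ('a, 'f, 's) lterm list \<Rightarrow> ('a, 'f, 's) lterm" where
  "lapps t us = foldl LApp t us"

inductive lconv :: "('a, 'f, 's) lterm \<Rightarrow> ('a, 'f, 's) lterm \<Rightarrow> bool" where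
  beta: "lconv (LApp (LAbs t) u) (linst 0 u t)"
| eta: "lconv (LAbs (LApp (llift 0 t) (LBound 0))) t"
| refl: "lconv t t"
| sym: "lconv t u \<Longrightarrow> lconv u t"
| trans: "lconv t u \<Longrightarrow> lconv u v \<Longrightarrow> lconv t v"
| app: "lconv t t' \<Longrightarrow> lconv u u' \<Longrightarrow> lconv (LApp t u) (LApp t' u')"
| abs: "lconv t t' \<Longrightarrow> lconv (LAbs t) (LAbs t')"

section \<open>Typing and lambda-substitutions\<close>

primrec trans_sort :: "'s nsort \<Rightarrow> 's ltype" where
  "trans_sort (BaseSort b) = LBase b"
| "trans_sort (AbsSort \<nu> \<tau>) = LFun (LBase (AtomSort \<nu>)) (trans_sort \<tau>)"

definition const_type :: "('a, 'f, 's) nsig \<Rightarrow> 'f \<Rightarrow> 's ltype" where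
  "const_type sg f = foldr LFun (map trans_sort (arg_sorts sg f)) (trans_sort (res_sort sg f))"

fun lvar_type :: "('a, 'f, 's) nsig \<Rightarrow> ('a, 's) lvar \<Rightarrow> 's ltype" where
  "lvar_type sg (LAtm a) = LBase (AtomSort (atom_sort sg a))"
| "lvar_type sg (LUnk X T) = T"

inductive has_type ::
  "('a, 'f, 's) nsig \<Rightarrow> 's ltype list \<Rightarrow> ('a, 'f, 's) lterm \<Rightarrow> 's ltype \<Rightarrow> bool"
  for sg where
  "i < length \<Gamma> \<Longrightarrow> has_type sg \<Gamma> (LBound i) (\<Gamma> ! i)"
| "has_type sg \<Gamma> (LFree x) (lvar_type sg x)"
| "has_type sg \<Gamma> (LConst f) (const_type sg f)"
| "has_type sg \<Gamma> t (LFun T U) \<Longrightarrow> has_type sg \<Gamma> u T \<Longrightarrow> has_type sg \<Gamma> (LApp t u) U"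
| "has_type sg (T # \<Gamma>) t U \<Longrightarrow> has_type sg \<Gamma> (LAbs t) (LFun T U)"

type_synonym ('a, 'f, 's) lsubst = "('a, 's) lvar \<rightharpoonup> ('a, 'f, 's) lterm"

definition llookup :: "('a, 'f, 's) lsubst \<Rightarrow> ('a, 's) lvar \<Rightarrow> ('a, 'f, 's) lterm" where
  "llookup \<theta> x = (case \<theta> x of None \<Rightarrow> LFree x | Some t \<Rightarrow> t)"

primrec lsubst_free ::
  "(('a, 's) lvar \<Rightarrow> ('a, 'f, 's) lterm) \<Rightarrow> ('a, 'f, 's) lterm \<Rightarrow> ('a, 'f, 's) lterm"
  where
  "lsubst_free \<rho> (LBound i) = LBound i"
| "lsubst_free \<rho> (LFree x) = \<rho> x"
| "lsubst_free \<rho> (LConst f) = LConst f"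
| "lsubst_free \<rho> (LApp t u) = LApp (lsubst_free \<rho> t) (lsubst_free \<rho> u)"
| "lsubst_free \<rho> (LAbs t) = LAbs (lsubst_free (\<lambda>x. llift 0 (\<rho> x)) t)"

definition lapply :: "('a, 'f, 's) lsubst \<Rightarrow> ('a, 'f, 's) lterm \<Rightarrow> ('a, 'f, 's) lterm" where
  "lapply \<theta> = lsubst_free (llookup \<theta>)"

definition lsubst_wf :: "('a, 'f, 's) nsig \<Rightarrow> ('a, 'f, 's) lsubst \<Rightarrow> bool" where
  "lsubst_wf sg \<theta> \<longleftrightarrow>
     finite (dom \<theta>) \<and> (\<forall>x t. \<theta> x = Some t \<longrightarrow> has_type sg [] t (lvar_type sg x))"

type_synonym ('a, 'f, 's) lproblem = "(('a, 'f, 's) lterm \<times> ('a, 'f, 's) lterm) set"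

definition lunifier ::
  "('a, 'f, 's) nsig \<Rightarrow> ('a, 'f, 's) lproblem \<Rightarrow> ('a, 'f, 's) lsubst \<Rightarrow> bool" where
  "lunifier sg L \<theta> \<longleftrightarrow>
     lsubst_wf sg \<theta> \<and> (\<forall>(t, u) \<in> L. lconv (lapply \<theta> t) (lapply \<theta> u))"

definition lmore_general ::
  "('a, 'f, 's) nsig \<Rightarrow> ('a, 'f, 's) lsubst \<Rightarrow> ('a, 'f, 's) lsubst \<Rightarrow> bool" where
  "lmore_general sg \<theta>1 \<theta>2 \<longleftrightarrow>
     (\<exists>\<theta>'. lsubst_wf sg \<theta>' \<and>
        (\<forall>x \<in> dom \<theta>1 \<union> dom \<theta>2. lconv (lapply \<theta>' (llookup \<theta>1 x)) (llookup \<theta>2 x)))"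

text \<open>
  Unifiers are compared under the convention that a name is instantiated at one type only: the
  domains of the two unifiers do not contain the same name at different types. In the translation
  of a nominal substitution the name \<open>X\<close> is instantiated at its type in the problem, while \<open>X\<close>
  with the smaller type given by the freshness environment is an auxiliary variable of the range.
  Without the convention, \<open>[Y\<^sub>2 \<mapsto> \<lambda>a b. Y\<^sub>0]\<close>, with the two unknowns named \<open>Y\<close> distinguished by
  their number of arguments, would not be most general for \<open>\<lambda>a b. Y\<^sub>2 a b = \<lambda>a b. Y\<^sub>2 b a\<close>:
  \<open>[Y\<^sub>2 \<mapsto> \<lambda>a b. Z, Y\<^sub>0 \<mapsto> Y\<^sub>0]\<close> is a strictly more general unifier, merely because it adds \<open>Y\<^sub>0\<close>
  to the variables on which the two are compared.
\<close>

definition compatible_names :: "('a, 's) lvar set \<Rightarrow> ('a, 's) lvar set \<Rightarrow> bool" where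
  "compatible_names D1 D2 \<longleftrightarrow>
     (\<forall>X T1 T2. LUnk X T1 \<in> D1 \<longrightarrow> LUnk X T2 \<in> D2 \<longrightarrow> T1 = T2)"

definition lmost_general ::
  "('a, 'f, 's) nsig \<Rightarrow> ('a, 'f, 's) lproblem \<Rightarrow> ('a, 'f, 's) lsubst \<Rightarrow> bool" where
  "lmost_general sg L \<theta> \<longleftrightarrow>
     lunifier sg L \<theta> \<and>
     (\<forall>\<theta>1. lunifier sg L \<theta>1 \<longrightarrow> compatible_names (dom \<theta>) (dom \<theta>1)
        \<longrightarrow> lmore_general sg \<theta>1 \<theta> \<longrightarrow> lmore_general sg \<theta> \<theta>1)"

section \<open>Translation\<close>

definition nonfresh :: "'a list \<Rightarrow> ('a, 'x) fenv \<Rightarrow> 'x \<Rightarrow> 'a list" where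
  "nonfresh as \<Delta> X = filter (\<lambda>a. (a, X) \<notin> \<Delta>) as"

definition trans_var ::
  "('a, 'f, 's) nsig \<Rightarrow> 'a list \<Rightarrow> ('a, 's nvar) fenv \<Rightarrow> 's nvar \<Rightarrow> ('a, 's) lvar" where
  "trans_var sg as \<Delta> X =
     LUnk X (foldr LFun (map (\<lambda>a. LBase (AtomSort (atom_sort sg a))) (nonfresh as \<Delta> X))
                        (LBase (nvar_sort X)))"

primrec trans_term ::
  "('a, 'f, 's) nsig \<Rightarrow> 'a list \<Rightarrow> ('a, 's nvar) fenv \<Rightarrow> ('a, 'f, 's nvar) nterm
    \<Rightarrow> ('a, 'f, 's) lterm" where
  "trans_term sg as \<Delta> (NFun f ts) = lapps (LConst f) (map (trans_term sg as \<Delta>) ts)"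
| "trans_term sg as \<Delta> (NAtm a) = LFree (LAtm a)"
| "trans_term sg as \<Delta> (NAbs a t) = lam a (trans_term sg as \<Delta> t)"
| "trans_term sg as \<Delta> (NSus \<pi> X) =
     lapps (LFree (trans_var sg as \<Delta> X))
       (map (\<lambda>b. LFree (LAtm (perm_atom \<pi> b))) (nonfresh as \<Delta> X))"

definition trans_problem ::
  "('a, 'f, 's) nsig \<Rightarrow> 'a list \<Rightarrow> ('a, 'f, 's nvar) nproblem \<Rightarrow> ('a, 'f, 's) lproblem" where
  "trans_problem sg as P =
     (\<lambda>(t, u). (lams as (trans_term sg as {} t), lams as (trans_term sg as {} u))) ` P"

text \<open>
  The instantiated unknowns are those of the translated problem, hence translated under the empty
  environment; \<open>\<Delta>\<close> affects only the range.
\<close>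

definition trans_subst ::
  "('a, 'f, 's) nsig \<Rightarrow> 'a list \<Rightarrow> ('a, 's nvar) fenv \<Rightarrow> ('a, 'f, 's nvar) nsubst
    \<Rightarrow> ('a, 'f, 's) lsubst" where
  "trans_subst sg as \<Delta> \<sigma> =
     (\<lambda>x. case x of
        LAtm a \<Rightarrow> None
      | LUnk X T \<Rightarrow>
          (if x = trans_var sg as {} X
           then map_option (\<lambda>t. lams as (trans_term sg as \<Delta> t)) (\<sigma> X)
           else None))"

end

theory Submission
  imports Defs
begin

text \<open>
  Both notions only compare values of variables, so the main direction is an argument about
  valuations of the variables in lambda-terms with free atoms. Given the nominal solution and an
  arbitrary lambda-unifier, take a least set \<open>V\<close> of variables such that every variable of the
  domain is expressed by one nominal term over \<open>V\<close> under both. By minimality \<open>V\<close> is free: terms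
  over \<open>V\<close> with equal values under both are alpha-equivalent. The expressions through \<open>V\<close>
  therefore form a nominal solution that generalizes both, without recourse to a unification
  algorithm. Conversely, nominal instances are read off lambda-instances. Confluence of beta-eta
  makes the term constructors injective. Normalization of typed terms shows that a term invariant
  under a permutation does not depend on the atoms moved by it.
\<close>

section \<open>Simultaneous substitution\<close>

text \<open>
  Lifting, contraction, named closing and substitution for free variables are all instances of
  \<open>sb\<close>, so the single law \<open>sb_sb\<close> replaces their mutual commutation laws.
\<close>

definition up :: "(nat \<Rightarrow> ('a, 'f, 's) lterm) \<Rightarrow> nat \<Rightarrow> ('a, 'f, 's) lterm" where
  "up f = case_nat (LBound 0) (\<lambda>i. llift 0 (f i))"

lemma up_simps [simp]: "up f 0 = LBound 0" "up f (Suc i) = llift 0 (f i)"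
  by (simp_all add: up_def)

primrec sb ::
  "(nat \<Rightarrow> ('a, 'f, 's) lterm) \<Rightarrow> (('a, 's) lvar \<Rightarrow> ('a, 'f, 's) lterm)
    \<Rightarrow> ('a, 'f, 's) lterm \<Rightarrow> ('a, 'f, 's) lterm" where
  "sb f g (LBound i) = f i"
| "sb f g (LFree x) = g x"
| "sb f g (LConst c) = LConst c"
| "sb f g (LApp t u) = LApp (sb f g t) (sb f g u)"
| "sb f g (LAbs t) = LAbs (sb (up f) (\<lambda>x. llift 0 (g x)) t)"

lemma llift_sb: "llift k t = sb (\<lambda>i. LBound (if i < k then i else Suc i)) LFree t"
proof (induction t arbitrary: k)
  case (LAbs t)
  have "up (\<lambda>i. LBound (if i < k then i else Suc i)) =
      (\<lambda>i. LBound (if i < Suc k then i else Suc i) :: ('a, 'b, 'c) lterm)"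
    by (rule ext) (simp add: up_def split: nat.split)
  then show ?case using LAbs by simp
qed auto

lemma llift_0: "llift 0 = sb (\<lambda>i. LBound (Suc i)) LFree"
  by (rule ext) (simp add: llift_sb)

lemma linst_sb:
  "linst k s t = sb (\<lambda>i. if i < k then LBound i else if i = k then s else LBound (i - 1)) LFree t"
proof (induction t arbitrary: k s)
  case (LAbs t)
  have "up (\<lambda>i. if i < k then LBound i else if i = k then s else LBound (i - 1)) =
      (\<lambda>i. if i < Suc k then LBound i else if i = Suc k then llift 0 s else LBound (i - 1))"
    by (rule ext) (auto simp add: up_def split: nat.split)
  then show ?case using LAbs by simp
qed auto

lemma linst_0: "linst 0 s = sb (case_nat s LBound) LFree"
proof -
  have "(\<lambda>i. if i < 0 then LBound i else if i = 0 then s else LBound (i - 1)) = case_nat s LBound"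
    by (rule ext) (auto split: nat.split)
  then show ?thesis by (intro ext) (simp add: linst_sb)
qed

lemma lsubst_free_sb: "lsubst_free \<rho> t = sb LBound \<rho> t"
proof (induction t arbitrary: \<rho>)
  case (LAbs t)
  have "up LBound = (LBound :: nat \<Rightarrow> ('a, 'b, 'c) lterm)"
    by (rule ext) (auto simp: up_def split: nat.split)
  then show ?case using LAbs by simp
qed auto

lemma up_LBound [simp]: "up LBound = LBound"
  by (rule ext) (auto simp: up_def split: nat.split)

lemma sb_id [simp]: "sb LBound LFree t = t"
  by (induction t) auto

lemma sb_rename:
  "sb f g (sb (\<lambda>i. LBound (r i)) LFree t) = sb (\<lambda>i. f (r i)) g t"
proof (induction t arbitrary: f g r)
  case (LAbs t)
  have 1: "up (\<lambda>i. LBound (r i)) = (\<lambda>i. LBound (case_nat 0 (\<lambda>j. Suc (r j)) i))"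
    by (rule ext) (auto simp: up_def split: nat.split)
  have 2: "(\<lambda>i. up f (case_nat 0 (\<lambda>j. Suc (r j)) i)) = up (\<lambda>i. f (r i))"
    by (rule ext) (auto simp: up_def split: nat.split)
  show ?case using LAbs by (simp add: 1 2)
qed auto

lemma rename_sb:
  "sb (\<lambda>i. LBound (r i)) LFree (sb f g t) =
    sb (\<lambda>i. sb (\<lambda>i. LBound (r i)) LFree (f i)) (\<lambda>x. sb (\<lambda>i. LBound (r i)) LFree (g x)) t"
proof (induction t arbitrary: f g r)
  case (LAbs t)
  have 1: "up (\<lambda>i. LBound (r i)) = (\<lambda>i. LBound (case_nat 0 (\<lambda>j. Suc (r j)) i))"
    by (rule ext) (auto simp: up_def split: nat.split)
  have 2: "sb (\<lambda>i. LBound (case_nat 0 (\<lambda>j. Suc (r j)) i)) LFree (llift 0 s) =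
      llift 0 (sb (\<lambda>i. LBound (r i)) LFree s)" for s :: "('a, 'b, 'c) lterm"
    by (simp add: llift_0 sb_rename)
  have 3: "(\<lambda>i. sb (\<lambda>i. LBound (case_nat 0 (\<lambda>j. Suc (r j)) i)) LFree (up f i)) =
      up (\<lambda>i. sb (\<lambda>i. LBound (r i)) LFree (f i))"
    by (rule ext) (auto simp: up_def 2 split: nat.split)
  show ?case using LAbs by (simp add: 1 2 3)
qed auto

lemma sb_up_llift: "sb (up f) (\<lambda>x. llift 0 (g x)) (llift 0 t) = llift 0 (sb f g t)"
  by (simp add: llift_0 sb_rename rename_sb)

lemma sb_sb: "sb f g (sb f' g' t) = sb (\<lambda>i. sb f g (f' i)) (\<lambda>x. sb f g (g' x)) t"
proof (induction t arbitrary: f g f' g')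
  case (LAbs t)
  have "(\<lambda>i. sb (up f) (\<lambda>x. llift 0 (g x)) (up f' i)) = up (\<lambda>i. sb f g (f' i))"
    by (rule ext) (auto simp: up_def sb_up_llift[unfolded up_def] split: nat.split)
  then show ?case using LAbs by (simp add: sb_up_llift)
qed auto

lemma linst_llift [simp]: "linst 0 u (llift 0 t) = t"
  by (simp add: linst_0 llift_0 sb_sb)

lemma llift_0_inject [simp]: "llift 0 s = llift 0 t \<longleftrightarrow> s = t"
proof
  assume "llift 0 s = llift 0 t"
  then have "linst 0 (LBound 0) (llift 0 s) = linst 0 (LBound 0) (llift 0 t)" by simp
  then show "s = t" by simp
qed simp

lemma linst_sb_up:
  "linst 0 u (sb (up f) (\<lambda>x. llift 0 (g x)) t) = sb (case_nat u f) g t"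
proof -
  have "(\<lambda>i. linst 0 u (up f i)) = case_nat u f"
    by (rule ext) (auto simp: up_def linst_0 llift_0 sb_sb split: nat.split)
  then show ?thesis
    by (simp add: linst_0 sb_sb) (simp add: linst_0[symmetric])
qed

lemma sb_linst: "sb f g (linst 0 u t) = linst 0 (sb f g u) (sb (up f) (\<lambda>x. llift 0 (g x)) t)"
proof -
  have "(\<lambda>i. sb f g (case_nat u LBound i)) = case_nat (sb f g u) f"
    by (rule ext) (auto split: nat.split)
  then show ?thesis
    by (simp add: linst_sb_up) (simp add: linst_0 sb_sb)
qed

primrec fvs :: "('a, 'f, 's) lterm \<Rightarrow> ('a, 's) lvar set" where
  "fvs (LBound i) = {}"
| "fvs (LFree x) = {x}"
| "fvs (LConst c) = {}"
| "fvs (LApp t u) = fvs t \<union> fvs u"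
| "fvs (LAbs t) = fvs t"

lemma finite_fvs [simp]: "finite (fvs t)"
  by (induction t) auto

lemma sb_cong: "(\<And>x. x \<in> fvs t \<Longrightarrow> g x = g' x) \<Longrightarrow> sb f g t = sb f g' t"
proof (induction t arbitrary: f g g')
  case (LAbs t)
  have "sb (up f) (\<lambda>x. llift 0 (g x)) t = sb (up f) (\<lambda>x. llift 0 (g' x)) t"
    by (rule LAbs.IH) (simp add: LAbs.prems)
  then show ?case by simp
next
  case (LApp t u)
  have "sb f g t = sb f g' t" by (rule LApp.IH(1)) (simp add: LApp.prems)
  moreover have "sb f g u = sb f g' u" by (rule LApp.IH(2)) (simp add: LApp.prems)
  ultimately show ?case by simp
qed simp_all

lemma fvs_llift [simp]: "fvs (llift k t) = fvs t"
  by (induction t arbitrary: k) simp_all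

lemma fvs_sb: "y \<in> fvs (sb f g t) \<Longrightarrow> (\<exists>i. y \<in> fvs (f i)) \<or> (\<exists>x \<in> fvs t. y \<in> fvs (g x))"
proof (induction t arbitrary: f g)
  case (LAbs t)
  have "\<exists>j. y \<in> fvs (f j)" if "y \<in> fvs (up f i)" for i
    using that by (cases i) auto
  moreover have "(\<exists>i. y \<in> fvs (up f i)) \<or> (\<exists>x \<in> fvs t. y \<in> fvs (llift 0 (g x)))"
    by (rule LAbs.IH) (use LAbs.prems in simp)
  ultimately show ?case by fastforce
next
  case (LApp t u)
  from LApp.prems have "y \<in> fvs (sb f g t) \<or> y \<in> fvs (sb f g u)" by simp
  then show ?case using LApp.IH(1)[of f g] LApp.IH(2)[of f g] by fastforce
next
  case (LBound i)
  then show ?case by (simp add: exI)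
qed simp_all

lemma lconv_sb: "lconv t u \<Longrightarrow> lconv (sb f g t) (sb f g u)"
proof (induction t u arbitrary: f g rule: lconv.induct)
  case (beta t u)
  show ?case by (simp add: sb_linst lconv.beta)
next
  case (eta t)
  show ?case by (simp add: sb_up_llift lconv.eta)
next
  case (trans t u v)
  then show ?case by (meson lconv.trans)
qed (auto intro: lconv.refl lconv.sym lconv.app lconv.abs)

section \<open>Confluence\<close>

inductive par :: "('a, 'f, 's) lterm \<Rightarrow> ('a, 'f, 's) lterm \<Rightarrow> bool" where
  bound: "par (LBound i) (LBound i)"
| free: "par (LFree x) (LFree x)"
| const: "par (LConst c) (LConst c)"
| app: "par t t' \<Longrightarrow> par u u' \<Longrightarrow> par (LApp t u) (LApp t' u')"
| abs: "par t t' \<Longrightarrow> par (LAbs t) (LAbs t')"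
| beta: "par t t' \<Longrightarrow> par u u' \<Longrightarrow> par (LApp (LAbs t) u) (linst 0 u' t')"

inductive_cases par_LBoundE [elim!]: "par (LBound i) t"
inductive_cases par_LFreeE [elim!]: "par (LFree x) t"
inductive_cases par_LConstE [elim!]: "par (LConst c) t"
inductive_cases par_LAbsE: "par (LAbs t) u"

lemma par_LAppE:
  assumes "par (LApp t u) v"
  obtains (app) t' u' where "v = LApp t' u'" "par t t'" "par u u'"
  | (beta) s s' u' where "t = LAbs s" "v = linst 0 u' s'" "par s s'" "par u u'"
  using assms by (cases rule: par.cases) auto

inductive eta_step :: "('a, 'f, 's) lterm \<Rightarrow> ('a, 'f, 's) lterm \<Rightarrow> bool" where
  eta: "eta_step (LAbs (LApp (llift 0 t) (LBound 0))) t"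
| appl: "eta_step t t' \<Longrightarrow> eta_step (LApp t u) (LApp t' u)"
| appr: "eta_step u u' \<Longrightarrow> eta_step (LApp t u) (LApp t u')"
| abs: "eta_step t t' \<Longrightarrow> eta_step (LAbs t) (LAbs t')"

inductive_cases eta_LBoundE [elim!]: "eta_step (LBound i) t"
inductive_cases eta_LFreeE [elim!]: "eta_step (LFree x) t"
inductive_cases eta_LConstE [elim!]: "eta_step (LConst c) t"

lemma eta_LAbsE:
  assumes "eta_step (LAbs t) u"
  obtains (eta) "t = LApp (llift 0 u) (LBound 0)"
  | (abs) t' where "u = LAbs t'" "eta_step t t'"
  using assms by (cases rule: eta_step.cases) auto

lemma eta_LAppE:
  assumes "eta_step (LApp t u) v"
  obtains (appl) t' where "v = LApp t' u" "eta_step t t'"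
  | (appr) u' where "v = LApp t u'" "eta_step u u'"
  using assms by (cases rule: eta_step.cases) auto

lemma par_refl [simp, intro]: "par t t"
  by (induction t) (auto intro: par.intros)

lemma par_sb_same: "par t t' \<Longrightarrow> par (sb f g t) (sb f g t')"
proof (induction t t' arbitrary: f g rule: par.induct)
  case (beta t t' u u')
  show ?case by (simp add: sb_linst par.beta beta)
next
  case (app t t' u u')
  show ?case by (simp add: par.app app)
next
  case (abs t t')
  show ?case by (simp add: par.abs abs)
qed (rule par_refl)+

lemma par_llift: "par t t' \<Longrightarrow> par (llift 0 t) (llift 0 t')"
  by (simp add: llift_0 par_sb_same)

lemma par_sb:
  "par t t' \<Longrightarrow> (\<And>i. par (f i) (f' i)) \<Longrightarrow> (\<And>x. par (g x) (g' x)) \<Longrightarrow> par (sb f g t) (sb f' g' t')"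
proof (induction t t' arbitrary: f g f' g' rule: par.induct)
  case (app t t' u u')
  show ?case by (simp add: par.app app)
next
  case (abs t t')
  have "par (up f i) (up f' i)" for i
    using abs.prems(1) by (cases i) (simp_all add: par_llift)
  then show ?case using abs.prems by (simp add: par.abs abs.IH par_llift)
next
  case (beta t t' u u')
  have "par (up f i) (up f' i)" for i
    using beta.prems(1) by (cases i) (simp_all add: par_llift)
  then show ?case using beta.prems by (simp add: sb_linst par.beta beta.IH par_llift)
qed simp_all

lemma par_linst: "par t t' \<Longrightarrow> par u u' \<Longrightarrow> par (linst 0 u t) (linst 0 u' t')"
  unfolding linst_0 by (rule par_sb) (simp_all split: nat.split)

fun develop :: "('a, 'f, 's) lterm \<Rightarrow> ('a, 'f, 's) lterm" where
  "develop (LBound i) = LBound i"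
| "develop (LFree x) = LFree x"
| "develop (LConst c) = LConst c"
| "develop (LAbs t) = LAbs (develop t)"
| "develop (LApp (LAbs t) u) = linst 0 (develop u) (develop t)"
| "develop (LApp t u) = LApp (develop t) (develop u)"

lemma par_develop: "par t u \<Longrightarrow> par u (develop t)"
proof (induction t u rule: par.induct)
  case (app t t' u u')
  show ?case
  proof (cases t)
    case (LAbs p)
    with app.hyps(1) obtain p' where p': "t' = LAbs p'" by (auto elim: par_LAbsE)
    with app.IH(1) LAbs have "par p' (develop p)" by (auto elim: par_LAbsE)
    then show ?thesis using app.IH(2) LAbs p' by (simp add: par.beta)
  qed (use app.IH par.app in force)+
next
  case (beta t t' u u')
  then show ?case by (simp add: par_linst)
qed (simp_all add: par.abs)

lemma par_diamond:
  assumes "par t u" "par t v"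
  shows "\<exists>w. par u w \<and> par v w"
  using par_develop[OF assms(1)] par_develop[OF assms(2)] by blast

definition is_var :: "('a, 'f, 's) lterm \<Rightarrow> bool" where
  "is_var t \<longleftrightarrow> (\<exists>i. t = LBound i) \<or> (\<exists>x. t = LFree x)"

lemma is_var_simps [simp]:
  "is_var (LBound i)" "is_var (LFree x)" "\<not> is_var (LConst c)" "\<not> is_var (LApp t u)" "\<not> is_var (LAbs t)"
  by (auto simp: is_var_def)

lemma is_var_llift: "is_var t \<Longrightarrow> is_var (llift k t)"
  by (auto simp: is_var_def)

lemma is_var_up: "(\<And>i. is_var (f i)) \<Longrightarrow> is_var (up f i)"
  by (cases i) (simp_all add: is_var_llift)

lemma sb_var_LAppD:
  assumes "sb f g s = LApp t u" "\<And>i. is_var (f i)" "\<And>x. is_var (g x)"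
  shows "\<exists>t' u'. s = LApp t' u' \<and> t = sb f g t' \<and> u = sb f g u'"
proof (cases s)
  case (LBound i) with assms(1) assms(2)[of i] show ?thesis by simp
next
  case (LFree x) with assms(1) assms(3)[of x] show ?thesis by simp
qed (use assms(1) in auto)

lemma sb_var_LAbsD:
  assumes "sb f g s = LAbs t" "\<And>i. is_var (f i)" "\<And>x. is_var (g x)"
  shows "\<exists>t'. s = LAbs t' \<and> t = sb (up f) (\<lambda>x. llift 0 (g x)) t'"
proof (cases s)
  case (LBound i) with assms(1) assms(2)[of i] show ?thesis by simp
next
  case (LFree x) with assms(1) assms(3)[of x] show ?thesis by simp
qed (use assms(1) in auto)

lemma par_sb_varD:
  assumes "par s r" "s = sb f g t" "\<And>i. is_var (f i)" "\<And>x. is_var (g x)"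
  shows "\<exists>t'. par t t' \<and> r = sb f g t'"
  using assms
proof (induction s r arbitrary: t f g rule: par.induct)
  case (app s s' u u')
  from sb_var_LAppD[OF app.prems(1)[symmetric] app.prems(2,3)] obtain t1 t2 where
    t: "t = LApp t1 t2" "s = sb f g t1" "u = sb f g t2" by auto
  from app.IH(1)[OF t(2) app.prems(2,3)] app.IH(2)[OF t(3) app.prems(2,3)]
  obtain t1' t2' where "par t1 t1'" "s' = sb f g t1'" "par t2 t2'" "u' = sb f g t2'" by auto
  then have "par t (LApp t1' t2')" "LApp s' u' = sb f g (LApp t1' t2')"
    using t(1) by (simp_all add: par.app)
  then show ?case by blast
next
  case (abs s s')
  from sb_var_LAbsD[OF abs.prems(1)[symmetric] abs.prems(2,3)] obtain t1 where
    t: "t = LAbs t1" "s = sb (up f) (\<lambda>x. llift 0 (g x)) t1" by auto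
  from abs.IH[OF t(2) is_var_up[OF abs.prems(2)] is_var_llift[OF abs.prems(3)]]
  obtain t1' where "par t1 t1'" "s' = sb (up f) (\<lambda>x. llift 0 (g x)) t1'" by auto
  then have "par t (LAbs t1')" "LAbs s' = sb f g (LAbs t1')"
    using t(1) by (simp_all add: par.abs)
  then show ?case by blast
next
  case (beta s s' u u')
  from sb_var_LAppD[OF beta.prems(1)[symmetric] beta.prems(2,3)] obtain t1 t2 where
    t: "t = LApp t1 t2" "LAbs s = sb f g t1" "u = sb f g t2" by auto
  from sb_var_LAbsD[OF t(2)[symmetric] beta.prems(2,3)] obtain t3 where
    t3: "t1 = LAbs t3" "s = sb (up f) (\<lambda>x. llift 0 (g x)) t3" by auto
  from beta.IH(1)[OF t3(2) is_var_up[OF beta.prems(2)] is_var_llift[OF beta.prems(3)]]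
    beta.IH(2)[OF t(3) beta.prems(2,3)]
  obtain t3' t2' where "par t3 t3'" "s' = sb (up f) (\<lambda>x. llift 0 (g x)) t3'"
    "par t2 t2'" "u' = sb f g t2'" by auto
  then have "par t (linst 0 t2' t3')" "linst 0 u' s' = sb f g (linst 0 t2' t3')"
    using t(1) t3(1) by (simp_all add: par.beta sb_linst)
  then show ?case by blast
qed (use par_refl in blast)+

lemma llift_eq_LBound_0 [simp]: "llift 0 t \<noteq> LBound 0"
  by (cases t) auto

lemma sb_var_llift_skip_0:
  assumes "sb f g s = sb (\<lambda>i. LBound (if i < k then i else Suc i)) LFree r"
    and "\<And>i. is_var (f i)" and "\<And>x. is_var (g x)" and "f k = LBound k"
    and "\<And>x. g x \<noteq> LBound k"
  shows "\<exists>s'. s = llift k s'"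
  using assms
proof (induction s arbitrary: f g k r)
  case (LBound i)
  show ?case
  proof (cases "i = k")
    case True
    with LBound have "LBound k = sb (\<lambda>i. LBound (if i < k then i else Suc i)) LFree r" by simp
    then show ?thesis by (cases r) (auto split: if_splits)
  next
    case False
    then have "LBound i = llift k (LBound (if i < k then i else i - 1))" by auto
    then show ?thesis by blast
  qed
next
  case (LFree x)
  have "LFree x = llift k (LFree x)" by simp
  then show ?case by blast
next
  case (LConst c)
  have "LConst c = llift k (LConst c)" by simp
  then show ?case by blast
next
  case (LApp t u)
  from LApp.prems(1) obtain t' u' where
    r: "sb f g t = sb (\<lambda>i. LBound (if i < k then i else Suc i)) LFree t'"
      "sb f g u = sb (\<lambda>i. LBound (if i < k then i else Suc i)) LFree u'"
    by (cases r) (auto split: if_splits)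
  from LApp.IH(1)[OF r(1) LApp.prems(2-5)] LApp.IH(2)[OF r(2) LApp.prems(2-5)]
  obtain t'' u'' where "t = llift k t''" "u = llift k u''" by auto
  then have "LApp t u = llift k (LApp t'' u'')" by simp
  then show ?case by blast
next
  case (LAbs t)
  have eq: "up (\<lambda>i. LBound (if i < k then i else Suc i)) =
      (\<lambda>i. LBound (if i < Suc k then i else Suc i) :: ('a, 'b, 'c) lterm)"
    by (rule ext) (simp add: up_def split: nat.split)
  from LAbs.prems(1) obtain t' where
    r: "sb (up f) (\<lambda>x. llift 0 (g x)) t = sb (\<lambda>i. LBound (if i < Suc k then i else Suc i)) LFree t'"
    by (cases r) (auto simp: eq split: if_splits)
  have "llift 0 (g x) \<noteq> LBound (Suc k)" for x
    using LAbs.prems(5)[of x] by (cases "g x") auto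
  then obtain t'' where "t = llift (Suc k) t''"
    using LAbs.IH[OF r is_var_up[OF LAbs.prems(2)] is_var_llift[OF LAbs.prems(3)]] LAbs.prems(4)
    by auto
  then have "LAbs t = llift k (LAbs t'')" by simp
  then show ?case by blast
qed

lemma eta_sb_varD:
  assumes "eta_step s r" "s = sb f g t" "\<And>i. is_var (f i)" "\<And>x. is_var (g x)"
  shows "\<exists>t'. eta_step t t' \<and> r = sb f g t'"
  using assms
proof (induction s r arbitrary: t f g rule: eta_step.induct)
  case (eta s)
  let ?f = "up f" and ?g = "\<lambda>x. llift 0 (g x)"
  note v = is_var_up[OF eta.prems(2)] is_var_llift[OF eta.prems(3)]
  from sb_var_LAbsD[OF eta.prems(1)[symmetric] eta.prems(2,3)] obtain t1 where
    t1: "t = LAbs t1" "LApp (llift 0 s) (LBound 0) = sb ?f ?g t1" by auto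
  from sb_var_LAppD[OF t1(2)[symmetric] v] obtain p q where
    pq: "t1 = LApp p q" "llift 0 s = sb ?f ?g p" "LBound 0 = sb ?f ?g q" by auto
  have q: "q = LBound 0"
  proof (cases q)
    case (LBound i)
    with pq(3) have "LBound 0 = up f i" by simp
    then have "i = 0" using llift_eq_LBound_0[of "f (i - 1)"] by (cases i) auto
    then show ?thesis using LBound by simp
  next
    case (LFree x)
    with pq(3) show ?thesis using llift_eq_LBound_0[of "g x"] by simp
  qed (use pq(3) in simp_all)
  have "sb ?f ?g p = sb (\<lambda>i. LBound (if i < 0 then i else Suc i)) LFree s"
    using pq(2) by (simp add: llift_sb)
  then have "\<exists>p'. p = llift 0 p'"
    by (rule sb_var_llift_skip_0) (use v in simp_all)
  then obtain p' where p': "p = llift 0 p'" by blast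
  have "llift 0 s = llift 0 (sb f g p')"
    using pq(2) p' by (simp add: sb_up_llift)
  then have "s = sb f g p'" by simp
  moreover have "eta_step t p'" unfolding t1(1) pq(1) q p' by (rule eta_step.eta)
  ultimately show ?case by blast
next
  case (appl s s' u)
  from sb_var_LAppD[OF appl.prems(1)[symmetric] appl.prems(2,3)] obtain t1 t2 where
    t: "t = LApp t1 t2" "s = sb f g t1" "u = sb f g t2" by auto
  from appl.IH[OF t(2) appl.prems(2,3)] obtain t1' where "eta_step t1 t1'" "s' = sb f g t1'" by auto
  then have "eta_step t (LApp t1' t2)" "LApp s' u = sb f g (LApp t1' t2)"
    using t by (simp_all add: eta_step.appl)
  then show ?case by blast
next
  case (appr s s' u)
  from sb_var_LAppD[OF appr.prems(1)[symmetric] appr.prems(2,3)] obtain t1 t2 where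
    t: "t = LApp t1 t2" "u = sb f g t1" "s = sb f g t2" by auto
  from appr.IH[OF t(3) appr.prems(2,3)] obtain t2' where "eta_step t2 t2'" "s' = sb f g t2'" by auto
  then have "eta_step t (LApp t1 t2')" "LApp u s' = sb f g (LApp t1 t2')"
    using t by (simp_all add: eta_step.appr)
  then show ?case by blast
next
  case (abs s s')
  from sb_var_LAbsD[OF abs.prems(1)[symmetric] abs.prems(2,3)] obtain t1 where
    t: "t = LAbs t1" "s = sb (up f) (\<lambda>x. llift 0 (g x)) t1" by auto
  from abs.IH[OF t(2) is_var_up[OF abs.prems(2)] is_var_llift[OF abs.prems(3)]]
  obtain t1' where "eta_step t1 t1'" "s' = sb (up f) (\<lambda>x. llift 0 (g x)) t1'" by auto
  then have "eta_step t (LAbs t1')" "LAbs s' = sb f g (LAbs t1')"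
    using t(1) by (simp_all add: eta_step.abs)
  then show ?case by blast
qed

lemma par_lliftD: "par (llift 0 t) r \<Longrightarrow> \<exists>t'. par t t' \<and> r = llift 0 t'"
  unfolding llift_0 by (rule par_sb_varD[OF _ HOL.refl]) simp_all

lemma eta_lliftD: "eta_step (llift 0 t) r \<Longrightarrow> \<exists>t'. eta_step t t' \<and> r = llift 0 t'"
  unfolding llift_0 by (rule eta_sb_varD[OF _ HOL.refl]) simp_all

lemma eta_sb: "eta_step t u \<Longrightarrow> eta_step (sb f g t) (sb f g u)"
proof (induction t u arbitrary: f g rule: eta_step.induct)
  case (eta t)
  show ?case by (simp add: sb_up_llift eta_step.eta)
qed (simp_all add: eta_step.appl eta_step.appr eta_step.abs)

abbreviation etas :: "('a, 'f, 's) lterm \<Rightarrow> ('a, 'f, 's) lterm \<Rightarrow> bool" where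
  "etas \<equiv> eta_step\<^sup>*\<^sup>*"

lemma etas_LApp: "etas t t' \<Longrightarrow> etas u u' \<Longrightarrow> etas (LApp t u) (LApp t' u')"
proof -
  assume "etas t t'" "etas u u'"
  from this(1) have "etas (LApp t u) (LApp t' u)"
    by induction (simp, meson eta_step.appl rtranclp.rtrancl_into_rtrancl)
  also from \<open>etas u u'\<close> have "etas (LApp t' u) (LApp t' u')"
    by induction (simp, meson eta_step.appr rtranclp.rtrancl_into_rtrancl)
  finally show ?thesis .
qed

lemma etas_LAbs: "etas t t' \<Longrightarrow> etas (LAbs t) (LAbs t')"
  by (induction rule: rtranclp.induct) (simp, meson eta_step.abs rtranclp.rtrancl_into_rtrancl)

lemma etas_sb: "etas t u \<Longrightarrow> etas (sb f g t) (sb f g u)"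
  by (induction rule: rtranclp.induct) (simp, meson eta_sb rtranclp.rtrancl_into_rtrancl)

lemma etas_sb_cong: "(\<And>i. etas (f i) (f' i)) \<Longrightarrow> etas (sb f LFree t) (sb f' LFree t)"
proof (induction t arbitrary: f f')
  case (LAbs t)
  have "etas (up f i) (up f' i)" for i
    using LAbs.prems[of "i - 1"] by (cases i) (simp_all add: llift_0 etas_sb)
  then show ?case using LAbs.IH[of "up f" "up f'"] by (simp add: etas_LAbs)
qed (simp_all add: etas_LApp)

lemma etas_linst:
  assumes "etas t t'" "etas u u'"
  shows "etas (linst 0 u t) (linst 0 u' t')"
proof -
  have "etas (linst 0 u t) (linst 0 u t')"
    using assms(1) by (simp add: linst_0 etas_sb)
  also have "etas (linst 0 u t') (linst 0 u' t')"
    unfolding linst_0 by (rule etas_sb_cong) (use assms(2) in \<open>simp split: nat.split\<close>)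
  finally show ?thesis .
qed

lemma eta_diamond:
  assumes "eta_step t u" "eta_step t v"
  shows "\<exists>w. (u = w \<or> eta_step u w) \<and> (v = w \<or> eta_step v w)"
  using assms
proof (induction t u arbitrary: v rule: eta_step.induct)
  case (eta t)
  from eta.prems show ?case
  proof (cases rule: eta_LAbsE)
    case eta
    then have "t = v" by simp
    then show ?thesis by blast
  next
    case A: (abs t')
    from A(2) obtain r where r: "t' = LApp r (LBound 0)" "eta_step (llift 0 t) r"
      by (elim eta_LAppE) auto
    from eta_lliftD[OF r(2)] obtain r' where r': "eta_step t r'" "r = llift 0 r'" by blast
    have "eta_step v r'" unfolding A(1) r(1) r'(2) by (rule eta_step.eta)
    then show ?thesis using r'(1) by blast
  qed
next
  case (appl t t' u)
  from appl.prems show ?case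
  proof (cases rule: eta_LAppE)
    case L: (appl t'')
    from appl.IH[OF L(2)] obtain w where
      "t' = w \<or> eta_step t' w" "t'' = w \<or> eta_step t'' w" by (elim exE conjE)
    then have "LApp t' u = LApp w u \<or> eta_step (LApp t' u) (LApp w u)" "LApp t'' u = LApp w u \<or> eta_step (LApp t'' u) (LApp w u)"
      by (elim disjE; simp add: eta_step.appl)+
    then show ?thesis using L(1) by metis
  next
    case R: (appr u')
    have "eta_step (LApp t' u) (LApp t' u')" "eta_step v (LApp t' u')"
      unfolding R(1) using R(2) appl.hyps by (simp_all add: eta_step.appl eta_step.appr)
    then show ?thesis by blast
  qed
next
  case (appr u u' t)
  from appr.prems show ?case
  proof (cases rule: eta_LAppE)
    case R: (appr u'')
    from appr.IH[OF R(2)] obtain w where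
      "u' = w \<or> eta_step u' w" "u'' = w \<or> eta_step u'' w" by (elim exE conjE)
    then have "LApp t u' = LApp t w \<or> eta_step (LApp t u') (LApp t w)" "LApp t u'' = LApp t w \<or> eta_step (LApp t u'') (LApp t w)"
      by (elim disjE; simp add: eta_step.appr)+
    then show ?thesis using R(1) by metis
  next
    case L: (appl t')
    have "eta_step (LApp t u') (LApp t' u')" "eta_step v (LApp t' u')"
      unfolding L(1) using L(2) appr.hyps by (simp_all add: eta_step.appl eta_step.appr)
    then show ?thesis by blast
  qed
next
  case (abs t t')
  from abs.prems show ?case
  proof (cases rule: eta_LAbsE)
    case eta
    from abs.hyps[unfolded eta] obtain r where r: "t' = LApp r (LBound 0)" "eta_step (llift 0 v) r"
      by (elim eta_LAppE) auto
    from eta_lliftD[OF r(2)] obtain r' where r': "eta_step v r'" "r = llift 0 r'" by blast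
    have "eta_step (LAbs t') r'" unfolding r(1) r'(2) by (rule eta_step.eta)
    then show ?thesis using r'(1) by blast
  next
    case A: (abs t'')
    from abs.IH[OF A(2)] obtain w where
      "t' = w \<or> eta_step t' w" "t'' = w \<or> eta_step t'' w" by (elim exE conjE)
    then have "LAbs t' = LAbs w \<or> eta_step (LAbs t') (LAbs w)" "LAbs t'' = LAbs w \<or> eta_step (LAbs t'') (LAbs w)"
      by (elim disjE; simp add: eta_step.abs)+
    then show ?thesis using A(1) by metis
  qed
qed

lemma llift_eq_LAbsD:
  assumes "llift 0 r = LAbs p"
  shows "\<exists>q. r = LAbs q \<and> p = llift (Suc 0) q"
  using assms by (cases r) (auto split: if_splits)

lemma linst_0_LBound_0 [simp]: "linst 0 (LBound 0) (llift (Suc 0) q) = q"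
proof -
  have *: "(\<lambda>i. case if i = 0 then i else Suc i of 0 \<Rightarrow> LBound 0 | Suc x \<Rightarrow> LBound x) =
      (LBound :: nat \<Rightarrow> ('a, 'b, 'c) lterm)"
    by (rule ext) (simp split: nat.split)
  show ?thesis
    unfolding linst_0 llift_sb[of "Suc 0"] sb_sb by (simp add: *)
qed

lemma par_eta_redexE:
  assumes "par (LApp (llift 0 r) (LBound 0)) p"
  obtains (app) r' where "par r r'" "p = LApp (llift 0 r') (LBound 0)"
  | (beta) q where "r = LAbs q" "par q p"
  using assms
proof (cases rule: par_LAppE)
  case A: (app t' u')
  with par_lliftD[of r t'] app show ?thesis by auto
next
  case B: (beta t t' u')
  obtain q where q: "r = LAbs q" "t = llift (Suc 0) q"
    using llift_eq_LAbsD[OF B(1)] by blast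
  have "par (linst 0 (LBound 0) t) (linst 0 (LBound 0) t')"
    by (rule par_linst) (use B in auto)
  moreover have "u' = LBound 0" using B by auto
  ultimately show ?thesis using q B beta by auto
qed

lemma par_eta_commute:
  assumes "par s t" "eta_step s u"
  shows "\<exists>v. etas t v \<and> par u v"
  using assms
proof (induction s t arbitrary: u rule: par.induct)
  case (app t t' u u' s)
  from app.prems show ?case
  proof (cases rule: eta_LAppE)
    case L: (appl s')
    with app.IH(1)[of s'] obtain v where "etas t' v" "par s' v" by auto
    then have "etas (LApp t' u') (LApp v u')" "par (LApp s' u) (LApp v u')"
      using app.hyps by (auto intro: par.app etas_LApp)
    then show ?thesis using L by blast
  next
    case R: (appr s')
    with app.IH(2)[of s'] obtain v where "etas u' v" "par s' v" by auto
    then have "etas (LApp t' u') (LApp t' v)" "par (LApp t s') (LApp t' v)"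
      using app.hyps by (auto intro: par.app etas_LApp)
    then show ?thesis using R by blast
  qed
next
  case (abs t t' s)
  from abs.prems show ?case
  proof (cases rule: eta_LAbsE)
    case eta
    with abs.hyps have "par (LApp (llift 0 s) (LBound 0)) t'" by simp
    then show ?thesis
    proof (cases rule: par_eta_redexE)
      case (app r')
      then have "etas (LAbs t') r'" by (auto intro: eta_step.eta)
      then show ?thesis using app(1) by blast
    next
      case (beta q)
      then show ?thesis by (auto intro: par.abs)
    qed
  next
    case A: (abs s')
    with abs.IH[of s'] obtain v where "etas t' v" "par s' v" by auto
    then have "etas (LAbs t') (LAbs v)" "par (LAbs s') (LAbs v)" by (auto intro: etas_LAbs par.abs)
    then show ?thesis using A by blast
  qed
next
  case (beta t t' u u' s)
  from beta.prems show ?case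
  proof (cases rule: eta_LAppE)
    case R: (appr s')
    with beta.IH(2)[of s'] obtain v where "etas u' v" "par s' v" by auto
    then have "etas (linst 0 u' t') (linst 0 v t')" "par (LApp (LAbs t) s') (linst 0 v t')"
      using beta.hyps by (auto intro: par.beta etas_linst)
    then show ?thesis using R by blast
  next
    case L: (appl s')
    from L(2) show ?thesis
    proof (cases rule: eta_LAbsE)
      case eta
      with beta.hyps have "par (LApp (llift 0 s') (LBound 0)) t'" by simp
      then have "par (LApp s' u) (linst 0 u' t')"
      proof (cases rule: par_eta_redexE)
        case (app r')
        then show ?thesis using beta.hyps by (auto intro: par.app)
      next
        case (beta q)
        then show ?thesis using \<open>par u u'\<close> by (auto intro: par.beta)
      qed
      then show ?thesis using L by blast
    next
      case A: (abs t'')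
      with beta.IH(1)[of t''] obtain v where "etas t' v" "par t'' v" by auto
      then have "etas (linst 0 u' t') (linst 0 u' v)" "par (LApp (LAbs t'') u) (linst 0 u' v)"
        using beta.hyps by (auto intro: par.beta etas_linst)
      then show ?thesis using L A by blast
    qed
  qed
qed auto

definition commute :: "('x \<Rightarrow> 'x \<Rightarrow> bool) \<Rightarrow> ('x \<Rightarrow> 'x \<Rightarrow> bool) \<Rightarrow> bool" where
  "commute R S \<longleftrightarrow> (\<forall>s t u. R s t \<longrightarrow> S s u \<longrightarrow> (\<exists>v. S t v \<and> R u v))"

lemma commute_sym: "commute R S \<Longrightarrow> commute S R"
  unfolding commute_def by blast

lemma commute_sup: "commute R S \<Longrightarrow> commute R T \<Longrightarrow> commute R (sup S T)"
  unfolding commute_def sup_apply sup_bool_def by blast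

lemma commute_rtranclp: 
  assumes "commute R S"
  shows "commute R S\<^sup>*\<^sup>*"
proof -
  have "\<exists>v. S\<^sup>*\<^sup>* t v \<and> R u v" if "S\<^sup>*\<^sup>* s u" "R s t" for s t u
    using that
  proof (induction rule: rtranclp_induct)
    case (step u u')
    then obtain v where v: "S\<^sup>*\<^sup>* t v" "R u v" by blast
    with step.hyps(2) assms obtain w where "S v w" "R u' w" unfolding commute_def by blast
    with v show ?case by (meson rtranclp.rtrancl_into_rtrancl)
  qed blast
  then show ?thesis unfolding commute_def by blast
qed

lemma etas_etas_commute: "commute etas etas"
proof -
  have "commute (eta_step\<^sup>=\<^sup>= :: ('a, 'f, 's) lterm \<Rightarrow> _) eta_step\<^sup>=\<^sup>="
    unfolding commute_def
  proof (intro allI impI)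
    fix s t u :: "('a, 'f, 's) lterm"
    assume a: "eta_step\<^sup>=\<^sup>= s t" "eta_step\<^sup>=\<^sup>= s u"
    show "\<exists>v. eta_step\<^sup>=\<^sup>= t v \<and> eta_step\<^sup>=\<^sup>= u v"
    proof (cases "s = t \<or> s = u")
      case True
      then show ?thesis using a by auto
    next
      case False
      with a have "eta_step s t" "eta_step s u" by auto
      from eta_diamond[OF this] obtain v where
        "t = v \<or> eta_step t v" "u = v \<or> eta_step u v" by blast
      then have "eta_step\<^sup>=\<^sup>= t v" "eta_step\<^sup>=\<^sup>= u v" by auto
      then show ?thesis by blast
    qed
  qed
  then have "commute (eta_step\<^sup>=\<^sup>= :: ('a, 'f, 's) lterm \<Rightarrow> _)\<^sup>*\<^sup>* eta_step\<^sup>=\<^sup>=\<^sup>*\<^sup>*"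
    by (intro commute_rtranclp commute_sym[OF commute_rtranclp])
  then show ?thesis by simp
qed

lemma par_etas_commute: "commute par etas"
proof -
  have "\<exists>v. etas t v \<and> par u v" if "etas s u" "par s t" for s t u :: "('a, 'f, 's) lterm"
    using that
  proof (induction rule: rtranclp_induct)
    case (step u u')
    then obtain v where v: "etas t v" "par u v" by blast
    from par_eta_commute[OF v(2) step.hyps(2)] obtain w where "etas v w" "par u' w" by blast
    with v show ?case by (meson rtranclp_trans)
  qed blast
  then show ?thesis unfolding commute_def by blast
qed

definition steps :: "('a, 'f, 's) lterm \<Rightarrow> ('a, 'f, 's) lterm \<Rightarrow> bool" where
  "steps = (sup par etas)\<^sup>*\<^sup>*"

lemma steps_confluent: "commute steps steps"
proof -
  have "commute par (par :: ('a, 'f, 's) lterm \<Rightarrow> _)"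
    unfolding commute_def using par_diamond by blast
  then have "commute (sup par etas) (sup par (etas :: ('a, 'f, 's) lterm \<Rightarrow> _))"
    by (intro commute_sup commute_sym[OF commute_sup] etas_etas_commute par_etas_commute
      commute_sym[OF par_etas_commute])
  then show ?thesis
    unfolding steps_def by (intro commute_rtranclp commute_sym[OF commute_rtranclp])
qed

lemma steps_refl [simp]: "steps t t"
  by (simp add: steps_def)

lemma steps_trans: "steps t u \<Longrightarrow> steps u v \<Longrightarrow> steps t v"
  by (simp add: steps_def)

lemma par_steps: "par t u \<Longrightarrow> steps t u"
  by (simp add: steps_def r_into_rtranclp)

lemma etas_steps: "etas t u \<Longrightarrow> steps t u"
  by (simp add: steps_def r_into_rtranclp)

lemma steps_induct [consumes 1, case_names refl par eta]:
  assumes "steps t u" "P t"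
    "\<And>u v. steps t u \<Longrightarrow> P u \<Longrightarrow> par u v \<Longrightarrow> P v"
    "\<And>u v. steps t u \<Longrightarrow> P u \<Longrightarrow> eta_step u v \<Longrightarrow> P v"
  shows "P u"
  using assms(1) unfolding steps_def
proof (induction rule: rtranclp_induct)
  case (step y z)
  note ty = step.hyps(1)[folded steps_def]
  from step.hyps(2) consider "par y z" | "etas y z" by auto
  then show ?case
  proof cases
    case 1
    then show ?thesis using assms(3) ty step.IH by blast
  next
    case 2
    then have "steps t z \<and> P z"
    proof (induction rule: rtranclp_induct)
      case (step u v)
      then show ?case using assms(4) by (meson etas_steps r_into_rtranclp steps_trans)
    qed (use ty \<open>P y\<close> in blast)
    then show ?thesis by blast
  qed
qed (rule assms(2))

lemma steps_LApp:
  assumes "steps t t'" "steps u u'"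
  shows "steps (LApp t u) (LApp t' u')"
proof -
  have "steps (LApp t u) (LApp t' u)" using assms(1)
    by (induction rule: steps_induct)
      (simp, meson par.app par_refl par_steps steps_trans,
       meson eta_step.appl etas_steps r_into_rtranclp steps_trans)
  moreover have "steps (LApp t' u) (LApp t' u')" using assms(2)
    by (induction rule: steps_induct)
      (simp, meson par.app par_refl par_steps steps_trans,
       meson eta_step.appr etas_steps r_into_rtranclp steps_trans)
  ultimately show ?thesis by (rule steps_trans)
qed

lemma steps_LAbs: "steps t t' \<Longrightarrow> steps (LAbs t) (LAbs t')"
  by (induction rule: steps_induct)
    (simp, meson par.abs par_steps steps_trans,
     meson eta_step.abs etas_steps r_into_rtranclp steps_trans)

lemma lconv_join:
  assumes "lconv t u"
  shows "\<exists>v. steps t v \<and> steps u v"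
  using assms
proof (induction rule: lconv.induct)
  case (beta t u)
  have "steps (LApp (LAbs t) u) (linst 0 u t)" by (simp add: par.beta par_steps)
  then show ?case using steps_refl by blast
next
  case (eta t)
  have "steps (LAbs (LApp (llift 0 t) (LBound 0))) t"
    by (simp add: eta_step.eta etas_steps r_into_rtranclp)
  then show ?case using steps_refl by blast
next
  case (trans t u v)
  then obtain p q where "steps t p" "steps u p" "steps u q" "steps v q" by blast
  moreover from this steps_confluent obtain r where "steps p r" "steps q r"
    unfolding commute_def by blast
  ultimately show ?case by (meson steps_trans)
next
  case (app t t' u u')
  then show ?case using steps_LApp by blast
next
  case (abs t t')
  then show ?case using steps_LAbs by blast
qed (use steps_refl in blast)+

lemma par_lconv: "par t u \<Longrightarrow> lconv t u"
proof (induction rule: par.induct)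
  case (beta t t' u u')
  then show ?case by (meson lconv.abs lconv.app lconv.beta lconv.trans)
qed (simp_all add: lconv.refl lconv.app lconv.abs)

lemma eta_lconv: "eta_step t u \<Longrightarrow> lconv t u"
  by (induction rule: eta_step.induct) (simp_all add: lconv.refl lconv.app lconv.abs lconv.eta)

definition is_head :: "('a, 'f, 's) lterm \<Rightarrow> bool" where
  "is_head h \<longleftrightarrow> (\<exists>c. h = LConst c) \<or> (\<exists>x. h = LFree x)"

lemma is_head_simps [simp]: "is_head (LConst c)" "is_head (LFree x)"
  by (auto simp: is_head_def)

lemma lapps_Nil [simp]: "lapps h [] = h"
  by (simp add: lapps_def)

lemma lapps_snoc [simp]: "lapps h (us @ [u]) = LApp (lapps h us) u"
  by (simp add: lapps_def)

lemma lapps_Cons: "lapps h (u # us) = lapps (LApp h u) us"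
  by (simp add: lapps_def)

lemma sb_lapps [simp]: "sb f g (lapps h us) = lapps (sb f g h) (map (sb f g) us)"
  by (induction us rule: rev_induct) simp_all

lemma fvs_lapps [simp]: "fvs (lapps h us) = fvs h \<union> (\<Union>u \<in> set us. fvs u)"
  by (induction us rule: rev_induct) auto

lemma lconv_lapps:
  "lconv h h' \<Longrightarrow> list_all2 lconv us us' \<Longrightarrow> lconv (lapps h us) (lapps h' us')"
proof (induction us arbitrary: h h' us')
  case (Cons u us)
  from Cons.prems(2) obtain u' us'' where "us' = u' # us''" "lconv u u'" "list_all2 lconv us us''"
    by (auto simp: list_all2_Cons1)
  then show ?case using Cons.IH[of "LApp h u" "LApp h' u'" us''] Cons.prems(1)
    by (simp add: lapps_Cons lconv.app)
qed simp

lemma lapps_neq_LAbs: "is_head h \<Longrightarrow> lapps h us \<noteq> LAbs t"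
  by (cases us rule: rev_cases) (auto simp: is_head_def)

lemma lapps_inject:
  assumes "is_head h" "is_head h'" "lapps h us = lapps h' us'"
  shows "h = h' \<and> us = us'"
  using assms(3)
proof (induction us arbitrary: us' rule: rev_induct)
  case Nil
  then show ?case using assms(1,2) by (cases us' rule: rev_cases) (auto simp: is_head_def)
next
  case (snoc u us)
  then show ?case using assms(1,2) by (cases us' rule: rev_cases) (auto simp: is_head_def)
qed

lemma par_lapps:
  assumes "is_head h" "par (lapps h us) v"
  shows "\<exists>us'. v = lapps h us' \<and> list_all2 par us us'"
  using assms(2)
proof (induction us arbitrary: v rule: rev_induct)
  case Nil
  then have "v = lapps h []" using assms(1) by (auto simp: is_head_def)
  then show ?case by blast
next
  case (snoc u us)
  from snoc.prems have "par (LApp (lapps h us) u) v" by simp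
  then show ?case
  proof (cases rule: par_LAppE)
    case (app t' u')
    with snoc.IH obtain us' where "t' = lapps h us'" "list_all2 par us us'" by blast
    then have "v = lapps h (us' @ [u'])" "list_all2 par (us @ [u]) (us' @ [u'])"
      using app by (simp_all add: list_all2_appendI)
    then show ?thesis by blast
  next
    case (beta s s' u')
    then show ?thesis using lapps_neq_LAbs[OF assms(1)] by metis
  qed
qed

lemma eta_lapps:
  assumes "is_head h" "eta_step (lapps h us) v"
  shows "\<exists>i u'. i < length us \<and> eta_step (us ! i) u' \<and> v = lapps h (us[i := u'])"
  using assms(2)
proof (induction us arbitrary: v rule: rev_induct)
  case Nil
  then show ?case using assms(1) by (auto simp: is_head_def)
next
  case (snoc u us)
  from snoc.prems have "eta_step (LApp (lapps h us) u) v" by simp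
  then show ?case
  proof (cases rule: eta_LAppE)
    case (appl t')
    with snoc.IH obtain i u' where *: "i < length us" "eta_step (us ! i) u'" "t' = lapps h (us[i := u'])"
      by blast
    then have "v = lapps h ((us @ [u])[i := u'])" "eta_step ((us @ [u]) ! i) u'"
      using appl by (simp_all add: list_update_append nth_append)
    then show ?thesis using * by (metis length_append_singleton less_SucI)
  next
    case (appr u')
    then have "v = lapps h ((us @ [u])[length us := u'])" "eta_step ((us @ [u]) ! length us) u'"
      by simp_all
    then show ?thesis by (metis length_append_singleton lessI)
  qed
qed

lemma steps_lapps:
  assumes "steps (lapps h us) v" "is_head h"
  shows "\<exists>us'. v = lapps h us' \<and> list_all2 lconv us us'"
  using assms(1)
proof (induction rule: steps_induct)
  case refl
  have "list_all2 lconv us us" by (simp add: list_all2_refl lconv.refl)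
  then show ?case by blast
next
  case (par u v)
  then obtain us' where us': "u = lapps h us'" "list_all2 lconv us us'" by blast
  with par_lapps[OF assms(2)] par.hyps obtain us'' where
    us'': "v = lapps h us''" "list_all2 par us' us''" by blast
  have "list_all2 lconv us us''"
    using us'(2) us''(2) by (rule list_all2_trans[rotated]) (meson lconv.trans par_lconv)
  with us'' show ?case by blast
next
  case (eta u v)
  then obtain us' where us': "u = lapps h us'" "list_all2 lconv us us'" by blast
  with eta_lapps[OF assms(2)] eta.hyps obtain i u' where
    i: "i < length us'" "eta_step (us' ! i) u'" "v = lapps h (us'[i := u'])" by blast
  have "list_all2 lconv us (us'[i := u'])"
    using us'(2) i eta_lconv[OF i(2)]
    by (auto simp: list_all2_conv_all_nth nth_list_update intro: lconv.trans)
  with i show ?case by blast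
qed

lemma lconv_lapps_headD:
  assumes "is_head h" "is_head h'" "lconv (lapps h us) (lapps h' us')"
  shows "h = h'" "list_all2 lconv us us'"
proof -
  from lconv_join[OF assms(3)] obtain v where "steps (lapps h us) v" "steps (lapps h' us') v" by blast
  from steps_lapps[OF this(1) assms(1)] steps_lapps[OF this(2) assms(2)] obtain ws ws' where
    "v = lapps h ws" "list_all2 lconv us ws" "v = lapps h' ws'" "list_all2 lconv us' ws'" by blast
  with lapps_inject[OF assms(1,2), of ws ws']
  have *: "h = h'" "list_all2 lconv us ws" "list_all2 lconv us' ws" by auto
  then show "h = h'" by blast
  from *(2,3) show "list_all2 lconv us us'"
    unfolding list_all2_conv_all_nth by (metis lconv.trans lconv.sym)
qed

section \<open>Normalization of typed terms\<close>

definition nf :: "('a, 'f, 's) lterm \<Rightarrow> bool" where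
  "nf t \<longleftrightarrow> (\<forall>u. par t u \<longrightarrow> u = t) \<and> (\<forall>u. \<not> eta_step t u)"

lemma nf_steps: "steps t u \<Longrightarrow> nf t \<Longrightarrow> u = t"
  by (induction rule: steps_induct) (auto simp: nf_def)

lemma nf_unique: "lconv t u \<Longrightarrow> nf t \<Longrightarrow> nf u \<Longrightarrow> t = u"
  using lconv_join nf_steps by metis

lemma nf_lapps:
  assumes "is_head h" "\<forall>u \<in> set us. nf u"
  shows "nf (lapps h us)"
  unfolding nf_def
proof (intro conjI allI impI notI)
  fix v assume "par (lapps h us) v"
  then obtain us' where us': "v = lapps h us'" "list_all2 par us us'"
    using par_lapps[OF assms(1)] by blast
  have "us' = us"
    using us'(2) assms(2) by (auto simp: list_all2_conv_all_nth nf_def intro!: nth_equalityI)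
  with us' show "v = lapps h us" by simp
next
  fix v assume "eta_step (lapps h us) v"
  then show False using eta_lapps[OF assms(1)] assms(2) nth_mem unfolding nf_def by blast
qed

lemma nf_sb_var:
  assumes "nf t" "\<And>i. is_var (f i)" "\<And>x. is_var (g x)"
  shows "nf (sb f g t)"
  unfolding nf_def
proof (intro conjI allI impI notI)
  fix u assume "par (sb f g t) u"
  then obtain t' where "par t t'" "u = sb f g t'" using par_sb_varD[of _ u f g t] assms(2,3) by auto
  moreover from this assms(1) have "t' = t" unfolding nf_def by blast
  ultimately show "u = sb f g t" by simp
next
  fix u assume "eta_step (sb f g t) u"
  then obtain t' where "eta_step t t'" using eta_sb_varD[of _ u f g t] assms(2,3) by auto
  then show False using assms(1) unfolding nf_def by simp
qed

definition wn :: "('a, 'f, 's) lterm \<Rightarrow> bool" where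
  "wn t \<longleftrightarrow> (\<exists>u. lconv t u \<and> nf u)"

lemma wn_LAbs_nf:
  assumes "nf t"
  shows "wn (LAbs t)"
proof (cases "nf (LAbs t)")
  case True
  then show ?thesis unfolding wn_def by (meson lconv.refl)
next
  case False
  then consider v where "par (LAbs t) v" "v \<noteq> LAbs t" | v where "eta_step (LAbs t) v"
    unfolding nf_def by blast
  then have "\<exists>u. t = LApp (llift 0 u) (LBound 0)"
  proof cases
    case 1
    then show ?thesis using assms unfolding nf_def by (auto elim: par_LAbsE)
  next
    case (2 v)
    then show ?thesis using assms unfolding nf_def by (auto elim: eta_LAbsE)
  qed
  then obtain u where u: "t = LApp (llift 0 u) (LBound 0)" by blast
  have "nf u"
    unfolding nf_def
  proof (intro conjI allI impI notI)
    fix v assume "par u v"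
    then have "par t (LApp (llift 0 v) (LBound 0))" by (simp add: u par.app par_llift)
    then show "v = u" using assms u unfolding nf_def by auto
  next
    fix v assume "eta_step u v"
    then have "eta_step t (LApp (llift 0 v) (LBound 0))" by (simp add: u eta_step.appl llift_0 eta_sb)
    then show False using assms unfolding nf_def by auto
  qed
  moreover have "lconv (LAbs t) u" unfolding u by (rule lconv.eta)
  ultimately show ?thesis unfolding wn_def by blast
qed

text \<open>
  Tait's reducibility, with weak normalization up to conversion: as conversion includes eta, a term
  of arrow type is recovered by abstracting the normal form of its application to a fresh variable.
\<close>

primrec red :: "'s ltype \<Rightarrow> ('a, 'f, 's) lterm \<Rightarrow> bool" where
  "red (LBase b) t \<longleftrightarrow> wn t"
| "red (LFun T U) t \<longleftrightarrow> (\<forall>u. red T u \<longrightarrow> red U (LApp t u))"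

lemma red_lconv: "red T t \<Longrightarrow> lconv t u \<Longrightarrow> red T u"
proof (induction T arbitrary: t u)
  case (LBase b)
  then show ?case by (metis wn_def lconv.sym lconv.trans red.simps(1))
next
  case (LFun T U)
  then show ?case by (metis lconv.app lconv.refl red.simps(2))
qed

lemma ex_fresh_unknown:
  fixes S :: "('a, 's) lvar set"
  assumes "finite S"
  shows "\<exists>n. LUnk (NVar n s) T \<notin> S"
proof -
  have "infinite (range (\<lambda>n. LUnk (NVar n s) T :: ('a, 's) lvar))"
    by (subst finite_image_iff) (simp_all add: inj_def)
  then have "\<not> range (\<lambda>n. LUnk (NVar n s) T :: ('a, 's) lvar) \<subseteq> S"
    using assms finite_subset by blast
  then show ?thesis by blast
qed

lemma red_wn_head:
  "(red T t \<longrightarrow> wn t) \<and> (is_head h \<longrightarrow> (\<forall>u \<in> set us. nf u) \<longrightarrow> red T (lapps h us))"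
  for t h :: "('a, 'f, 's) lterm"
proof (induction T arbitrary: t h us)
  case (LBase b)
  show ?case using nf_lapps[of h us] by (auto simp: wn_def intro: lconv.refl)
next
  case (LFun T U)
  have "wn t" if t: "red (LFun T U) t"
  proof -
    obtain n where n: "LUnk (NVar n (undefined :: 's base_sort)) T \<notin> fvs t"
      using ex_fresh_unknown[OF finite_fvs] by blast
    let ?x = "LUnk (NVar n undefined) T :: ('a, 's) lvar"
    define cl :: "('a, 'f, 's) lterm \<Rightarrow> ('a, 'f, 's) lterm" where
      "cl = sb (\<lambda>i. LBound (Suc i)) (\<lambda>y. if y = ?x then LBound 0 else LFree y)"
    have "red T (LFree ?x :: ('a, 'f, 's) lterm)"
      using LFun.IH(1)[of _ "LFree ?x" "[]"] by simp
    then have "wn (LApp t (LFree ?x))" using t LFun.IH(2) by auto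
    then obtain N where N: "lconv (LApp t (LFree ?x)) N" "nf N" unfolding wn_def by blast
    from N(1) have "lconv (cl (LApp t (LFree ?x))) (cl N)" unfolding cl_def by (rule lconv_sb)
    moreover have "cl (LApp t (LFree ?x)) = LApp (llift 0 t) (LBound 0)"
    proof -
      have "cl t = llift 0 t" unfolding cl_def llift_0 by (rule sb_cong) (use n in auto)
      then show ?thesis by (simp add: cl_def)
    qed
    ultimately have "lconv t (LAbs (cl N))"
      by (metis lconv.abs lconv.eta lconv.sym lconv.trans)
    moreover have "nf (cl N)" unfolding cl_def by (rule nf_sb_var) (use N in auto)
    ultimately show ?thesis using wn_LAbs_nf unfolding wn_def by (meson lconv.trans)
  qed
  moreover have "red U (LApp (lapps h us) u)"
    if "is_head h" "\<forall>u \<in> set us. nf u" "red T u" for u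
  proof -
    from LFun.IH(1) that(3) obtain u' where u': "lconv u u'" "nf u'" unfolding wn_def by blast
    then have "red U (lapps h (us @ [u']))"
      using LFun.IH(2)[of _ h "us @ [u']"] that by (simp del: lapps_snoc)
    then show ?thesis
      by (rule red_lconv) (simp add: u' lconv.sym lconv.app lconv.refl)
  qed
  ultimately show ?case by auto
qed

lemma red_wn: "red T t \<Longrightarrow> wn t"
  using red_wn_head by blast

lemma red_head: "is_head h \<Longrightarrow> red T h"
  using red_wn_head[of T _ h "[]"] by simp

lemma red_has_type:
  "has_type sg \<Gamma> t T \<Longrightarrow> (\<And>i. i < length \<Gamma> \<Longrightarrow> red (\<Gamma> ! i) (f i)) \<Longrightarrow> red T (sb f LFree t)"
proof (induction arbitrary: f rule: has_type.induct)
  case (2 \<Gamma> x)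
  show ?case by (simp add: red_head)
next
  case (3 \<Gamma> c)
  show ?case by (simp add: red_head)
next
  case (5 T \<Gamma> t U)
  have "red U (LApp (sb f LFree (LAbs t)) u)" if "red T u" for u
  proof -
    have "red ((T # \<Gamma>) ! i) (case_nat u f i)" if "i < length (T # \<Gamma>)" for i
      using that \<open>red T u\<close> 5(3) by (cases i) auto
    then have "red U (sb (case_nat u f) LFree t)" by (rule 5(2))
    moreover have "lconv (LApp (sb f LFree (LAbs t)) u) (sb (case_nat u f) LFree t)"
      using lconv.beta[of "sb (up f) (\<lambda>x. llift 0 (LFree x)) t" u] by (simp only: linst_sb_up sb.simps)
    ultimately show ?thesis by (meson red_lconv lconv.sym)
  qed
  then show ?case by simp
qed simp_all

lemma has_type_wn: 
  assumes "has_type sg [] t T"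
  shows "wn t"
  using red_has_type[OF assms, of LBound] red_wn[of T t] by simp

lemma has_type_rename:
  "has_type sg \<Gamma> t T \<Longrightarrow> (\<And>i. i < length \<Gamma> \<Longrightarrow> r i < length \<Gamma>' \<and> \<Gamma>' ! r i = \<Gamma> ! i)
    \<Longrightarrow> has_type sg \<Gamma>' (sb (\<lambda>i. LBound (r i)) LFree t) T"
proof (induction arbitrary: r \<Gamma>' rule: has_type.induct)
  case (1 i \<Gamma>)
  then show ?case using has_type.intros(1)[of "r i" \<Gamma>' sg] by simp
next
  case (5 T \<Gamma> t U)
  have *: "up (\<lambda>i. LBound (r i)) = (\<lambda>i. LBound (case_nat 0 (\<lambda>j. Suc (r j)) i))"
    by (rule ext) (auto simp: up_def split: nat.split)
  have "has_type sg (T # \<Gamma>') (sb (\<lambda>i. LBound (case_nat 0 (\<lambda>j. Suc (r j)) i)) LFree t) U"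
    by (rule 5(2)) (use 5(3) in \<open>auto split: nat.split\<close>)
  then show ?case by (simp add: * has_type.intros)
next
  case (4 \<Gamma> t T U u)
  show ?case using 4(3)[OF 4(5)] 4(4)[OF 4(5)] by (auto intro: has_type.intros)
qed (auto intro: has_type.intros)

lemma has_type_llift: "has_type sg \<Gamma> t T \<Longrightarrow> has_type sg (U # \<Gamma>) (llift 0 t) T"
  unfolding llift_0 by (rule has_type_rename) auto

lemma has_type_sb:
  "has_type sg \<Gamma> t T \<Longrightarrow> (\<And>i. i < length \<Gamma> \<Longrightarrow> has_type sg \<Gamma>' (f i) (\<Gamma> ! i))
    \<Longrightarrow> (\<And>x. x \<in> fvs t \<Longrightarrow> has_type sg \<Gamma>' (g x) (lvar_type sg x))
    \<Longrightarrow> has_type sg \<Gamma>' (sb f g t) T"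
proof (induction arbitrary: f g \<Gamma>' rule: has_type.induct)
  case (4 \<Gamma> t T U u)
  have "has_type sg \<Gamma>' (sb f g t) (LFun T U)" by (rule 4(3)) (use 4(5,6) in auto)
  moreover have "has_type sg \<Gamma>' (sb f g u) T" by (rule 4(4)) (use 4(5,6) in auto)
  ultimately show ?case by (auto intro: has_type.intros)
next
  case (5 T \<Gamma> t U)
  have "has_type sg (T # \<Gamma>') (up f i) ((T # \<Gamma>) ! i)" if "i < length (T # \<Gamma>)" for i
    using that 5(3) has_type.intros(1)[of 0 "T # \<Gamma>'" sg] by (cases i) (auto intro: has_type_llift)
  then have "has_type sg (T # \<Gamma>') (sb (up f) (\<lambda>x. llift 0 (g x)) t) U"
    by (rule 5(2)) (use 5(4) in \<open>auto intro: has_type_llift\<close>)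
  then show ?case by (auto intro: has_type.intros)
qed (auto intro: has_type.intros)

section \<open>Permutations of the free atoms\<close>

definition ren :: "('a \<Rightarrow> 'a) \<Rightarrow> ('a, 'f, 's) lterm \<Rightarrow> ('a, 'f, 's) lterm" where
  "ren p = sb LBound (\<lambda>x. case x of LAtm a \<Rightarrow> LFree (LAtm (p a)) | LUnk X T \<Rightarrow> LFree (LUnk X T))"

definition afresh :: "'a \<Rightarrow> ('a, 'f, 's) lterm \<Rightarrow> bool" where
  "afresh a t \<longleftrightarrow> (\<exists>u. lconv t u \<and> LAtm a \<notin> fvs u)"

lemma sb_eqD: "sb f g t = sb f g' t \<Longrightarrow> x \<in> fvs t \<Longrightarrow> g x = g' x"
proof (induction t arbitrary: f g g')
  case (LAbs t)
  have "llift 0 (g x) = llift 0 (g' x)" by (rule LAbs.IH) (use LAbs.prems in auto)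
  then show ?case by simp
qed auto

lemma lconv_ren_eqD:
  assumes "wn t" "lconv (ren p t) (ren q t)" "p a \<noteq> q a"
  shows "afresh a t"
proof -
  from assms(1) obtain n where n: "lconv t n" "nf n" unfolding wn_def by blast
  have "lconv (ren p n) (ren q n)"
    using lconv_sb[OF n(1)] assms(2) unfolding ren_def by (meson lconv.sym lconv.trans)
  moreover have "nf (ren r n)" for r
    unfolding ren_def by (rule nf_sb_var[OF n(2)]) (simp_all split: lvar.split)
  ultimately have "ren p n = ren q n" using nf_unique by blast
  then have "LAtm a \<notin> fvs n" using assms(3) sb_eqD unfolding ren_def by fastforce
  with n show ?thesis unfolding afresh_def by blast
qed

declare lconv.trans [trans]

section \<open>Permutations\<close>

definition patoms :: "'a perm \<Rightarrow> 'a set" where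
  "patoms \<pi> = fst ` set \<pi> \<union> snd ` set \<pi>"

lemma patoms_simps [simp]:
  "patoms [] = {}" "patoms (s # \<pi>) = {fst s, snd s} \<union> patoms \<pi>"
  "patoms (\<pi> @ \<pi>') = patoms \<pi> \<union> patoms \<pi>'" "patoms (rev \<pi>) = patoms \<pi>"
  by (auto simp: patoms_def)

lemma natoms_NSus [simp]: "natoms (NSus \<pi> X) = patoms \<pi>"
  by (auto simp: patoms_def fsts.simps snds.simps prod_set_defs image_iff)

declare nterm.set(4) [simp del]

lemma perm_atom_simps [simp]:
  "perm_atom [] c = c"
  "perm_atom (s # \<pi>) c = transpose (fst s) (snd s) (perm_atom \<pi> c)"
  by (simp_all add: perm_atom_def split_def)

lemma perm_atom_append [simp]: "perm_atom (\<pi> @ \<pi>') c = perm_atom \<pi> (perm_atom \<pi>' c)"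
  by (induction \<pi>) simp_all

lemma perm_atom_rev [simp]: "perm_atom (rev \<pi>) (perm_atom \<pi> c) = c"
  by (induction \<pi> arbitrary: c) simp_all

lemma perm_atom_rev' [simp]: "perm_atom \<pi> (perm_atom (rev \<pi>) c) = c"
  using perm_atom_rev[of "rev \<pi>" c] by simp

lemma perm_atom_inject [simp]: "perm_atom \<pi> a = perm_atom \<pi> b \<longleftrightarrow> a = b"
  by (metis perm_atom_rev)

lemma inj_perm_atom: "inj (perm_atom \<pi>)"
  by (rule injI) simp

lemma perm_atom_fixed: "a \<notin> patoms \<pi> \<Longrightarrow> perm_atom \<pi> a = a"
  by (induction \<pi>) simp_all

lemma perm_atom_in: "a \<in> A \<Longrightarrow> patoms \<pi> \<subseteq> A \<Longrightarrow> perm_atom \<pi> a \<in> A"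
  by (induction \<pi>) (auto simp: transpose_def)

lemma perm_atom_sort:
  assumes "\<forall>(a, b) \<in> set \<pi>. atom_sort sg a = atom_sort sg b"
  shows "atom_sort sg (perm_atom \<pi> a) = atom_sort sg a"
  using assms by (induction \<pi>) (auto simp: transpose_def)

lemma perm_term_simps [simp]:
  "perm_term \<pi> (NFun f ts) = NFun f (map (perm_term \<pi>) ts)"
  "perm_term \<pi> (NAtm a) = NAtm (perm_atom \<pi> a)"
  "perm_term \<pi> (NAbs a t) = NAbs (perm_atom \<pi> a) (perm_term \<pi> t)"
  "perm_term \<pi> (NSus \<pi>' X) = NSus (\<pi> @ \<pi>') X"
proof -
  show "perm_term \<pi> (NFun f ts) = NFun f (map (perm_term \<pi>) ts)"
  proof (induction \<pi>)
    case Nil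
    then show ?case by (simp add: perm_term_def map_idI)
  qed (simp add: perm_term_def)
qed (induction \<pi>; simp add: perm_term_def)+

lemma swap_perm_term: "swap_term s t = perm_term [s] t"
  by (simp add: perm_term_def)

lemma perm_term_Nil [simp]: "perm_term [] t = t"
  by (simp add: perm_term_def)

lemma nvars_swap [simp]: "nvars (swap_term s t) = nvars t"
  by (induction t) auto

lemma nvars_perm [simp]: "nvars (perm_term \<pi> t) = nvars t"
  by (induction \<pi>) (simp_all add: perm_term_def)

lemma natoms_perm: "natoms (perm_term \<pi> t) \<subseteq> natoms t \<union> patoms \<pi>"
proof (induction t)
  case (NAtm a)
  then show ?case using perm_atom_in[of a "{a} \<union> patoms \<pi>" \<pi>] by auto
next
  case (NAbs a t)
  then show ?case using perm_atom_in[of a "{a} \<union> patoms \<pi>" \<pi>] by auto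
qed auto

lemma has_sort_perm:
  assumes "\<forall>(a, b) \<in> set \<pi>. atom_sort sg a = atom_sort sg b"
  shows "has_sort sg t \<tau> \<Longrightarrow> has_sort sg (perm_term \<pi> t) \<tau>"
proof (induction rule: has_sort.induct)
  case (1 ts f)
  then have "list_all2 (has_sort sg) (map (perm_term \<pi>) ts) (arg_sorts sg f)"
    by (auto simp: list_all2_conv_all_nth)
  then show ?case by (simp add: has_sort.intros)
next
  case (2 a)
  show ?case using has_sort.intros(2)[of sg "perm_atom \<pi> a"] by (simp add: perm_atom_sort[OF assms])
next
  case (3 t \<tau> a)
  show ?case using has_sort.intros(3)[OF 3(2), of "perm_atom \<pi> a"]
    by (simp add: perm_atom_sort[OF assms])
next
  case (4 \<pi>' X)
  then show ?case using assms by (auto intro!: has_sort.intros)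
qed

lemma has_sort_var: "has_sort sg (NSus [] X) (BaseSort (nvar_sort X))"
  by (rule has_sort.intros) simp

inductive_cases has_sort_NFunE: "has_sort sg (NFun f ts) \<tau>"
inductive_cases has_sort_NAtmE: "has_sort sg (NAtm a) \<tau>"
inductive_cases has_sort_NAbsE: "has_sort sg (NAbs a t) \<tau>"
inductive_cases has_sort_NSusE: "has_sort sg (NSus \<pi> X) \<tau>"

section \<open>Named abstraction\<close>

lemma lclose_sb:
  "lclose k a t = sb (\<lambda>i. LBound (if i < k then i else Suc i))
    (\<lambda>x. if x = LAtm a then LBound k else LFree x) t"
proof (induction t arbitrary: k)
  case (LAbs t)
  have 1: "up (\<lambda>i. LBound (if i < k then i else Suc i)) =
      (\<lambda>i. LBound (if i < Suc k then i else Suc i) :: ('a, 'b, 'c) lterm)"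
    by (rule ext) (simp add: up_def split: nat.split)
  have 2: "(\<lambda>x. llift 0 (if x = LAtm a then LBound k else LFree x)) =
      (\<lambda>x. if x = LAtm a then LBound (Suc k) else LFree x :: ('a, 'b, 'c) lterm)"
    by (rule ext) simp
  show ?case using LAbs by (simp add: 1 2)
qed auto

lemma lam_sb:
  "lam a t = LAbs (sb (\<lambda>i. LBound (Suc i)) (\<lambda>x. if x = LAtm a then LBound 0 else LFree x) t)"
  by (simp add: lam_def lclose_sb)

lemma fvs_lamD: "x \<in> fvs (lam a t) \<Longrightarrow> x \<in> fvs t \<and> x \<noteq> LAtm a"
  unfolding lam_sb by (auto dest!: fvs_sb split: if_splits)

lemma sb_lam:
  assumes "g (LAtm a) = LFree (LAtm b)"
    and "\<And>x. x \<in> fvs t \<Longrightarrow> x \<noteq> LAtm a \<Longrightarrow> LAtm b \<notin> fvs (g x)"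
  shows "sb LBound g (lam a t) = lam b (sb LBound g t)"
proof -
  let ?cl = "sb (\<lambda>i. LBound (Suc i)) (\<lambda>x. if x = LAtm b then LBound 0 else LFree x)"
  have "sb (\<lambda>i. LBound (Suc i))
      (\<lambda>x. sb LBound (\<lambda>x. llift 0 (g x)) (if x = LAtm a then LBound 0 else LFree x)) t =
    sb (\<lambda>i. LBound (Suc i)) (\<lambda>x. ?cl (g x)) t"
  proof (rule sb_cong)
    fix x assume x: "x \<in> fvs t"
    show "sb LBound (\<lambda>x. llift 0 (g x)) (if x = LAtm a then LBound 0 else LFree x) = ?cl (g x)"
    proof (cases "x = LAtm a")
      case False
      have "?cl (g x) = sb (\<lambda>i. LBound (Suc i)) LFree (g x)"
        by (rule sb_cong) (use assms(2)[OF x False] in auto)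
      then show ?thesis using False by (simp add: llift_0)
    qed (simp add: assms)
  qed
  then show ?thesis by (simp add: lam_sb sb_sb)
qed

lemma lconv_lam: "lconv t u \<Longrightarrow> lconv (lam a t) (lam a u)"
  unfolding lam_sb by (intro lconv.abs lconv_sb)

definition asub :: "'a \<Rightarrow> ('a, 'f, 's) lterm \<Rightarrow> ('a, 'f, 's) lterm \<Rightarrow> ('a, 'f, 's) lterm" where
  "asub a d = sb LBound (\<lambda>x. if x = LAtm a then d else LFree x)"

lemma lconv_asub: "lconv t u \<Longrightarrow> lconv (asub a d t) (asub a d u)"
  unfolding asub_def by (rule lconv_sb)

lemma lam_apply: "lconv (LApp (lam a t) d) (asub a d t)"
proof -
  have "(\<lambda>x. sb (case_nat d LBound) LFree (if x = LAtm a then LBound 0 else LFree x)) =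
      (\<lambda>x. if x = LAtm a then d else LFree x)"
    by (rule ext) simp
  then have "linst 0 d (sb (\<lambda>i. LBound (Suc i)) (\<lambda>x. if x = LAtm a then LBound 0 else LFree x) t)
      = asub a d t"
    by (simp add: linst_0 sb_sb asub_def)
  then show ?thesis
    using lconv.beta[of "sb (\<lambda>i. LBound (Suc i)) (\<lambda>x. if x = LAtm a then LBound 0 else LFree x) t" d]
    by (simp add: lam_sb)
qed

lemma asub_same [simp]: "asub a (LFree (LAtm a)) t = t"
proof -
  have "asub a (LFree (LAtm a)) t = sb LBound LFree t"
    unfolding asub_def by (rule sb_cong) simp
  then show ?thesis by simp
qed

lemma asub_notin: "LAtm a \<notin> fvs t \<Longrightarrow> asub a d t = t"
proof -
  assume *: "LAtm a \<notin> fvs t"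
  have "asub a d t = sb LBound LFree t" unfolding asub_def by (rule sb_cong) (use * in auto)
  then show ?thesis by simp
qed

lemma fvs_asub: "LAtm a \<notin> fvs d \<Longrightarrow> LAtm a \<notin> fvs (asub a d t)"
  unfolding asub_def by (auto dest!: fvs_sb split: if_splits)

lemma lconv_lam_same: "lconv (lam a t) (lam a u) \<longleftrightarrow> lconv t u"
proof
  assume "lconv (lam a t) (lam a u)"
  then have "lconv (LApp (lam a t) (LFree (LAtm a))) (LApp (lam a u) (LFree (LAtm a)))"
    by (intro lconv.app lconv.refl)
  then show "lconv t u"
    using lam_apply[of a t "LFree (LAtm a)"] lam_apply[of a u "LFree (LAtm a)"]
    by simp (meson lconv.sym lconv.trans)
qed (rule lconv_lam)

lemma lam_eta:
  assumes "LAtm a \<notin> fvs t"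
  shows "lconv (lam a (LApp t (LFree (LAtm a)))) t"
proof -
  have "sb (\<lambda>i. LBound (Suc i)) (\<lambda>x. if x = LAtm a then LBound 0 else LFree x) t = llift 0 t"
    unfolding llift_0 by (rule sb_cong) (use assms in auto)
  then show ?thesis by (simp add: lam_sb lconv.eta)
qed

section \<open>Semantic freshness\<close>

lemma lconv_ren: "lconv t u \<Longrightarrow> lconv (ren p t) (ren p u)"
  unfolding ren_def by (rule lconv_sb)

lemma ren_simps [simp]:
  "ren p (LFree (LAtm a)) = LFree (LAtm (p a))" "ren p (LFree (LUnk X T)) = LFree (LUnk X T)"
  "ren p (LConst c) = LConst c" "ren p (LApp t u) = LApp (ren p t) (ren p u)"
  "ren p (lapps h us) = lapps (ren p h) (map (ren p) us)"
  by (simp_all add: ren_def)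

lemma ren_ren: "ren p (ren q t) = ren (\<lambda>a. p (q a)) t"
  unfolding ren_def by (subst sb_sb, simp only: sb.simps, rule sb_cong) (simp split: lvar.split)

lemma ren_cong: "(\<And>a. LAtm a \<in> fvs t \<Longrightarrow> p a = q a) \<Longrightarrow> ren p t = ren q t"
  unfolding ren_def by (rule sb_cong) (auto split: lvar.split)

lemma ren_id: "(\<And>a. LAtm a \<in> fvs t \<Longrightarrow> p a = a) \<Longrightarrow> ren p t = t"
proof -
  assume *: "\<And>a. LAtm a \<in> fvs t \<Longrightarrow> p a = a"
  have "ren p t = sb LBound LFree t"
    unfolding ren_def by (rule sb_cong) (auto simp: * split: lvar.split)
  then show ?thesis by simp
qed

lemma ren_perm_Nil [simp]: "ren (perm_atom []) t = t"
  by (rule ren_id) simp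

lemma ren_rev [simp]: "ren (perm_atom (rev \<pi>)) (ren (perm_atom \<pi>) t) = t"
  "ren (perm_atom \<pi>) (ren (perm_atom (rev \<pi>)) t) = t"
  by (simp_all add: ren_ren ren_id)

lemma fvs_renD: "LAtm b \<in> fvs (ren p t) \<Longrightarrow> \<exists>a. b = p a \<and> LAtm a \<in> fvs t"
  unfolding ren_def by (auto dest!: fvs_sb split: lvar.splits)

lemma ren_lam: "inj p \<Longrightarrow> ren p (lam a t) = lam (p a) (ren p t)"
  unfolding ren_def by (rule sb_lam) (auto split: lvar.splits dest: injD)

lemma afresh_lconv: "lconv t u \<Longrightarrow> afresh a t \<Longrightarrow> afresh a u"
  unfolding afresh_def by (meson lconv.sym lconv.trans)

lemma afresh_notin: "LAtm a \<notin> fvs t \<Longrightarrow> afresh a t"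
  unfolding afresh_def by (meson lconv.refl)

lemma afresh_asub: "afresh a t \<Longrightarrow> lconv (asub a d t) t"
proof -
  assume "afresh a t"
  then obtain u where u: "lconv t u" "LAtm a \<notin> fvs u" unfolding afresh_def by blast
  have "lconv (asub a d t) u" using lconv_asub[OF u(1), of a d] asub_notin[OF u(2)] by simp
  then show ?thesis using u(1) by (meson lconv.sym lconv.trans)
qed

lemma asub_afresh: "lconv (asub a d t) t \<Longrightarrow> LAtm a \<notin> fvs d \<Longrightarrow> afresh a t"
  unfolding afresh_def by (rule exI[of _ "asub a d t"]) (simp add: fvs_asub lconv.sym)

lemma afresh_lapps_args:
  assumes "afresh a (lapps h us)" "is_head h" "u \<in> set us"
  shows "afresh a u"
proof -
  have "lconv (asub a (LConst undefined) (lapps h us)) (lapps h us)"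
    using assms(1) by (rule afresh_asub)
  moreover have "asub a (LConst undefined) (lapps h us) =
      lapps (asub a (LConst undefined) h) (map (asub a (LConst undefined)) us)"
    by (simp add: asub_def)
  moreover have "is_head (asub a (LConst undefined) h)"
    using assms(2) unfolding is_head_def[of h] by (auto simp: asub_def)
  ultimately have "list_all2 lconv (map (asub a (LConst undefined)) us) us"
    using lconv_lapps_headD(2)[of "asub a (LConst undefined) h" h] assms(2) by simp
  then have "lconv (asub a (LConst undefined) u) u"
    using assms(3) by (auto simp: list_all2_conv_all_nth in_set_conv_nth)
  then show ?thesis by (rule asub_afresh) simp
qed

lemma afresh_atom_iff: "afresh a (LFree (LAtm b)) \<longleftrightarrow> a \<noteq> b"
proof
  assume "afresh a (LFree (LAtm b))"
  from afresh_asub[OF this, of "LConst undefined"] show "a \<noteq> b"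
    using lconv_lapps_headD(1)[of "LConst undefined" "LFree (LAtm b)" "[]" "[]"]
    by (auto simp: asub_def)
qed (simp add: afresh_notin)

lemma afresh_lapps_const:
  assumes "\<forall>u \<in> set us. afresh a u"
  shows "afresh a (lapps (LConst c) us)"
proof -
  have "list_all2 lconv (map (asub a (LConst undefined)) us) us"
    using assms by (auto simp: list_all2_conv_all_nth intro: afresh_asub)
  then have "lconv (asub a (LConst undefined) (lapps (LConst c) us)) (lapps (LConst c) us)"
    by (simp add: asub_def lconv_lapps lconv.refl)
  then show ?thesis by (rule asub_afresh) simp
qed

lemma afresh_lam_same: "afresh a (lam a t)"
  by (rule afresh_notin) (auto dest: fvs_lamD)

lemma afresh_lam_iff:
  assumes "a \<noteq> b"
  shows "afresh a (lam b t) \<longleftrightarrow> afresh a t"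
proof
  assume "afresh a t"
  then obtain u where "lconv t u" "LAtm a \<notin> fvs u" unfolding afresh_def by blast
  then show "afresh a (lam b t)"
    unfolding afresh_def by (intro exI[of _ "lam b u"]) (auto simp: lconv_lam_same dest: fvs_lamD)
next
  assume "afresh a (lam b t)"
  then have "lconv (asub a (LConst undefined) (lam b t)) (lam b t)" by (rule afresh_asub)
  moreover have "asub a (LConst undefined) (lam b t) = lam b (asub a (LConst undefined) t)"
    unfolding asub_def by (rule sb_lam) (use assms in auto)
  ultimately have "lconv (asub a (LConst undefined) t) t" by (simp add: lconv_lam_same)
  then show "afresh a t" by (rule asub_afresh) simp
qed

lemma afresh_ren: 
  assumes "afresh (perm_atom (rev \<pi>) a) t"
  shows "afresh a (ren (perm_atom \<pi>) t)"
proof -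
  obtain u where "lconv t u" "LAtm (perm_atom (rev \<pi>) a) \<notin> fvs u"
    using assms unfolding afresh_def by blast
  then have "lconv (ren (perm_atom \<pi>) t) (ren (perm_atom \<pi>) u)" "LAtm a \<notin> fvs (ren (perm_atom \<pi>) u)"
    by (auto simp: lconv_ren dest!: fvs_renD)
  then show ?thesis unfolding afresh_def by (intro exI[of _ "ren (perm_atom \<pi>) u"]) simp
qed

lemma afresh_ren_iff: "afresh a (ren (perm_atom \<pi>) t) \<longleftrightarrow> afresh (perm_atom (rev \<pi>) a) t"
  using afresh_ren[of \<pi> a t] afresh_ren[of "rev \<pi>" "perm_atom (rev \<pi>) a" "ren (perm_atom \<pi>) t"]
  by auto

lemma lconv_lam_neqD:
  assumes "lconv (lam a t) (lam b u)" "a \<noteq> b"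
  shows "afresh a u" "lconv t (ren (perm_atom [(a, b)]) u)"
proof -
  have "afresh a (lam b u)" using assms(1) afresh_lam_same by (rule afresh_lconv)
  then show a: "afresh a u" using afresh_lam_iff[OF assms(2)] by blast
  then obtain v where v: "lconv u v" "LAtm a \<notin> fvs v" unfolding afresh_def by blast
  have "lconv (LApp (lam a t) (LFree (LAtm a))) (LApp (lam b u) (LFree (LAtm a)))"
    using assms(1) by (intro lconv.app lconv.refl)
  then have "lconv t (asub b (LFree (LAtm a)) u)"
    using lam_apply[of a t "LFree (LAtm a)"] lam_apply[of b u "LFree (LAtm a)"]
    by simp (meson lconv.sym lconv.trans)
  also have "lconv (asub b (LFree (LAtm a)) u) (asub b (LFree (LAtm a)) v)"
    using v(1) by (rule lconv_asub)
  finally have "lconv t (asub b (LFree (LAtm a)) v)" .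
  moreover have "asub b (LFree (LAtm a)) v = ren (perm_atom [(a, b)]) v"
    unfolding asub_def ren_def
    by (rule sb_cong) (use v(2) in \<open>auto simp: transpose_def split: lvar.split\<close>)
  ultimately show "lconv t (ren (perm_atom [(a, b)]) u)"
    using lconv_ren[OF v(1), of "perm_atom [(a, b)]"] by simp (meson lconv.sym lconv.trans)
qed

lemma lconv_lam_neqI:
  assumes "lconv t (ren (perm_atom [(a, b)]) u)" "afresh a u"
  shows "lconv (lam a t) (lam b u)"
proof -
  obtain v where v: "lconv u v" "LAtm a \<notin> fvs v" using assms(2) unfolding afresh_def by blast
  let ?p = "perm_atom [(a, b)]"
  have "lconv (lam a t) (lam a (ren ?p v))"
    using assms(1) lconv_ren[OF v(1)] by (meson lconv_lam lconv.trans)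
  moreover have "lam a (ren ?p v) = ren ?p (lam b v)" by (simp add: ren_lam[OF inj_perm_atom])
  moreover have "ren ?p (lam b v) = lam b v"
    by (rule ren_id) (use v(2) in \<open>auto simp: transpose_def dest: fvs_lamD\<close>)
  ultimately show ?thesis using lconv_lam[OF v(1), of b] by simp (meson lconv.sym lconv.trans)
qed

definition clean :: "('a \<Rightarrow> ('a, 'f, 's) lterm) \<Rightarrow> 'a set \<Rightarrow> ('a, 'f, 's) lterm \<Rightarrow> ('a, 'f, 's) lterm" where
  "clean d A = sb LBound (\<lambda>x. case x of LAtm a \<Rightarrow> if a \<in> A then d a else LFree x | LUnk X T \<Rightarrow> LFree x)"

lemma fvs_cleanD:
  assumes "x \<in> fvs (clean d A t)"
  shows "x \<in> fvs t \<and> x \<notin> LAtm ` A \<or> (\<exists>a \<in> A. x \<in> fvs (d a))"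
  using assms unfolding clean_def by (auto dest!: fvs_sb split: lvar.splits if_splits)

lemma lconv_clean:
  assumes "\<And>a. a \<in> A \<Longrightarrow> LAtm a \<in> fvs t \<Longrightarrow> afresh a t" "\<And>a b. LAtm b \<notin> fvs (d a)"
  shows "lconv t (clean d A t)"
proof -
  have fin: "finite {a \<in> A. LAtm a \<in> fvs t}"
    by (rule finite_imageD[of LAtm]) (auto intro: finite_subset[OF _ finite_fvs[of t]] inj_onI)
  have "lconv t (clean d B t)" if "finite B" "\<forall>a \<in> B. afresh a t" for B
    using that
  proof (induction B rule: finite_induct)
    case empty
    have "clean d {} t = sb LBound LFree t"
      unfolding clean_def by (rule sb_cong) (auto split: lvar.split)
    then show ?case by (simp add: lconv.refl)
  next
    case (insert a B)
    have *: "sb LBound (\<lambda>x. if x = LAtm a then d a else LFree x) (d b) = d b" for b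
      using asub_notin[OF assms(2)] unfolding asub_def by blast
    have "clean d (insert a B) t = asub a (d a) (clean d B t)"
      unfolding clean_def asub_def sb_sb
      by (simp, rule sb_cong) (use insert.hyps in \<open>auto simp: * split: lvar.split\<close>)
    moreover have conv: "lconv t (clean d B t)" using insert by simp
    moreover have "afresh a (clean d B t)" by (rule afresh_lconv[OF conv]) (use insert.prems in simp)
    ultimately show ?case using afresh_asub[of a "clean d B t" "d a"] by simp (meson lconv.sym lconv.trans)
  qed
  from this[OF fin] have "lconv t (clean d {a \<in> A. LAtm a \<in> fvs t} t)" using assms(1) by blast
  moreover have "clean d {a \<in> A. LAtm a \<in> fvs t} t = clean d A t"
    unfolding clean_def by (rule sb_cong) (auto split: lvar.split)
  ultimately show ?thesis by simp
qed

lemma lconv_ren_cong: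
  assumes "\<And>a. p a \<noteq> q a \<Longrightarrow> afresh a t"
  shows "lconv (ren p t) (ren q t)"
proof -
  let ?u = "clean (\<lambda>a. LConst undefined) {a. p a \<noteq> q a} t"
  have *: "lconv t ?u" by (rule lconv_clean) (use assms in auto)
  have "ren p ?u = ren q ?u" by (rule ren_cong) (auto dest!: fvs_cleanD)
  then show ?thesis using lconv_ren[OF *, of p] lconv_ren[OF *, of q] by simp (meson lconv.sym lconv.trans)
qed

section \<open>Evaluation of nominal terms in lambda-terms\<close>

primrec ev :: "('x \<Rightarrow> ('a, 'f, 's) lterm) \<Rightarrow> ('a, 'f, 'x) nterm \<Rightarrow> ('a, 'f, 's) lterm" where
  "ev \<xi> (NFun f ts) = lapps (LConst f) (map (ev \<xi>) ts)"
| "ev \<xi> (NAtm a) = LFree (LAtm a)"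
| "ev \<xi> (NAbs a t) = lam a (ev \<xi> t)"
| "ev \<xi> (NSus \<pi> X) = ren (perm_atom \<pi>) (\<xi> X)"

lemma ev_perm: "ev \<xi> (perm_term \<pi> t) = ren (perm_atom \<pi>) (ev \<xi> t)"
proof (induction t)
  case (NSus \<pi>' X)
  have "perm_atom (\<pi> @ \<pi>') = (\<lambda>a. perm_atom \<pi> (perm_atom \<pi>' a))" by (rule ext) simp
  then show ?case by (simp add: ren_ren)
qed (simp_all add: ren_lam[OF inj_perm_atom] o_def cong: map_cong)

lemma ev_napply: "ev \<xi> (napply \<sigma> t) = ev (\<lambda>X. ev \<xi> (nlookup \<sigma> X)) t"
  by (induction t) (simp_all add: ev_perm o_def cong: map_cong)

lemma ev_cong: "(\<And>X. X \<in> nvars t \<Longrightarrow> \<xi> X = \<xi>' X) \<Longrightarrow> ev \<xi> t = ev \<xi>' t"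
proof (induction t)
  case (NFun f ts)
  have "ev \<xi> t = ev \<xi>' t" if "t \<in> set ts" for t
    by (rule NFun.IH[OF that]) (use NFun.prems that in auto)
  then show ?case by (simp cong: map_cong)
qed simp_all

lemma ev_lconv: "(\<And>X. X \<in> nvars t \<Longrightarrow> lconv (\<xi> X) (\<xi>' X)) \<Longrightarrow> lconv (ev \<xi> t) (ev \<xi>' t)"
proof (induction t)
  case (NFun f ts)
  have "lconv (ev \<xi> t) (ev \<xi>' t)" if "t \<in> set ts" for t
    by (rule NFun.IH[OF that]) (use NFun.prems that in auto)
  then have "list_all2 lconv (map (ev \<xi>) ts) (map (ev \<xi>') ts)"
    by (auto simp: list_all2_conv_all_nth)
  then show ?case by (simp add: lconv_lapps lconv.refl)
qed (simp_all add: lconv.refl lconv_lam lconv_ren)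

definition sat :: "('x \<Rightarrow> ('a, 'f, 's) lterm) \<Rightarrow> ('a, 'x) fenv \<Rightarrow> bool" where
  "sat \<xi> \<Delta> \<longleftrightarrow> (\<forall>(a, X) \<in> \<Delta>. afresh a (\<xi> X))"

lemma fresh_sound:
  assumes "sat \<xi> \<Delta>"
  shows "fresh \<Delta> a t \<Longrightarrow> afresh a (ev \<xi> t)"
proof (induction rule: fresh.induct)
  case (1 a a')
  then show ?case by (simp add: afresh_atom_iff)
next
  case (2 \<pi> a X)
  then show ?case using assms by (auto simp: afresh_ren_iff sat_def)
next
  case (3 ts a f)
  then show ?case by (simp add: afresh_lapps_const)
next
  case (4 a t)
  show ?case by (simp add: afresh_lam_same)
next
  case (5 a a' t)
  then show ?case by (simp add: afresh_lam_iff)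
qed

lemma neq_sound:
  assumes "sat \<xi> \<Delta>"
  shows "neq \<Delta> t u \<Longrightarrow> lconv (ev \<xi> t) (ev \<xi> u)"
proof (induction rule: neq.induct)
  case (1 a)
  show ?case by (simp add: lconv.refl)
next
  case (2 \<pi> \<pi>' X)
  then show ?case using assms by (auto simp: sat_def intro!: lconv_ren_cong)
next
  case (3 ts ts' f)
  then have "list_all2 lconv (map (ev \<xi>) ts) (map (ev \<xi>) ts')"
    by (auto simp: list_all2_conv_all_nth)
  then show ?case by (simp add: lconv_lapps lconv.refl)
next
  case (4 t t' a)
  then show ?case by (simp add: lconv_lam)
next
  case (5 a a' t t')
  then show ?case
    using fresh_sound[OF assms 5(3)] by (simp add: swap_perm_term ev_perm lconv_lam_neqI)
qed

lemma neq_refl: "neq \<Delta> t t"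
proof (induction t)
  case (NFun f ts)
  then show ?case by (auto intro!: neq.intros simp: list_all2_conv_all_nth)
qed (auto intro: neq.intros)

lemma has_type_lapps:
  "has_type sg \<Gamma> h (foldr LFun Ts T) \<Longrightarrow> list_all2 (has_type sg \<Gamma>) us Ts \<Longrightarrow> has_type sg \<Gamma> (lapps h us) T"
proof (induction us arbitrary: h Ts)
  case (Cons u us)
  from Cons.prems(2) obtain U Us where Ts: "Ts = U # Us" "has_type sg \<Gamma> u U" "list_all2 (has_type sg \<Gamma>) us Us"
    by (auto simp: list_all2_Cons1)
  from Cons.prems(1) Ts have "has_type sg \<Gamma> (LApp h u) (foldr LFun Us T)"
    by (auto intro: has_type.intros)
  with Cons.IH Ts(3) show ?case by (simp add: lapps_Cons)
qed simp

lemma has_type_lam: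
  assumes "has_type sg [] t T"
  shows "has_type sg [] (lam a t) (LFun (LBase (AtomSort (atom_sort sg a))) T)"
proof -
  let ?A = "LBase (AtomSort (atom_sort sg a))"
  have "has_type sg [?A] (LBound 0) ?A"
    using has_type.intros(1)[of 0 "[?A]" sg] by simp
  then have "has_type sg [?A]
      (sb (\<lambda>i. LBound (Suc i)) (\<lambda>x. if x = LAtm a then LBound 0 else LFree x) t) T"
    by (intro has_type_sb[OF assms]) (auto intro: has_type.intros)
  then show ?thesis unfolding lam_sb by (rule has_type.intros)
qed

lemma has_type_ren:
  assumes "has_type sg [] t T" "\<And>a. atom_sort sg (p a) = atom_sort sg a"
  shows "has_type sg [] (ren p t) T"
  unfolding ren_def
proof (rule has_type_sb[OF assms(1)])
  fix x :: "('a, 'c) lvar"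
  show "has_type sg [] (case x of LAtm a \<Rightarrow> LFree (LAtm (p a)) | LUnk X T \<Rightarrow> LFree (LUnk X T)) (lvar_type sg x)"
    using has_type.intros(2)[of sg "[]" "LAtm (p a)" for a] has_type.intros(2)[of sg "[]" "LUnk X T" for X T]
    by (auto simp: assms(2) split: lvar.split)
qed simp

lemma ev_has_type:
  "has_sort sg t \<tau> \<Longrightarrow> (\<And>X. X \<in> nvars t \<Longrightarrow> has_type sg [] (\<xi> X) (LBase (nvar_sort X)))
    \<Longrightarrow> has_type sg [] (ev \<xi> t) (trans_sort \<tau>)"
proof (induction rule: has_sort.induct)
  case (1 ts f)
  have "list_all2 (has_type sg []) (map (ev \<xi>) ts) (map trans_sort (arg_sorts sg f))"
    unfolding list_all2_conv_all_nth
  proof (intro conjI allI impI)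
    fix i assume "i < length (map (ev \<xi>) ts)"
    then have i: "i < length ts" by simp
    then have "X \<in> nvars (NFun f ts)" if "X \<in> nvars (ts ! i)" for X
      using that nth_mem[OF i] by auto
    then show "has_type sg [] (map (ev \<xi>) ts ! i) (map trans_sort (arg_sorts sg f) ! i)"
      using 1 i by (auto simp: list_all2_conv_all_nth)
  qed (use 1 in \<open>auto dest: list_all2_lengthD\<close>)
  then have "has_type sg [] (lapps (LConst f) (map (ev \<xi>) ts)) (trans_sort (res_sort sg f))"
    by (rule has_type_lapps[rotated]) (use has_type.intros(3)[of sg "[]" f] in \<open>simp add: const_type_def\<close>)
  then show ?case by simp
next
  case (2 a)
  show ?case using has_type.intros(2)[of sg "[]" "LAtm a"] by simp
next
  case (3 t \<tau> a)
  then show ?case by (simp add: has_type_lam)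
next
  case (4 \<pi> X)
  then show ?case by (simp add: has_type_ren perm_atom_sort)
qed

abbreviation atm :: "'a \<Rightarrow> ('a, 'f, 's) lterm" where
  "atm a \<equiv> LFree (LAtm a)"

lemma lams_simps [simp]: "lams [] t = t" "lams (a # as) t = lam a (lams as t)"
  by (simp_all add: lams_def)

lemma fvs_lamsD: "x \<in> fvs (lams as t) \<Longrightarrow> x \<in> fvs t \<and> x \<notin> LAtm ` set as"
  by (induction as) (auto dest: fvs_lamD)

lemma lconv_lams: "lconv (lams as t) (lams as u) \<longleftrightarrow> lconv t u"
  by (induction as) (simp_all add: lconv_lam_same)

lemma lapps_lams: "lconv (lapps (lams as t) (map atm as)) t"
proof (induction as)
  case (Cons a as)
  have "lconv (LApp (lam a (lams as t)) (atm a)) (lams as t)"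
    using lam_apply[of a "lams as t" "atm a"] by simp
  then have "lconv (lapps (lams (a # as) t) (map atm (a # as))) (lapps (lams as t) (map atm as))"
    by (simp add: lapps_Cons lconv_lapps list_all2_refl lconv.refl)
  also note Cons.IH
  finally show ?case .
qed (simp add: lconv.refl)

lemma lams_lapps: "distinct as \<Longrightarrow> fvs M \<inter> LAtm ` set as = {} \<Longrightarrow> lconv (lams as (lapps M (map atm as))) M"
proof (induction as arbitrary: M)
  case (Cons a as)
  have "lconv (lams as (lapps (LApp M (atm a)) (map atm as))) (LApp M (atm a))"
    by (rule Cons.IH) (use Cons.prems in auto)
  then have "lconv (lams (a # as) (lapps M (map atm (a # as)))) (lam a (LApp M (atm a)))"
    by (simp add: lapps_Cons lconv_lam)
  also have "lconv (lam a (LApp M (atm a))) M"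
    by (rule lam_eta) (use Cons.prems in auto)
  finally show ?case .
qed (simp add: lconv.refl)

lemma has_type_lams:
  "has_type sg [] t T \<Longrightarrow>
    has_type sg [] (lams as t) (foldr LFun (map (\<lambda>a. LBase (AtomSort (atom_sort sg a))) as) T)"
  by (induction as) (simp_all add: has_type_lam)

lemma sb_lams:
  assumes "\<And>a. a \<in> A \<Longrightarrow> g (LAtm a) = atm a"
    and "\<And>x a. x \<notin> LAtm ` A \<Longrightarrow> a \<in> A \<Longrightarrow> LAtm a \<notin> fvs (g x)"
  shows "set as \<subseteq> A \<Longrightarrow> sb LBound g (lams as t) = lams as (sb LBound g t)"
proof (induction as)
  case (Cons a as)
  have "sb LBound g (lam a (lams as t)) = lam a (sb LBound g (lams as t))"
  proof (rule sb_lam)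
    show "LAtm a \<notin> fvs (g x)" if "x \<noteq> LAtm a" for x
      using that assms Cons.prems by (cases "x \<in> LAtm ` A") auto
  qed (use assms(1) Cons.prems in simp)
  with Cons show ?case by simp
qed simp

lemma sb_ev:
  assumes "\<And>a. a \<in> A \<Longrightarrow> g (LAtm a) = atm a"
    and "\<And>x a. x \<notin> LAtm ` A \<Longrightarrow> a \<in> A \<Longrightarrow> LAtm a \<notin> fvs (g x)"
  shows "natoms t \<subseteq> A \<Longrightarrow> sb LBound g (ev \<xi> t) = ev (\<lambda>X. sb LBound g (\<xi> X)) t"
proof (induction t)
  case (NFun f ts)
  then have "map (sb LBound g) (map (ev \<xi>) ts) = map (ev (\<lambda>X. sb LBound g (\<xi> X))) ts" by auto
  then show ?case by (simp del: map_map)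
next
  case (NAbs a t)
  have "sb LBound g (lam a (ev \<xi> t)) = lam a (sb LBound g (ev \<xi> t))"
  proof (rule sb_lam)
    show "LAtm a \<notin> fvs (g x)" if "x \<noteq> LAtm a" for x
      using that assms NAbs.prems by (cases "x \<in> LAtm ` A") auto
  qed (use assms(1) NAbs.prems in simp)
  with NAbs show ?case by simp
next
  case (NAtm a)
  then show ?case using assms(1) by simp
next
  case (NSus \<pi> X)
  then have \<pi>: "patoms \<pi> \<subseteq> A" by simp
  have "sb LBound g (case x of LAtm a \<Rightarrow> atm (perm_atom \<pi> a) | LUnk X T \<Rightarrow> LFree (LUnk X T)) =
      ren (perm_atom \<pi>) (g x)" for x
  proof (cases "x \<in> LAtm ` A")
    case True
    then obtain a where "x = LAtm a" "a \<in> A" "perm_atom \<pi> a \<in> A" using perm_atom_in[OF _ \<pi>] by blast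
    then show ?thesis by (simp add: assms(1))
  next
    case False
    have "ren (perm_atom \<pi>) (g x) = g x"
    proof (rule ren_id)
      fix a assume "LAtm a \<in> fvs (g x)"
      with assms(2)[OF False, of a] \<pi> have "a \<notin> patoms \<pi>" by auto
      then show "perm_atom \<pi> a = a" by (rule perm_atom_fixed)
    qed
    moreover have "perm_atom \<pi> a = a" if "x = LAtm a" for a
      using that False \<pi> perm_atom_fixed[of a \<pi>] by blast
    ultimately show ?thesis by (cases x) auto
  qed
  then have "sb LBound g (ren (perm_atom \<pi>) (\<xi> X)) = ren (perm_atom \<pi>) (sb LBound g (\<xi> X))"
    unfolding ren_def sb_sb by simp
  then show ?case by simp
qed

section \<open>The translation as an evaluation\<close>

definition tval ::
  "('a, 'f, 's) nsig \<Rightarrow> 'a list \<Rightarrow> ('a, 's nvar) fenv \<Rightarrow> 's nvar \<Rightarrow> ('a, 'f, 's) lterm" where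
  "tval sg as \<Delta> X = lapps (LFree (trans_var sg as \<Delta> X)) (map atm (nonfresh as \<Delta> X))"

lemma trans_term_ev: "trans_term sg as \<Delta> t = ev (tval sg as \<Delta>) t"
proof (induction t)
  case (NSus \<pi> X)
  show ?case by (simp add: tval_def trans_var_def o_def)
qed (simp_all cong: map_cong)

lemma trans_var_inject: "trans_var sg as \<Delta> X = trans_var sg as \<Delta>' Y \<Longrightarrow> X = Y"
  by (simp add: trans_var_def)

lemma trans_var_neq_LAtm [simp]: "trans_var sg as \<Delta> X \<noteq> LAtm a" "LAtm a \<noteq> trans_var sg as \<Delta> X"
  by (simp_all add: trans_var_def)

lemma has_type_atms:
  "list_all2 (has_type sg []) (map atm bs) (map (\<lambda>a. LBase (AtomSort (atom_sort sg a))) bs)"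
  using has_type.intros(2)[of sg "[]" "LAtm a" for a] by (auto simp: list_all2_conv_all_nth)

lemma tval_has_type: "has_type sg [] (tval sg as \<Delta> X) (LBase (nvar_sort X))"
proof -
  let ?Ts = "map (\<lambda>a. LBase (AtomSort (atom_sort sg a))) (nonfresh as \<Delta> X)"
  have "has_type sg [] (LFree (trans_var sg as \<Delta> X)) (foldr LFun ?Ts (LBase (nvar_sort X)))"
    using has_type.intros(2)[of sg "[]" "trans_var sg as \<Delta> X"] by (simp add: trans_var_def)
  then show ?thesis unfolding tval_def by (rule has_type_lapps) (rule has_type_atms)
qed

lemma tval_sat: "sat (tval sg as \<Delta>) \<Delta>"
  unfolding sat_def by (auto simp: tval_def nonfresh_def intro!: afresh_notin)

lemma ren_tval:
  "ren (perm_atom \<pi>) (tval sg as \<Delta> X) =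
    lapps (LFree (trans_var sg as \<Delta> X)) (map (\<lambda>b. atm (perm_atom \<pi> b)) (nonfresh as \<Delta> X))"
  by (simp add: tval_def trans_var_def o_def)

lemma fresh_complete:
  "afresh a (ev (tval sg as \<Delta>) t) \<Longrightarrow> a \<in> set as \<Longrightarrow> natoms t \<subseteq> set as \<Longrightarrow> fresh \<Delta> a t"
proof (induction t)
  case (NFun f ts)
  then have "\<forall>t \<in> set ts. afresh a (ev (tval sg as \<Delta>) t)"
    using afresh_lapps_args[of a "LConst f" "map (ev (tval sg as \<Delta>)) ts"] by simp
  then show ?case using NFun by (auto intro!: fresh.intros)
next
  case (NAtm b)
  then show ?case by (auto simp: afresh_atom_iff intro: fresh.intros)
next
  case (NAbs b t)
  then show ?case by (cases "a = b") (auto simp: afresh_lam_iff intro: fresh.intros)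
next
  case (NSus \<pi> X)
  let ?b = "perm_atom (rev \<pi>) a"
  have "afresh ?b (tval sg as \<Delta> X)" using NSus.prems by (simp add: afresh_ren_iff)
  then have "?b \<notin> set (nonfresh as \<Delta> X)"
    using afresh_lapps_args[of ?b "LFree (trans_var sg as \<Delta> X)" "map atm (nonfresh as \<Delta> X)" "atm ?b"]
    by (auto simp: tval_def afresh_atom_iff)
  moreover have "?b \<in> set as" using perm_atom_in[of a "set as" "rev \<pi>"] NSus.prems by simp
  ultimately show ?case by (auto simp: nonfresh_def intro!: fresh.intros)
qed

lemma lconv_const_ev_tvalD:
  assumes "has_sort sg u \<tau>" "lconv (lapps (LConst f) Ms) (ev (tval sg as \<Delta>) u)"
    and "length (arg_sorts sg f) \<le> length Ms"
  shows "\<exists>us. u = NFun f us \<and> list_all2 lconv Ms (map (ev (tval sg as \<Delta>)) us)"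
  using assms
proof (induction u arbitrary: Ms \<tau>)
  case (NFun g us)
  then have "lconv (lapps (LConst f) Ms) (lapps (LConst g) (map (ev (tval sg as \<Delta>)) us))" by simp
  from lconv_lapps_headD[OF _ _ this] show ?case by simp
next
  case (NAtm a)
  then have "lconv (lapps (LConst f) Ms) (lapps (LFree (LAtm a)) [])" by simp
  from lconv_lapps_headD(1)[OF _ _ this] show ?case by simp
next
  case (NAbs a u)
  from NAbs.prems(1) obtain \<tau>' where \<tau>': "has_sort sg u \<tau>'" by (auto elim: has_sort_NAbsE)
  have "lconv (lapps (LConst f) (Ms @ [atm a])) (LApp (lam a (ev (tval sg as \<Delta>) u)) (atm a))"
    using NAbs.prems(2) by (simp add: lconv.app lconv.refl)
  also have "lconv \<dots> (ev (tval sg as \<Delta>) u)"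
    using lam_apply[of a "ev (tval sg as \<Delta>) u" "atm a"] by simp
  finally obtain us where us: "u = NFun f us" "list_all2 lconv (Ms @ [atm a]) (map (ev (tval sg as \<Delta>)) us)"
    using NAbs.IH[OF \<tau>', of "Ms @ [atm a]"] NAbs.prems(3) by auto
  from us(1) \<tau>' have "length us = length (arg_sorts sg f)"
    by (auto elim!: has_sort_NFunE dest: list_all2_lengthD)
  moreover from us(2) have "length us = Suc (length Ms)" by (auto dest: list_all2_lengthD)
  ultimately show ?case using NAbs.prems(3) by simp
next
  case (NSus \<pi> X)
  then have "lconv (lapps (LConst f) Ms) (lapps (LFree (trans_var sg as \<Delta> X))
    (map (\<lambda>b. atm (perm_atom \<pi> b)) (nonfresh as \<Delta> X)))"
    by (simp only: ev.simps ren_tval)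
  from lconv_lapps_headD(1)[OF _ _ this] show ?case by simp
qed

lemma neq_complete:
  fixes t u :: "('a, 'f, 's nvar) nterm"
  assumes "has_sort sg t \<tau>" "has_sort sg u \<tau>" "natoms t \<subseteq> set as" "natoms u \<subseteq> set as"
    and "lconv (ev (tval sg as \<Delta>) t) (ev (tval sg as \<Delta>) u)"
  shows "neq \<Delta> t u"
  using assms
proof (induction t arbitrary: u \<tau>)
  case (NFun f ts)
  let ?e = "ev (tval sg as \<Delta>)"
  from NFun.prems(1) have ts: "list_all2 (has_sort sg) ts (arg_sorts sg f)"
    by (auto elim: has_sort_NFunE)
  have "lconv (lapps (LConst f) (map ?e ts)) (?e u)" using NFun.prems(5) by simp
  then obtain us where us: "u = NFun f us" "list_all2 lconv (map ?e ts) (map ?e us)"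
    using lconv_const_ev_tvalD[OF NFun.prems(2), of f "map ?e ts" as \<Delta>] list_all2_lengthD[OF ts]
    by auto
  from NFun.prems(2) us have us': "list_all2 (has_sort sg) us (arg_sorts sg f)"
    by (auto elim: has_sort_NFunE)
  have "list_all2 (neq \<Delta>) ts us"
    unfolding list_all2_conv_all_nth
  proof (intro conjI allI impI)
    show len: "length ts = length us" using us(2) by (auto dest: list_all2_lengthD)
    fix i assume i: "i < length ts"
    show "neq \<Delta> (ts ! i) (us ! i)"
    proof (rule NFun.IH)
      show "ts ! i \<in> set ts" using i by simp
      show "has_sort sg (ts ! i) (arg_sorts sg f ! i)" "has_sort sg (us ! i) (arg_sorts sg f ! i)"
        using ts us' i len by (auto simp: list_all2_conv_all_nth)
      show "natoms (ts ! i) \<subseteq> set as" using NFun.prems(3) i nth_mem by fastforce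
      show "natoms (us ! i) \<subseteq> set as" using NFun.prems(4) us(1) i len nth_mem by fastforce
      show "lconv (?e (ts ! i)) (?e (us ! i))" using us(2) i by (auto simp: list_all2_conv_all_nth)
    qed
  qed
  then show ?case using us(1) by (simp add: neq.intros)
next
  case (NAtm a)
  let ?e = "ev (tval sg as \<Delta>)"
  have *: "lconv (lapps (LFree (LAtm a)) []) (?e u)" using NAtm.prems(5) by simp
  show ?case
  proof (cases u)
    case (NFun f us)
    then show ?thesis using lconv_lapps_headD(1)[of "LFree (LAtm a)" "LConst f" "[]" "map ?e us"] * by simp
  next
    case (NAtm b)
    then show ?thesis
      using lconv_lapps_headD(1)[of "LFree (LAtm a)" "LFree (LAtm b)" "[]" "[]"] * by (auto intro: neq.intros)
  next
    case (NAbs b u')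
    then show ?thesis using NAtm.prems(1,2) by (auto elim!: has_sort_NAtmE has_sort_NAbsE)
  next
    case (NSus \<pi> X)
    then show ?thesis
      using lconv_lapps_headD(1)[OF _ _ *[unfolded NSus ev.simps ren_tval]] by simp
  qed
next
  case (NAbs a t)
  let ?e = "ev (tval sg as \<Delta>)"
  from NAbs.prems(1) obtain \<tau>' where \<tau>': "\<tau> = AbsSort (atom_sort sg a) \<tau>'" "has_sort sg t \<tau>'"
    by (auto elim: has_sort_NAbsE)
  show ?case
  proof (cases u)
    case (NFun f us)
    from NAbs.prems(2) NFun have "list_all2 (has_sort sg) us (arg_sorts sg f)"
      by (auto elim: has_sort_NFunE)
    moreover have "lconv (lapps (LConst f) (map ?e us)) (?e (NAbs a t))"
      using lconv.sym[OF NAbs.prems(5)] NFun by simp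
    ultimately have "\<exists>us'. NAbs a t = NFun f us' \<and> list_all2 lconv (map ?e us) (map ?e us')"
      by (intro lconv_const_ev_tvalD[OF NAbs.prems(1)]) (auto dest: list_all2_lengthD)
    then show ?thesis by simp
  next
    case (NAtm b)
    then show ?thesis using \<tau>' NAbs.prems(2) by (auto elim!: has_sort_NAtmE)
  next
    case (NSus \<pi> X)
    then show ?thesis using \<tau>' NAbs.prems(2) by (auto elim!: has_sort_NSusE)
  next
    case u: (NAbs b u')
    from NAbs.prems(2) u \<tau>' have u': "has_sort sg u' \<tau>'" "atom_sort sg b = atom_sort sg a"
      by (auto elim: has_sort_NAbsE)
    show ?thesis
    proof (cases "a = b")
      case True
      then have "lconv (?e t) (?e u')" using NAbs.prems(5) u by (simp add: lconv_lam_same)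
      then have "neq \<Delta> t u'" using NAbs.IH[OF \<tau>'(2) u'(1)] NAbs.prems(3,4) u by simp
      then show ?thesis using u True by (simp add: neq.intros)
    next
      case False
      have conv: "lconv (lam a (?e t)) (lam b (?e u'))" using NAbs.prems(5) u by simp
      have "fresh \<Delta> a u'"
        by (rule fresh_complete[OF lconv_lam_neqD(1)[OF conv False]]) (use NAbs.prems(3,4) u in auto)
      moreover have "neq \<Delta> t (perm_term [(a, b)] u')"
      proof (rule NAbs.IH[OF \<tau>'(2)])
        show "has_sort sg (perm_term [(a, b)] u') \<tau>'"
          by (rule has_sort_perm) (use u' in auto)
        show "natoms (perm_term [(a, b)] u') \<subseteq> set as"
          using natoms_perm[of "[(a, b)]" u'] NAbs.prems(3,4) u by auto
        show "lconv (?e t) (?e (perm_term [(a, b)] u'))"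
          using lconv_lam_neqD(2)[OF conv False] by (simp only: ev_perm)
      qed (use NAbs.prems(3) in simp)
      ultimately show ?thesis using u False by (simp add: neq.intros swap_perm_term)
    qed
  qed
next
  case (NSus \<pi> X)
  let ?e = "ev (tval sg as \<Delta>)"
  note * = NSus.prems(5)[unfolded ev.simps ren_tval]
  show ?case
  proof (cases u)
    case (NFun f us)
    then show ?thesis using lconv_lapps_headD(1)[OF _ _ *[unfolded NFun ev.simps]] by simp
  next
    case (NAtm b)
    have "lconv (?e u) (lapps (LFree (LAtm b)) [])" using NAtm by (simp add: lconv.refl)
    from lconv_lapps_headD(1)[OF _ _ lconv.trans[OF * this]] show ?thesis by simp
  next
    case (NAbs b u')
    then show ?thesis using NSus.prems(1,2) by (auto elim!: has_sort_NSusE has_sort_NAbsE)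
  next
    case u: (NSus \<pi>' Y)
    note ** = *[unfolded u ev.simps ren_tval]
    from lconv_lapps_headD(1)[OF _ _ **] have XY: "X = Y" by (auto dest: trans_var_inject)
    from lconv_lapps_headD(2)[OF _ _ **] XY
    have l: "\<forall>b \<in> set (nonfresh as \<Delta> X). lconv (atm (perm_atom \<pi> b) :: ('a, 'f, 's) lterm) (atm (perm_atom \<pi>' b))"
      by (auto simp: list_all2_conv_all_nth in_set_conv_nth)
    have eq: "perm_atom \<pi> b = perm_atom \<pi>' b" if "b \<in> set (nonfresh as \<Delta> X)" for b
      using lconv_lapps_headD(1)[of "atm (perm_atom \<pi> b) :: ('a, 'f, 's) lterm" "atm (perm_atom \<pi>' b)" "[]" "[]"] l that by auto
    have "(b, X) \<in> \<Delta>" if "perm_atom \<pi> b \<noteq> perm_atom \<pi>' b" for b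
    proof -
      have "b \<in> set as"
      proof (rule ccontr)
        assume "b \<notin> set as"
        then have "b \<notin> patoms \<pi>" "b \<notin> patoms \<pi>'" using NSus.prems(3,4) u by auto
        then show False using that by (simp add: perm_atom_fixed)
      qed
      then show ?thesis using eq that by (auto simp: nonfresh_def)
    qed
    then show ?thesis using u XY by (auto intro!: neq.intros)
  qed
qed

section \<open>Nominal substitutions\<close>

lemma nvars_napply: "nvars (napply \<sigma> t) = (\<Union>X \<in> nvars t. nvars (nlookup \<sigma> X))"
  by (induction t) simp_all

lemma natoms_napply: "natoms (napply \<sigma> t) \<subseteq> natoms t \<union> (\<Union>X \<in> nvars t. natoms (nlookup \<sigma> X))"
proof (induction t)
  case (NSus \<pi> X)
  show ?case using natoms_perm[of \<pi> "nlookup \<sigma> X"] by auto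
next
  case (NFun f ts)
  show ?case
  proof
    fix a assume "a \<in> natoms (napply \<sigma> (NFun f ts))"
    then obtain t where t: "t \<in> set ts" "a \<in> natoms (napply \<sigma> t)" by auto
    with NFun.IH have "a \<in> natoms t \<union> (\<Union>X \<in> nvars t. natoms (nlookup \<sigma> X))" by blast
    with t(1) show "a \<in> natoms (NFun f ts) \<union> (\<Union>X \<in> nvars (NFun f ts). natoms (nlookup \<sigma> X))" by auto
  qed
qed auto

lemma finite_nvars [simp]: "finite (nvars t)"
  by (induction t) simp_all

lemma finite_natoms [simp]: "finite (natoms t)"
  by (induction t) (simp_all add: patoms_def)

lemma nlookup_has_sort: "nsubst_wf sg \<sigma> \<Longrightarrow> has_sort sg (nlookup \<sigma> X) (BaseSort (nvar_sort X))"
  unfolding nsubst_wf_def nlookup_def using has_sort_var[of sg X] by (auto split: option.split)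

lemma has_sort_napply:
  assumes "\<And>X. X \<in> nvars t \<Longrightarrow> has_sort sg (nlookup \<sigma> X) (BaseSort (nvar_sort X))"
  shows "has_sort sg t \<tau> \<Longrightarrow> has_sort sg (napply \<sigma> t) \<tau>"
  using assms
proof (induction t arbitrary: \<tau>)
  case (NFun f ts)
  from NFun.prems(1) have ts: "list_all2 (has_sort sg) ts (arg_sorts sg f)" "\<tau> = res_sort sg f"
    by (auto elim: has_sort_NFunE)
  have "has_sort sg (napply \<sigma> t) \<tau>'" if "t \<in> set ts" "has_sort sg t \<tau>'" for t \<tau>'
    by (rule NFun.IH[OF that]) (use NFun.prems(2) that(1) in auto)
  then have "list_all2 (has_sort sg) (map (napply \<sigma>) ts) (arg_sorts sg f)"
    using ts(1) by (auto simp: list_all2_conv_all_nth)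
  then show ?case using ts(2) by (simp add: has_sort.intros)
next
  case (NAbs a t)
  then show ?case by (auto elim!: has_sort_NAbsE intro!: has_sort.intros)
next
  case (NSus \<pi> X)
  then show ?case by (auto elim!: has_sort_NSusE intro!: has_sort_perm)
qed (simp add: has_sort.intros)

lemma nlookup_ncomp: "nlookup (ncomp \<sigma>1 \<sigma>2) X = napply \<sigma>1 (nlookup \<sigma>2 X)"
  by (auto simp: ncomp_def nlookup_def split: option.split)

lemma nlookup_nrestrict: "X \<in> V \<Longrightarrow> nlookup (nrestrict \<sigma> V) X = nlookup \<sigma> X"
  by (auto simp: nrestrict_def nlookup_def)

lemma nmore_general_iff:
  "nmore_general sg \<Delta>1 \<sigma>1 \<Delta>2 \<sigma>2 \<longleftrightarrow> (\<exists>\<sigma>'. nsubst_wf sg \<sigma>' \<and> fenv_entails \<Delta>2 \<sigma>' \<Delta>1 \<and>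
    (\<forall>X \<in> dom \<sigma>1 \<union> dom \<sigma>2. neq \<Delta>2 (napply \<sigma>' (nlookup \<sigma>1 X)) (nlookup \<sigma>2 X)))"
proof -
  have "dom (nrestrict \<sigma> V) = V" for \<sigma> :: "('a, 'b, 'c nvar) nsubst" and V
    by (auto simp: nrestrict_def split: if_splits)
  then show ?thesis
    unfolding nmore_general_def nsubst_eq_def by (simp add: nlookup_nrestrict nlookup_ncomp Un_assoc)
qed

lemma neq_nvars: "neq \<Delta> t u \<Longrightarrow> nvars t = nvars u"
proof (induction rule: neq.induct)
  case (3 ts us f)
  then have "map nvars ts = map nvars us"
    by (auto simp: list_all2_conv_all_nth intro: nth_equalityI)
  then have "nvars ` set ts = nvars ` set us" by (metis list.set_map)
  then show ?case by simp
qed simp_all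

primrec nsize :: "('a, 'f, 'x) nterm \<Rightarrow> nat" where
  "nsize (NFun f ts) = Suc (sum_list (map nsize ts))"
| "nsize (NAtm a) = 1"
| "nsize (NAbs a t) = Suc (nsize t)"
| "nsize (NSus \<pi> X) = 1"

lemma nsize_swap [simp]: "nsize (swap_term s t) = nsize t"
  by (induction t) (simp_all add: o_def cong: map_cong)

lemma nsize_perm [simp]: "nsize (perm_term \<pi> t) = nsize t"
  by (induction \<pi>) (simp_all add: perm_term_def)

lemma neq_nsize: "neq \<Delta> t u \<Longrightarrow> nsize t = nsize u"
proof (induction rule: neq.induct)
  case (3 ts us f)
  then have "map nsize ts = map nsize us"
    by (auto simp: list_all2_conv_all_nth intro: nth_equalityI)
  then show ?case by simp
qed simp_all

lemma nsize_napply_ge: "X \<in> nvars t \<Longrightarrow> nsize (nlookup \<sigma> X) \<le> nsize (napply \<sigma> t)"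
proof (induction t)
  case (NFun f ts)
  then obtain t where t: "t \<in> set ts" "nsize (nlookup \<sigma> X) \<le> nsize (napply \<sigma> t)" by auto
  then have "nsize (napply \<sigma> t) \<le> sum_list (map (\<lambda>t. nsize (napply \<sigma> t)) ts)"
    by (intro member_le_sum_list) simp_all
  with t(2) show ?case by (simp add: o_def)
qed auto

lemma nsize_napply_gt:
  assumes "X \<in> nvars t" "\<And>\<pi>. t \<noteq> NSus \<pi> X"
  shows "nsize (nlookup \<sigma> X) < nsize (napply \<sigma> t)"
proof (cases t)
  case (NFun f ts)
  then obtain s where s: "s \<in> set ts" "X \<in> nvars s" using assms(1) by auto
  have "nsize (napply \<sigma> s) \<le> sum_list (map (\<lambda>t. nsize (napply \<sigma> t)) ts)"
    using s(1) by (intro member_le_sum_list) simp_all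
  with nsize_napply_ge[OF s(2), of \<sigma>] NFun show ?thesis by (simp add: o_def)
next
  case (NAbs a s)
  with assms(1) nsize_napply_ge[of X s \<sigma>] show ?thesis by simp
qed (use assms in auto)

inductive skel :: "('a, 'f, 'x) nterm \<Rightarrow> ('a, 'f, 'x) nterm \<Rightarrow> bool" where
  "skel (NSus \<pi> X) t"
| "skel (NAtm a) (NAtm b)"
| "list_all2 skel ts us \<Longrightarrow> skel (NFun f ts) (NFun f us)"
| "skel t u \<Longrightarrow> skel (NAbs a t) (NAbs b u)"

lemma skel_perm_left: "skel t u \<Longrightarrow> skel (perm_term \<pi> t) u"
proof (induction rule: skel.induct)
  case (3 ts us f)
  then show ?case by (auto intro!: skel.intros simp: list_all2_conv_all_nth)
qed (auto intro: skel.intros)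

lemma skel_perm_rightD:
  "skel t (perm_term \<pi> u) \<Longrightarrow> skel t u"
proof (induction t arbitrary: u)
  case (NFun f ts)
  from NFun.prems obtain us where us: "u = NFun f us" "list_all2 skel ts (map (perm_term \<pi>) us)"
    by (cases u) (auto elim: skel.cases)
  then have "list_all2 skel ts us" using NFun.IH by (auto simp: list_all2_conv_all_nth)
  then show ?case using us by (simp add: skel.intros)
next
  case (NAtm a)
  then show ?case by (cases u) (auto elim: skel.cases intro: skel.intros)
next
  case (NAbs a t)
  from NAbs.prems obtain b u' where u': "u = NAbs b u'" "skel t (perm_term \<pi> u')"
    by (cases u) (auto elim: skel.cases)
  then show ?case using NAbs.IH by (simp add: skel.intros)
qed (simp add: skel.intros)

lemma neq_skel: "neq \<Delta> (napply \<sigma> t) u \<Longrightarrow> skel t u"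
proof (induction t arbitrary: u)
  case (NFun f ts)
  from NFun.prems obtain us where us: "u = NFun f us" "list_all2 (neq \<Delta>) (map (napply \<sigma>) ts) us"
    by (auto elim: neq.cases)
  then have "list_all2 skel ts us" using NFun.IH by (auto simp: list_all2_conv_all_nth)
  then show ?case using us by (simp add: skel.intros)
next
  case (NAtm a)
  then show ?case by (auto elim: neq.cases intro: skel.intros)
next
  case (NAbs a t)
  from NAbs.prems obtain b u' where u': "u = NAbs b u'"
    "neq \<Delta> (napply \<sigma> t) u' \<or> neq \<Delta> (napply \<sigma> t) (perm_term [(a, b)] u')"
    by (auto elim: neq.cases simp: swap_perm_term)
  then have "skel t u'" using NAbs.IH skel_perm_rightD by blast
  then show ?case using u' by (simp add: skel.intros)
qed (simp add: skel.intros)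

text \<open>
  Reads a nominal substitution off a lambda-instance. Without \<open>skel\<close> this fails: for a constant
  \<open>f\<close> of abstraction sort, \<open>\<lambda>a. Y a\<close> has the instance \<open>f\<close>, but \<open>a.Y\<close> has no instance \<open>f\<close>.
\<close>

lemma lconv_ev_extract:
  assumes "skel u s" "has_sort sg s \<tau>" "has_sort sg u \<tau>"
    and "lconv (ev \<phi> s) (ev (tval sg as \<Delta>) u)" "Y \<in> nvars s"
  shows "\<exists>v. has_sort sg v (BaseSort (nvar_sort Y)) \<and> lconv (\<phi> Y) (ev (tval sg as \<Delta>) v) \<and>
    nvars v \<subseteq> nvars u \<and> natoms v \<subseteq> natoms s \<union> natoms u"
  using assms
proof (induction s arbitrary: u \<tau> rule: nterm.induct)
  case (NFun f ss)
  let ?e = "ev (tval sg as \<Delta>)"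
  from NFun.prems(2) have ss: "list_all2 (has_sort sg) ss (arg_sorts sg f)"
    by (auto elim: has_sort_NFunE)
  have "lconv (lapps (LConst f) (map (ev \<phi>) ss)) (?e u)" using NFun.prems(4) by simp
  then obtain us where us: "u = NFun f us" "list_all2 lconv (map (ev \<phi>) ss) (map ?e us)"
    using lconv_const_ev_tvalD[OF NFun.prems(3), of f "map (ev \<phi>) ss" as \<Delta>] list_all2_lengthD[OF ss]
    by auto
  from NFun.prems(3) us(1) have us': "list_all2 (has_sort sg) us (arg_sorts sg f)"
    by (auto elim: has_sort_NFunE)
  from NFun.prems(1) us(1) have sk: "list_all2 skel us ss" by (auto elim: skel.cases)
  from NFun.prems(5) obtain i where i: "i < length ss" "Y \<in> nvars (ss ! i)"
    by (auto simp: in_set_conv_nth)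
  have len: "i < length us" "i < length (arg_sorts sg f)"
    using i list_all2_lengthD[OF sk] list_all2_lengthD[OF ss] by auto
  have "\<exists>v. has_sort sg v (BaseSort (nvar_sort Y)) \<and> lconv (\<phi> Y) (?e v) \<and>
    nvars v \<subseteq> nvars (us ! i) \<and> natoms v \<subseteq> natoms (ss ! i) \<union> natoms (us ! i)"
    by (rule NFun.IH[of _ _ "arg_sorts sg f ! i"])
      (use i len sk ss us' us(2) in \<open>auto simp: list_all2_conv_all_nth\<close>)
  moreover have "nvars (us ! i) \<subseteq> nvars u" "natoms (us ! i) \<subseteq> natoms u" "natoms (ss ! i) \<subseteq> natoms (NFun f ss)"
    using us(1) nth_mem[OF len(1)] nth_mem[OF i(1)] by auto
  ultimately show ?case by blast
next
  case (NAbs a s)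
  let ?e = "ev (tval sg as \<Delta>)"
  from NAbs.prems(2) obtain \<tau>' where \<tau>': "\<tau> = AbsSort (atom_sort sg a) \<tau>'" "has_sort sg s \<tau>'"
    by (auto elim: has_sort_NAbsE)
  obtain b u' where u: "u = NAbs b u'" "skel u' s"
    using NAbs.prems(1,3) \<tau>'(1) by (cases u) (auto elim: skel.cases elim!: has_sort_NSusE)
  from NAbs.prems(3) u \<tau>' have u': "has_sort sg u' \<tau>'" "atom_sort sg b = atom_sort sg a"
    by (auto elim: has_sort_NAbsE)
  have conv: "lconv (lam a (ev \<phi> s)) (lam b (?e u'))" using NAbs.prems(4) u by simp
  have Y: "Y \<in> nvars s" using NAbs.prems(5) by simp
  show ?case
  proof (cases "a = b")
    case True
    then have "lconv (ev \<phi> s) (?e u')" using conv by (simp add: lconv_lam_same)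
    from NAbs.IH[OF u(2) \<tau>'(2) u'(1) this Y] show ?thesis using u(1) by auto
  next
    case False
    let ?u = "perm_term [(a, b)] u'"
    have "has_sort sg ?u \<tau>'" by (rule has_sort_perm) (use u' in auto)
    moreover have "lconv (ev \<phi> s) (?e ?u)"
      using lconv_lam_neqD(2)[OF conv False] by (simp only: ev_perm)
    ultimately obtain v where v: "has_sort sg v (BaseSort (nvar_sort Y))" "lconv (\<phi> Y) (?e v)"
      "nvars v \<subseteq> nvars ?u" "natoms v \<subseteq> natoms s \<union> natoms ?u"
      using NAbs.IH[OF skel_perm_left[OF u(2)] \<tau>'(2) _ _ Y] by blast
    then show ?thesis using u(1) natoms_perm[of "[(a, b)]" u'] by (intro exI[of _ v]) auto
  qed
next
  case (NSus \<pi> X)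
  let ?v = "perm_term (rev \<pi>) u"
  have XY: "X = Y" using NSus.prems(5) by simp
  have "lconv (ren (perm_atom (rev \<pi>)) (ren (perm_atom \<pi>) (\<phi> X))) (ev (tval sg as \<Delta>) ?v)"
    unfolding ev_perm using NSus.prems(4) by (intro lconv_ren) simp
  then have "lconv (\<phi> Y) (ev (tval sg as \<Delta>) ?v)" using XY by simp
  moreover have "has_sort sg ?v (BaseSort (nvar_sort Y))"
    by (rule has_sort_perm) (use NSus.prems(2,3) XY in \<open>auto elim!: has_sort_NSusE\<close>)
  ultimately show ?case using natoms_perm[of "rev \<pi>" u] by (intro exI[of _ ?v]) auto
qed simp

section \<open>Instances of translated terms\<close>

lemma fvs_ev_unk: "LUnk Z T \<in> fvs (ev \<xi> t) \<Longrightarrow> \<exists>X \<in> nvars t. LUnk Z T \<in> fvs (\<xi> X)"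
proof (induction t)
  case (NFun f ts)
  then obtain t where t: "t \<in> set ts" "LUnk Z T \<in> fvs (ev \<xi> t)" by auto
  with NFun.IH obtain X where "X \<in> nvars t" "LUnk Z T \<in> fvs (\<xi> X)" by blast
  with t(1) show ?case by auto
next
  case (NAbs a t)
  then show ?case using fvs_lamD by fastforce
next
  case (NSus \<pi> X)
  then have "LUnk Z T \<in> fvs (ren (perm_atom \<pi>) (\<xi> X))" by simp
  then have "LUnk Z T \<in> fvs (\<xi> X)" unfolding ren_def by (auto dest!: fvs_sb split: lvar.splits)
  then show ?case by simp
qed auto

lemma fvs_ev_atm:
  "LAtm a \<in> fvs (ev \<xi> t) \<Longrightarrow> natoms t \<subseteq> A \<Longrightarrow>
    (\<And>X b. X \<in> nvars t \<Longrightarrow> LAtm b \<in> fvs (\<xi> X) \<Longrightarrow> b \<in> A) \<Longrightarrow> a \<in> A"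
proof (induction t)
  case (NFun f ts)
  then obtain t where t: "t \<in> set ts" "LAtm a \<in> fvs (ev \<xi> t)" by auto
  have "b \<in> A" if "X \<in> nvars t" "LAtm b \<in> fvs (\<xi> X)" for X b
    by (rule NFun.prems(3)[of X]) (use that t(1) in auto)
  moreover have "natoms t \<subseteq> A" using NFun.prems(2) t(1) by auto
  ultimately show ?case using NFun.IH[OF t] by blast
next
  case (NAbs b t)
  show ?case by (rule NAbs.IH) (use NAbs.prems fvs_lamD[of "LAtm a" b "ev \<xi> t"] in auto)
next
  case (NSus \<pi> X)
  then obtain b where "a = perm_atom \<pi> b" "LAtm b \<in> fvs (\<xi> X)" by (auto dest: fvs_renD)
  then show ?case using NSus perm_atom_in[of b A \<pi>] by auto
qed auto

lemma fvs_trans_unk: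
  "LUnk Z T \<in> fvs (ev (tval sg as \<Delta>) t) \<Longrightarrow> \<exists>X \<in> nvars t. LUnk Z T = trans_var sg as \<Delta> X"
  using fvs_ev_unk[of Z T "tval sg as \<Delta>" t] by (auto simp: tval_def)

lemma fvs_trans_atm: "LAtm a \<in> fvs (ev (tval sg as \<Delta>) t) \<Longrightarrow> natoms t \<subseteq> set as \<Longrightarrow> a \<in> set as"
  by (rule fvs_ev_atm) (auto simp: tval_def nonfresh_def)

lemma lapply_sb: "lapply \<theta> = sb LBound (llookup \<theta>)"
  by (rule ext) (simp add: lapply_def lsubst_free_sb)

lemma lconv_trans_inst:
  assumes "set bs \<subseteq> set as" "natoms t \<subseteq> set as" "\<And>a. a \<in> set as \<Longrightarrow> g (LAtm a) = atm a"
    and no_atoms: "\<And>X a. X \<in> nvars t \<Longrightarrow> a \<in> set as \<Longrightarrow> LAtm a \<notin> fvs (g (trans_var sg as \<Delta> X))"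
    and conv: "\<And>X. X \<in> nvars t \<Longrightarrow>
      lconv (lapps (g (trans_var sg as \<Delta> X)) (map atm (nonfresh as \<Delta> X))) (\<xi> X)"
  shows "lconv (sb LBound g (lams bs (ev (tval sg as \<Delta>) t))) (lams bs (ev \<xi> t))"
proof -
  define g' where "g' = (\<lambda>x. case x of LAtm a \<Rightarrow> atm a
    | LUnk Z T \<Rightarrow> if \<exists>X \<in> nvars t. x = trans_var sg as \<Delta> X then g x else LConst undefined)"
  let ?T = "ev (tval sg as \<Delta>) t"
  have g'X: "g' (trans_var sg as \<Delta> X) = g (trans_var sg as \<Delta> X)" if "X \<in> nvars t" for X
    using that by (auto simp: g'_def trans_var_def)
  have "sb LBound g (lams bs ?T) = sb LBound g' (lams bs ?T)"
  proof (rule sb_cong)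
    fix x assume "x \<in> fvs (lams bs ?T)"
    then have x: "x \<in> fvs ?T" by (auto dest: fvs_lamsD)
    show "g x = g' x"
    proof (cases x)
      case (LAtm a)
      then show ?thesis using x fvs_trans_atm[OF _ assms(2)] assms(3) by (simp add: g'_def)
    next
      case (LUnk Z T)
      then obtain X where "X \<in> nvars t" "x = trans_var sg as \<Delta> X" using x fvs_trans_unk by blast
      then show ?thesis using g'X by simp
    qed
  qed
  also have "\<dots> = lams bs (ev (\<lambda>X. sb LBound g' (tval sg as \<Delta> X)) t)"
  proof -
    have 1: "g' (LAtm a) = atm a" if "a \<in> set as" for a by (simp add: g'_def)
    have 2: "LAtm a \<notin> fvs (g' x)" if "x \<notin> LAtm ` set as" "a \<in> set as" for x a
      using that no_atoms by (cases x) (auto simp: g'_def)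
    show ?thesis using sb_lams[of "set as" g', OF 1 2 assms(1)] sb_ev[of "set as" g', OF 1 2 assms(2)]
      by simp
  qed
  also have "lconv \<dots> (lams bs (ev \<xi> t))"
    unfolding lconv_lams
  proof (rule ev_lconv)
    fix X assume X: "X \<in> nvars t"
    have "map (sb LBound g') (map atm (nonfresh as \<Delta> X)) = map atm (nonfresh as \<Delta> X)"
      by (simp add: g'_def)
    then show "lconv (sb LBound g' (tval sg as \<Delta> X)) (\<xi> X)"
      using conv[OF X] g'X[OF X] by (simp add: tval_def del: map_map)
  qed
  finally show ?thesis .
qed

lemma clean_sb_trans:
  assumes "natoms t \<subseteq> set as" "\<And>a b. LAtm b \<notin> fvs (d a)"
  shows "clean d (set as) (sb LBound g (lams as (ev (tval sg as \<Delta>) t))) =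
    lams as (ev (\<lambda>X. lapps (clean d (set as) (g (trans_var sg as \<Delta> X))) (map atm (nonfresh as \<Delta> X))) t)"
proof -
  define g' where "g' = (\<lambda>x. case x of LAtm a \<Rightarrow> atm a | LUnk Z T \<Rightarrow> clean d (set as) (g x))"
  let ?T = "ev (tval sg as \<Delta>) t"
  have "clean d (set as) (sb LBound g (lams as ?T)) = sb LBound (\<lambda>x. clean d (set as) (g x)) (lams as ?T)"
    by (simp add: clean_def sb_sb)
  also have "\<dots> = sb LBound g' (lams as ?T)"
  proof (rule sb_cong)
    fix x assume x: "x \<in> fvs (lams as ?T)"
    show "clean d (set as) (g x) = g' x"
    proof (cases x)
      case (LAtm a)
      with x show ?thesis using fvs_trans_atm[OF _ assms(1)] by (auto dest!: fvs_lamsD)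
    qed (simp add: g'_def)
  qed
  also have "\<dots> = lams as (ev (\<lambda>X. sb LBound g' (tval sg as \<Delta> X)) t)"
  proof -
    have 1: "g' (LAtm a) = atm a" if "a \<in> set as" for a by (simp add: g'_def)
    have 2: "LAtm a \<notin> fvs (g' x)" if "x \<notin> LAtm ` set as" "a \<in> set as" for x a
      using that assms(2) by (cases x) (auto simp: g'_def dest!: fvs_cleanD)
    show ?thesis using sb_lams[of "set as" g', OF 1 2 order.refl] sb_ev[of "set as" g', OF 1 2 assms(1)]
      by simp
  qed
  also have "(\<lambda>X. sb LBound g' (tval sg as \<Delta> X)) =
      (\<lambda>X. lapps (clean d (set as) (g (trans_var sg as \<Delta> X))) (map atm (nonfresh as \<Delta> X)))"
  proof
    fix X
    have "map (sb LBound g') (map atm (nonfresh as \<Delta> X)) = map atm (nonfresh as \<Delta> X)"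
      by (simp add: g'_def)
    moreover have "g' (trans_var sg as \<Delta> X) = clean d (set as) (g (trans_var sg as \<Delta> X))"
      by (simp add: g'_def trans_var_def)
    ultimately show "sb LBound g' (tval sg as \<Delta> X) =
        lapps (clean d (set as) (g (trans_var sg as \<Delta> X))) (map atm (nonfresh as \<Delta> X))"
      by (simp add: tval_def del: map_map)
  qed
  finally show ?thesis .
qed

lemma lconv_clean_cong: "lconv t u \<Longrightarrow> lconv (clean d A t) (clean d A u)"
  unfolding clean_def by (rule lconv_sb)

lemma clean_notin:
  assumes "fvs t \<inter> LAtm ` A = {}"
  shows "clean d A t = t"
proof -
  have "clean d A t = sb LBound LFree t"
    unfolding clean_def by (rule sb_cong) (use assms in \<open>auto split: lvar.split\<close>)
  then show ?thesis by simp
qed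

lemma lconv_trans_instD:
  assumes "natoms t \<subseteq> set as" "lconv (sb LBound g (lams as (ev (tval sg as \<Delta>) t))) (lams as M)"
  shows "lconv (ev (\<lambda>X. lapps (clean (\<lambda>_. LConst undefined) (set as) (g (trans_var sg as \<Delta> X)))
    (map atm (nonfresh as \<Delta> X))) t) M"
proof -
  let ?c = "clean (\<lambda>_. LConst undefined) (set as)"
  have "?c (lams as M) = lams as M" by (rule clean_notin) (auto dest: fvs_lamsD)
  then have "lconv (?c (sb LBound g (lams as (ev (tval sg as \<Delta>) t)))) (lams as M)"
    using lconv_clean_cong[OF assms(2), of "\<lambda>_. LConst undefined" "set as"] by simp
  then show ?thesis by (subst (asm) clean_sb_trans[OF assms(1)]) (simp_all add: lconv_lams)
qed

lemma nonfresh_empty [simp]: "nonfresh as {} X = as"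
  by (simp add: nonfresh_def)

definition unk_subst ::
  "('a, 'f, 's) nsig \<Rightarrow> 'a list \<Rightarrow> ('a, 's nvar) fenv \<Rightarrow> 's nvar set \<Rightarrow> ('s nvar \<Rightarrow> ('a, 'f, 's) lterm)
    \<Rightarrow> ('a, 'f, 's) lsubst" where
  "unk_subst sg as \<Delta> V F x = (case x of LAtm a \<Rightarrow> None
    | LUnk X T \<Rightarrow> if X \<in> V \<and> x = trans_var sg as \<Delta> X then Some (F X) else None)"

lemma llookup_unk_subst:
  "X \<in> V \<Longrightarrow> llookup (unk_subst sg as \<Delta> V F) (trans_var sg as \<Delta> X) = F X"
  "llookup (unk_subst sg as \<Delta> V F) (LAtm a) = atm a"
  by (simp_all add: llookup_def unk_subst_def trans_var_def)

lemma dom_unk_subst: "dom (unk_subst sg as \<Delta> V F) = trans_var sg as \<Delta> ` V"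
proof (intro set_eqI iffI)
  fix x assume "x \<in> dom (unk_subst sg as \<Delta> V F)"
  then show "x \<in> trans_var sg as \<Delta> ` V"
    by (cases x) (auto simp: unk_subst_def split: if_splits)
next
  fix x assume "x \<in> trans_var sg as \<Delta> ` V"
  then show "x \<in> dom (unk_subst sg as \<Delta> V F)"
    by (auto simp: unk_subst_def trans_var_def)
qed

lemma trans_subst_unk:
  "trans_subst sg as \<Delta> \<sigma> = unk_subst sg as {} (dom \<sigma>) (\<lambda>X. lams as (ev (tval sg as \<Delta>) (nlookup \<sigma> X)))"
proof
  fix x show "trans_subst sg as \<Delta> \<sigma> x =
      unk_subst sg as {} (dom \<sigma>) (\<lambda>X. lams as (ev (tval sg as \<Delta>) (nlookup \<sigma> X))) x"
    by (cases x) (auto simp: trans_subst_def unk_subst_def nlookup_def trans_term_ev split: option.split)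
qed

lemma llookup_trans_subst:
  "X \<in> dom \<sigma> \<Longrightarrow> llookup (trans_subst sg as \<Delta> \<sigma>) (trans_var sg as {} X) =
    lams as (ev (tval sg as \<Delta>) (nlookup \<sigma> X))"
  by (simp add: trans_subst_unk llookup_unk_subst del: domIff)

lemma dom_trans_subst: "dom (trans_subst sg as \<Delta> \<sigma>) = trans_var sg as {} ` dom \<sigma>"
  by (simp add: trans_subst_unk dom_unk_subst)

lemma lsubst_wfI:
  assumes "finite (dom \<theta>)" "\<And>x. x \<in> dom \<theta> \<Longrightarrow> has_type sg [] (llookup \<theta> x) (lvar_type sg x)"
  shows "lsubst_wf sg \<theta>"
  unfolding lsubst_wf_def using assms by (force simp: llookup_def)

lemma llookup_has_type: "lsubst_wf sg \<theta> \<Longrightarrow> has_type sg [] (llookup \<theta> x) (lvar_type sg x)"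
  unfolding lsubst_wf_def llookup_def by (auto split: option.split intro: has_type.intros)

lemma has_type_lams_trans_var:
  assumes "has_type sg [] t (LBase (nvar_sort X))"
  shows "has_type sg [] (lams (nonfresh as \<Delta> X) t) (lvar_type sg (trans_var sg as \<Delta> X))"
  using has_type_lams[OF assms, of "nonfresh as \<Delta> X"] by (simp add: trans_var_def)

lemma unk_subst_wf:
  assumes "finite V" "\<And>X. X \<in> V \<Longrightarrow> has_type sg [] (F X) (lvar_type sg (trans_var sg as \<Delta> X))"
  shows "lsubst_wf sg (unk_subst sg as \<Delta> V F)"
  by (rule lsubst_wfI) (use assms in \<open>auto simp: dom_unk_subst llookup_unk_subst\<close>)

lemma unk_subst_lams_wf:
  assumes "finite V" "\<And>X. X \<in> V \<Longrightarrow> has_type sg [] (F X) (LBase (nvar_sort X))"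
  shows "lsubst_wf sg (unk_subst sg as {} V (\<lambda>X. lams as (F X)))"
  by (rule unk_subst_wf[OF assms(1)]) (use has_type_lams_trans_var[OF assms(2), of _ as "{}"] in simp)

lemma nlookup_has_type:
  "nsubst_wf sg \<sigma> \<Longrightarrow> has_type sg [] (ev (tval sg as \<Delta>) (nlookup \<sigma> X)) (LBase (nvar_sort X))"
  using ev_has_type[OF nlookup_has_sort tval_has_type] by simp

lemma trans_subst_wf:
  assumes "nsubst_wf sg \<sigma>"
  shows "lsubst_wf sg (trans_subst sg as \<Delta> \<sigma>)"
  unfolding trans_subst_unk
  by (rule unk_subst_lams_wf) (use assms nlookup_has_type in \<open>simp_all add: nsubst_wf_def\<close>)

lemma lunifier_transI:
  assumes "lsubst_wf sg \<theta>" "problem_atoms P \<subseteq> set as"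
    and "\<And>a. llookup \<theta> (LAtm a) = atm a"
    and "\<And>X. X \<in> problem_vars P \<Longrightarrow> llookup \<theta> (trans_var sg as {} X) = lams as (\<xi> X)"
    and "\<And>t u. (t, u) \<in> P \<Longrightarrow> lconv (ev \<xi> t) (ev \<xi> u)"
  shows "lunifier sg (trans_problem sg as P) \<theta>"
proof -
  have conv: "lconv (lapply \<theta> (lams as (trans_term sg as {} t))) (lams as (ev \<xi> t))"
    if "natoms t \<subseteq> set as" "nvars t \<subseteq> problem_vars P" for t
    unfolding lapply_sb trans_term_ev
  proof (rule lconv_trans_inst)
    fix X assume "X \<in> nvars t"
    then have X: "llookup \<theta> (trans_var sg as {} X) = lams as (\<xi> X)" using assms(4) that by blast
    show "LAtm a \<notin> fvs (llookup \<theta> (trans_var sg as {} X))" if "a \<in> set as" for a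
      using that by (auto simp: X dest: fvs_lamsD)
    show "lconv (lapps (llookup \<theta> (trans_var sg as {} X)) (map atm (nonfresh as {} X))) (\<xi> X)"
      by (simp add: X lapps_lams)
  qed (use that assms(3) in auto)
  have "lconv (lapply \<theta> (lams as (trans_term sg as {} t))) (lapply \<theta> (lams as (trans_term sg as {} u)))"
    if tu: "(t, u) \<in> P" for t u
  proof -
    have "natoms t \<subseteq> set as" "natoms u \<subseteq> set as" "nvars t \<subseteq> problem_vars P" "nvars u \<subseteq> problem_vars P"
      using tu assms(2) by (fastforce simp: problem_atoms_def problem_vars_def)+
    with conv assms(5)[OF tu] show ?thesis by (meson lconv.sym lconv.trans lconv_lams)
  qed
  with assms(1) show ?thesis unfolding lunifier_def trans_problem_def by auto
qed

section \<open>Comparing the two notions of most general unifier\<close>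

locale nominal_solution =
  fixes sg :: "('a, 'f, 's) nsig"
    and as :: "'a list"
    and P :: "('a, 'f, 's nvar) nproblem"
    and \<Delta> :: "('a, 's nvar) fenv"
    and \<sigma> :: "('a, 'f, 's nvar) nsubst"
  assumes P_wf: "nproblem_wf sg P"
    and sol: "nsolution sg P \<Delta> \<sigma>"
    and P_vars: "problem_vars P \<subseteq> dom \<sigma>"
    and \<Delta>_vars: "snd ` \<Delta> \<subseteq> (\<Union>t \<in> ran \<sigma>. nvars t)"
    and as_distinct: "distinct as"
    and P_atoms: "problem_atoms P \<subseteq> set as"
    and \<Delta>_atoms: "fst ` \<Delta> \<subseteq> set as"
    and \<sigma>_atoms: "(\<Union>t \<in> ran \<sigma>. natoms t) \<subseteq> set as"
begin

abbreviation tv :: "'s nvar \<Rightarrow> ('a, 'f, 's) lterm" where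
  "tv \<equiv> tval sg as \<Delta>"

definition RV :: "'s nvar set" where
  "RV = (\<Union>X \<in> dom \<sigma>. nvars (nlookup \<sigma> X))"

lemma RV_ran: "RV = (\<Union>t \<in> ran \<sigma>. nvars t)"
  by (auto simp: RV_def ran_def nlookup_def dom_def split: option.splits)

lemma wf_\<sigma>: "nsubst_wf sg \<sigma>" and finite_\<Delta>: "finite \<Delta>"
  using sol by (simp_all add: nsolution_def)

lemma finite_dom: "finite (dom \<sigma>)"
  using wf_\<sigma> by (simp add: nsubst_wf_def)

lemma finite_RV: "finite RV"
  by (simp add: RV_def finite_dom)

lemma nlookup_natoms: "natoms (nlookup \<sigma> X) \<subseteq> set as"
proof (cases "\<sigma> X")
  case (Some t)
  then have "t \<in> ran \<sigma>" by (auto simp: ran_def)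
  then show ?thesis using \<sigma>_atoms Some by (auto simp: nlookup_def)
qed (simp add: nlookup_def)

lemmas nlookup_sort = nlookup_has_sort[OF wf_\<sigma>]

lemma P_term:
  assumes "(t, u) \<in> P"
  shows "nvars t \<subseteq> dom \<sigma>" "nvars u \<subseteq> dom \<sigma>" "natoms t \<subseteq> set as" "natoms u \<subseteq> set as"
    "\<exists>\<tau>. has_sort sg t \<tau> \<and> has_sort sg u \<tau>" "neq \<Delta> (napply \<sigma> t) (napply \<sigma> u)"
proof -
  have "nvars t \<union> nvars u \<subseteq> problem_vars P" "natoms t \<union> natoms u \<subseteq> problem_atoms P"
    using assms unfolding problem_vars_def problem_atoms_def by blast+
  then show "nvars t \<subseteq> dom \<sigma>" "nvars u \<subseteq> dom \<sigma>" "natoms t \<subseteq> set as" "natoms u \<subseteq> set as"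
    using P_vars P_atoms by blast+
  show "\<exists>\<tau>. has_sort sg t \<tau> \<and> has_sort sg u \<tau>" "neq \<Delta> (napply \<sigma> t) (napply \<sigma> u)"
    using assms P_wf sol unfolding nproblem_wf_def nsolution_def by blast+
qed

lemma P_ev: 
  assumes "(t, u) \<in> P" "sat \<xi> \<Delta>"
  shows "lconv (ev (\<lambda>X. ev \<xi> (nlookup \<sigma> X)) t) (ev (\<lambda>X. ev \<xi> (nlookup \<sigma> X)) u)"
  using neq_sound[OF assms(2) P_term(6)[OF assms(1)]] by (simp add: ev_napply)

lemma ex_fresh_nvar:
  assumes "finite (S :: 's nvar set)"
  shows "\<exists>X. X \<notin> S \<and> nvar_sort X = s"
proof -
  have "infinite (range (\<lambda>n. NVar n s))" by (subst finite_image_iff) (simp_all add: inj_def)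
  then have "\<not> range (\<lambda>n. NVar n s) \<subseteq> S" using assms finite_subset by blast
  then obtain n where "NVar n s \<notin> S" by blast
  then show ?thesis by (intro exI[of _ "NVar n s"]) simp
qed

end

text \<open>
  If a variable \<open>W\<close> of the range is not in the domain, then renaming it to \<open>W'\<close> and adding
  \<open>W\<close> to the domain gives a strictly more general solution, on both sides.
\<close>

locale escaping_variable = nominal_solution +
  fixes W W' :: "'c nvar"
  assumes W: "W \<in> RV" "W \<notin> dom \<sigma>"
    and W': "W' \<notin> RV" "W' \<notin> dom \<sigma>" "W' \<noteq> W" "nvar_sort W' = nvar_sort W"
begin

definition \<rho> :: "('a, 'b, 'c nvar) nsubst" where
  "\<rho> = [W \<mapsto> NSus [] W']"

definition \<rho>' :: "('a, 'b, 'c nvar) nsubst" where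
  "\<rho>' = [W' \<mapsto> NSus [] W]"

definition \<Delta>1 :: "('a, 'c nvar) fenv" where
  "\<Delta>1 = \<Delta> \<union> {(a, W') | a. (a, W) \<in> \<Delta>}"

definition renamed :: "'c nvar \<Rightarrow> ('a, 'b, 'c nvar) nterm" where
  "renamed X = napply \<rho> (nlookup \<sigma> X)"

abbreviation tv1 :: "'c nvar \<Rightarrow> ('a, 'b, 'c) lterm" where
  "tv1 \<equiv> tval sg as \<Delta>1"

lemma nlookup_\<rho>: "nlookup \<rho> X = (if X = W then NSus [] W' else NSus [] X)"
  by (simp add: \<rho>_def nlookup_def)

lemma nlookup_\<rho>': "nlookup \<rho>' X = (if X = W' then NSus [] W else NSus [] X)"
  by (simp add: \<rho>'_def nlookup_def)

lemma W'_\<Delta>: "(a, W') \<notin> \<Delta>"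
  using W'(1) \<Delta>_vars RV_ran by force

lemma finite_\<Delta>1: "finite \<Delta>1"
proof -
  have "{(a, W') | a. (a, W) \<in> \<Delta>} \<subseteq> (\<lambda>p. (fst p, W')) ` \<Delta>" by force
  then show ?thesis unfolding \<Delta>1_def using finite_\<Delta> finite_subset by blast
qed

lemma sat_\<rho>: "sat (\<lambda>X. ev tv1 (nlookup \<rho> X)) \<Delta>"
proof -
  have "sat tv1 \<Delta>1" by (rule tval_sat)
  then show ?thesis by (auto simp: sat_def nlookup_\<rho> \<Delta>1_def ren_id)
qed

lemma napply_\<rho>'_\<rho>: "W' \<notin> nvars t \<Longrightarrow> napply \<rho>' (napply \<rho> t) = t"
  by (induction t) (simp_all add: nlookup_\<rho> nlookup_\<rho>' map_idI)

lemma W_renamed: "W \<notin> nvars (renamed X)"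
  using W'(3) by (auto simp: renamed_def nvars_napply nlookup_\<rho> split: if_splits)

lemma renamed_natoms: "natoms (renamed X) \<subseteq> set as"
  using natoms_napply[of \<rho> "nlookup \<sigma> X"] nlookup_natoms[of X]
  by (auto simp: renamed_def nlookup_\<rho> split: if_splits)

lemma renamed_sort: "has_sort sg (renamed X) (BaseSort (nvar_sort X))"
  unfolding renamed_def
proof (rule has_sort_napply[OF _ nlookup_sort])
  fix Y show "has_sort sg (nlookup \<rho> Y) (BaseSort (nvar_sort Y))"
    using has_sort_var[of sg W'] has_sort_var[of sg Y]
    by (simp add: nlookup_\<rho> W'(4))
qed

lemma renamed_back: "X \<in> dom \<sigma> \<Longrightarrow> napply \<rho>' (renamed X) = nlookup \<sigma> X"
  unfolding renamed_def by (rule napply_\<rho>'_\<rho>) (use W'(1) in \<open>auto simp: RV_def\<close>)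

lemma P_renamed:
  assumes "(t, u) \<in> P"
  shows "lconv (ev (\<lambda>X. ev tv1 (renamed X)) t) (ev (\<lambda>X. ev tv1 (renamed X)) u)"
  using P_ev[OF assms sat_\<rho>] by (simp add: renamed_def ev_napply)

lemma not_nmost_general: "\<not> nmost_general sg P \<Delta> \<sigma>"
proof
  assume mg: "nmost_general sg P \<Delta> \<sigma>"
  define \<sigma>1 where "\<sigma>1 X = (if X \<in> dom \<sigma> then Some (renamed X) else if X = W then Some (NSus [] W) else None)" for X
  have dom1: "dom \<sigma>1 = insert W (dom \<sigma>)" by (auto simp: \<sigma>1_def split: if_splits)
  have l1: "nlookup \<sigma>1 X = renamed X" if "X \<in> dom \<sigma>" for X using that by (simp add: nlookup_def \<sigma>1_def)
  have lW: "nlookup \<sigma>1 W = NSus [] W" using W by (simp add: nlookup_def \<sigma>1_def)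
  have wf1: "nsubst_wf sg \<sigma>1"
    unfolding nsubst_wf_def
  proof (intro conjI allI impI)
    show "finite (dom \<sigma>1)" by (simp add: dom1 finite_dom)
    fix X t assume "\<sigma>1 X = Some t"
    then show "has_sort sg t (BaseSort (nvar_sort X))"
      using renamed_sort[of X] has_sort_var[of sg W] by (auto simp: \<sigma>1_def split: if_splits)
  qed
  have "nsolution sg P \<Delta>1 \<sigma>1"
    unfolding nsolution_def
  proof (intro conjI finite_\<Delta>1 wf1, clarify)
    fix t u assume tu: "(t, u) \<in> P"
    obtain \<tau> where \<tau>: "has_sort sg t \<tau>" "has_sort sg u \<tau>" using P_term(5)[OF tu] by blast
    have at: "natoms (napply \<sigma>1 s) \<subseteq> set as" and e: "ev tv1 (napply \<sigma>1 s) = ev (\<lambda>X. ev tv1 (renamed X)) s"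
      if "nvars s \<subseteq> dom \<sigma>" "natoms s \<subseteq> set as" for s
    proof -
      show "natoms (napply \<sigma>1 s) \<subseteq> set as"
      proof -
        have "natoms (nlookup \<sigma>1 Y) \<subseteq> set as" if "Y \<in> nvars s" for Y
        proof -
          have "Y \<in> dom \<sigma>" using that \<open>nvars s \<subseteq> dom \<sigma>\<close> by blast
          then show ?thesis using l1[of Y] renamed_natoms[of Y] by simp
        qed
        then show ?thesis using natoms_napply[of \<sigma>1 s] \<open>natoms s \<subseteq> set as\<close> by blast
      qed
      show "ev tv1 (napply \<sigma>1 s) = ev (\<lambda>X. ev tv1 (renamed X)) s"
        unfolding ev_napply by (rule ev_cong, rule arg_cong[of _ _ "ev tv1"], rule l1) (use that in blast)
    qed
    show "neq \<Delta>1 (napply \<sigma>1 t) (napply \<sigma>1 u)"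
      using P_renamed[OF tu] at e P_term(1-4)[OF tu]
        has_sort_napply[OF nlookup_has_sort[OF wf1] \<tau>(1)] has_sort_napply[OF nlookup_has_sort[OF wf1] \<tau>(2)]
      by (intro neq_complete[where as = as]) auto
  qed
  moreover have "nmore_general sg \<Delta>1 \<sigma>1 \<Delta> \<sigma>"
    unfolding nmore_general_iff
  proof (intro exI[of _ \<rho>'] conjI ballI)
    show "nsubst_wf sg \<rho>'"
      using has_sort_var[of sg W] by (auto simp: nsubst_wf_def \<rho>'_def W'(4))
    show "fenv_entails \<Delta> \<rho>' \<Delta>1"
      using W'_\<Delta> by (auto simp: fenv_entails_def \<Delta>1_def nlookup_\<rho>' intro!: fresh.intros)
    fix X assume X: "X \<in> dom \<sigma>1 \<union> dom \<sigma>"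
    have "napply \<rho>' (nlookup \<sigma>1 X) = nlookup \<sigma> X"
    proof (cases "X \<in> dom \<sigma>")
      case False
      with X have "X = W" by (auto simp: dom1)
      moreover have "nlookup \<sigma> W = NSus [] W" using W(2) by (auto simp: nlookup_def split: option.split)
      ultimately show ?thesis using W'(3) by (simp add: lW nlookup_\<rho>')
    qed (simp add: l1 renamed_back)
    then show "neq \<Delta> (napply \<rho>' (nlookup \<sigma>1 X)) (nlookup \<sigma> X)" by (simp add: neq_refl)
  qed
  ultimately have "nmore_general sg \<Delta> \<sigma> \<Delta>1 \<sigma>1" using mg by (simp add: nmost_general_def)
  then obtain \<sigma>' where \<sigma>': "\<And>X. X \<in> dom \<sigma> \<union> dom \<sigma>1 \<Longrightarrow> neq \<Delta>1 (napply \<sigma>' (nlookup \<sigma> X)) (nlookup \<sigma>1 X)"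
    unfolding nmore_general_iff by blast
  have "nlookup \<sigma> W = NSus [] W" using W(2) by (auto simp: nlookup_def split: option.split)
  then have "nvars (nlookup \<sigma>' W) = {W}"
    using neq_nvars[OF \<sigma>'[of W]] by (simp add: lW dom1)
  moreover obtain X where X: "X \<in> dom \<sigma>" "W \<in> nvars (nlookup \<sigma> X)" using W(1) by (auto simp: RV_def)
  then have "nvars (nlookup \<sigma>' W) \<subseteq> nvars (renamed X)"
    using neq_nvars[OF \<sigma>'[of X]] by (auto simp: l1 nvars_napply)
  ultimately show False using W_renamed by blast
qed

lemma not_lmost_general: "\<not> lmost_general sg (trans_problem sg as P) (trans_subst sg as \<Delta> \<sigma>)"
proof
  let ?\<sigma> = "trans_subst sg as \<Delta> \<sigma>"
  let ?W = "trans_var sg as \<Delta> W"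
  assume mg: "lmost_general sg (trans_problem sg as P) ?\<sigma>"
  let ?F = "\<lambda>X. lams as (ev tv1 (renamed X))"
  define \<theta>1 where "\<theta>1 = (unk_subst sg as {} (dom \<sigma>) ?F)(?W \<mapsto> LFree ?W)"
  have X_W: "trans_var sg as {} X \<noteq> ?W" if "X \<in> dom \<sigma>" for X
    using that W(2) trans_var_inject by metis
  have dom1: "dom \<theta>1 = insert ?W (trans_var sg as {} ` dom \<sigma>)"
    by (simp add: \<theta>1_def dom_unk_subst)
  have l1: "llookup \<theta>1 (trans_var sg as {} X) = ?F X" if "X \<in> dom \<sigma>" for X
    using llookup_unk_subst(1)[OF that, of sg as "{}" ?F] X_W[OF that] by (simp add: llookup_def \<theta>1_def)
  have lW: "llookup \<theta>1 ?W = LFree ?W" by (simp add: llookup_def \<theta>1_def)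
  have \<sigma>W: "llookup ?\<sigma> ?W = LFree ?W"
    using X_W by (auto simp: llookup_def split: option.split) (metis dom_trans_subst domI imageE)
  have wf1: "lsubst_wf sg \<theta>1"
  proof -
    have "lsubst_wf sg (unk_subst sg as {} (dom \<sigma>) ?F)"
      by (rule unk_subst_lams_wf[OF finite_dom]) (use ev_has_type[OF renamed_sort tval_has_type] in simp)
    then show ?thesis by (auto simp: lsubst_wf_def \<theta>1_def has_type.intros)
  qed
  have "lunifier sg (trans_problem sg as P) \<theta>1"
  proof (rule lunifier_transI[OF wf1 P_atoms, where \<xi> = "\<lambda>X. ev tv1 (renamed X)"])
    show "llookup \<theta>1 (LAtm a) = atm a" for a by (simp add: llookup_def \<theta>1_def unk_subst_def)
    show "llookup \<theta>1 (trans_var sg as {} X) = lams as (ev tv1 (renamed X))" if "X \<in> problem_vars P" for X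
      using l1 that P_vars by blast
  qed (rule P_renamed)
  moreover have "compatible_names (dom ?\<sigma>) (dom \<theta>1)"
    using W(2) by (auto simp: compatible_names_def dom_trans_subst dom1 trans_var_def)
  moreover have "lmore_general sg \<theta>1 ?\<sigma>"
  proof -
    define \<theta> :: "('a, 'b, 'c) lsubst" where "\<theta> = [trans_var sg as \<Delta>1 W' \<mapsto> LFree ?W]"
    have nf1: "nonfresh as \<Delta>1 W' = nonfresh as \<Delta> W"
      using W'_\<Delta> by (auto simp: nonfresh_def \<Delta>1_def intro!: filter_cong)
    have ne: "trans_var sg as \<Delta>1 W' \<noteq> ?W" using W'(3) trans_var_inject by metis
    have "lsubst_wf sg \<theta>"
      using has_type.intros(2)[of sg "[]" ?W] nf1 W'(4)
      by (auto simp: lsubst_wf_def \<theta>_def trans_var_def)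
    moreover have "lconv (lapply \<theta> (llookup \<theta>1 x)) (llookup ?\<sigma> x)" if "x \<in> dom \<theta>1 \<union> dom ?\<sigma>" for x
    proof -
      from that consider "x = ?W" | X where "X \<in> dom \<sigma>" "x = trans_var sg as {} X"
        by (auto simp: dom1 dom_trans_subst)
      then show ?thesis
      proof cases
        case 1
        then show ?thesis using ne \<sigma>W by (simp add: lW lapply_sb) (simp add: llookup_def \<theta>_def lconv.refl)
      next
        case (2 X)
        have "lconv (sb LBound (llookup \<theta>) (lams as (ev tv1 (renamed X)))) (lams as (ev tv (napply \<rho>' (renamed X))))"
          unfolding ev_napply
        proof (rule lconv_trans_inst)
          fix Y assume "Y \<in> nvars (renamed X)"
          then have Y: "Y \<noteq> W" using W_renamed by blast
          have g: "llookup \<theta> (trans_var sg as \<Delta>1 Y) =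
            (if Y = W' then LFree ?W else LFree (trans_var sg as \<Delta>1 Y))"
            using trans_var_inject[of sg as \<Delta>1 Y \<Delta>1 W'] by (auto simp: llookup_def \<theta>_def)
          then show "LAtm a \<notin> fvs (llookup \<theta> (trans_var sg as \<Delta>1 Y))" for a by simp
          show "lconv (lapps (llookup \<theta> (trans_var sg as \<Delta>1 Y)) (map atm (nonfresh as \<Delta>1 Y)))
            (ev tv (nlookup \<rho>' Y))"
          proof (cases "Y = W'")
            case True
            then have "ev tv (nlookup \<rho>' Y) = tv W" by (simp add: nlookup_\<rho>')
            then show ?thesis using g nf1 True by (simp add: tval_def lconv.refl)
          next
            case False
            then have "nonfresh as \<Delta>1 Y = nonfresh as \<Delta> Y" by (simp add: nonfresh_def \<Delta>1_def)
            moreover have "ev tv (nlookup \<rho>' Y) = tv Y" using False by (simp add: nlookup_\<rho>')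
            ultimately show ?thesis using g False by (simp add: tval_def trans_var_def lconv.refl)
          qed
        qed (use renamed_natoms in \<open>auto simp: llookup_def \<theta>_def\<close>)
        then show ?thesis using 2 by (simp add: lapply_sb l1 llookup_trans_subst renamed_back)
      qed
    qed
    ultimately show ?thesis unfolding lmore_general_def by blast
  qed
  ultimately have "lmore_general sg ?\<sigma> \<theta>1" using mg by (simp add: lmost_general_def)
  then obtain \<theta> where \<theta>: "\<And>x. x \<in> dom ?\<sigma> \<union> dom \<theta>1 \<Longrightarrow> lconv (lapply \<theta> (llookup ?\<sigma> x)) (llookup \<theta>1 x)"
    unfolding lmore_general_def by blast
  let ?c = "clean (\<lambda>_. LConst undefined) (set as) :: ('a, 'b, 'c) lterm \<Rightarrow> _"
  let ?\<phi> = "\<lambda>X. lapps (?c (llookup \<theta> (trans_var sg as \<Delta> X))) (map atm (nonfresh as \<Delta> X))"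
  obtain X where X: "X \<in> dom \<sigma>" "W \<in> nvars (nlookup \<sigma> X)" using W(1) by (auto simp: RV_def)
  have "lconv (sb LBound (llookup \<theta>) (lams as (ev tv (nlookup \<sigma> X)))) (lams as (ev tv1 (renamed X)))"
    using \<theta>[of "trans_var sg as {} X"] X(1) by (simp add: dom1 lapply_sb l1 llookup_trans_subst)
  then have "lconv (ev ?\<phi> (nlookup \<sigma> X)) (ev tv1 (renamed X))"
    by (rule lconv_trans_instD[OF nlookup_natoms])
  moreover have "skel (renamed X) (nlookup \<sigma> X)"
    by (rule neq_skel[of "{}" \<rho>']) (simp add: renamed_back[OF X(1)] neq_refl)
  ultimately obtain v where v: "has_sort sg v (BaseSort (nvar_sort W))" "lconv (?\<phi> W) (ev tv1 v)"
    "nvars v \<subseteq> nvars (renamed X)"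
    using lconv_ev_extract[OF _ nlookup_sort renamed_sort _ X(2)] by blast
  have "lconv (llookup \<theta> ?W) (LFree ?W)"
    using \<theta>[of ?W] lW \<sigma>W by (simp add: dom1 lapply_sb)
  then have "lconv (?c (llookup \<theta> ?W)) (?c (LFree ?W))" by (rule lconv_clean_cong)
  moreover have "?c (LFree ?W) = LFree ?W" by (rule clean_notin) auto
  ultimately have "lconv (?\<phi> W) (tv W)"
    unfolding tval_def by (intro lconv_lapps) (simp_all add: list_all2_refl lconv.refl)
  then have conv: "lconv (tv W) (ev tv1 v)" using v(2) by (meson lconv.sym lconv.trans)
  show False
  proof (cases v)
    case (NFun f ts)
    then show False using lconv_lapps_headD(1)[OF _ _ conv[unfolded tval_def[of sg as \<Delta>] NFun ev.simps]] by simp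
  next
    case (NAtm a)
    then show False using lconv_lapps_headD(1)[of "LFree ?W" "atm a" _ "[]"] conv by (simp add: tval_def)
  next
    case (NAbs a t)
    then show False using v(1) by (auto elim: has_sort_NAbsE)
  next
    case (NSus \<pi> Z)
    have "?W = trans_var sg as \<Delta>1 Z"
      using lconv_lapps_headD(1)[OF _ _ conv[unfolded tval_def[of sg as \<Delta>] NSus ev.simps ren_tval]] by simp
    then have "Z = W" using trans_var_inject by metis
    then show False using v(3) W_renamed NSus by auto
  qed
qed

end

lemma (in nominal_solution) ex_renaming:
  assumes "\<not> RV \<subseteq> dom \<sigma>"
  shows "\<exists>W W'. escaping_variable sg as P \<Delta> \<sigma> W W'"
proof -
  obtain W where W: "W \<in> RV" "W \<notin> dom \<sigma>" using assms by blast
  obtain W' where W': "W' \<notin> insert W (RV \<union> dom \<sigma>)" "nvar_sort W' = nvar_sort W"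
    using ex_fresh_nvar[of "insert W (RV \<union> dom \<sigma>)"] finite_RV finite_dom by blast
  have "escaping_variable sg as P \<Delta> \<sigma> W W'"
    using nominal_solution_axioms W W' by (auto simp: escaping_variable_def escaping_variable_axioms_def)
  then show ?thesis by blast
qed

text \<open>
  \<open>M\<close> values the variables by a lambda-unifier (see \<open>nmost_general_imp_lmost_general\<close>),
  \<open>B\<close> by the nominal solution. The set \<open>V\<close> of least cardinality is the one in the introduction.
\<close>

locale lambda_unifier = nominal_solution +
  fixes M :: "'c nvar \<Rightarrow> ('a, 'b, 'c) lterm"
  assumes M_type: "has_type sg [] (M X) (LBase (nvar_sort X))"
    and M_unif: "(t, u) \<in> P \<Longrightarrow> lconv (ev M t) (ev M u)"
begin

definition B :: "'c nvar \<Rightarrow> ('a, 'b, 'c) lterm" where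
  "B X = ev tv (nlookup \<sigma> X)"

lemma B_type: "has_type sg [] (B X) (LBase (nvar_sort X))"
  using ev_has_type[OF nlookup_sort tval_has_type] by (simp add: B_def)

lemma ev_B: "ev B t = ev tv (napply \<sigma> t)"
  unfolding ev_napply by (rule ev_cong) (simp add: B_def)

lemma B_unif: "(t, u) \<in> P \<Longrightarrow> lconv (ev B t) (ev B u)"
  using P_ev[OF _ tval_sat] unfolding B_def[abs_def] by blast

lemma napply_natoms: "natoms t \<subseteq> set as \<Longrightarrow> natoms (napply \<sigma> t) \<subseteq> set as"
  using natoms_napply[of \<sigma> t] nlookup_natoms by blast

lemma B_neq:
  assumes "lconv (ev B t) (ev B u)" "has_sort sg t \<tau>" "has_sort sg u \<tau>"
    and "natoms t \<subseteq> set as" "natoms u \<subseteq> set as"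
  shows "neq \<Delta> (napply \<sigma> t) (napply \<sigma> u)"
  by (rule neq_complete[where as = as])
    (use assms has_sort_napply[OF nlookup_sort] napply_natoms in \<open>auto simp: ev_B\<close>)

definition represents :: "'c nvar set \<Rightarrow> 'c nvar \<Rightarrow> ('a, 'b, 'c nvar) nterm \<Rightarrow> bool" where
  "represents V X s \<longleftrightarrow> has_sort sg s (BaseSort (nvar_sort X)) \<and> nvars s \<subseteq> V \<and> natoms s \<subseteq> set as \<and>
    lconv (M X) (ev M s) \<and> lconv (B X) (ev B s)"

definition generates :: "'c nvar set \<Rightarrow> bool" where
  "generates V \<longleftrightarrow> V \<subseteq> dom \<sigma> \<and> (\<forall>X \<in> dom \<sigma>. \<exists>s. represents V X s)"

lemma generates_dom: "generates (dom \<sigma>)"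
  unfolding generates_def represents_def
proof (intro conjI ballI)
  fix X assume "X \<in> dom \<sigma>"
  then show "\<exists>s. has_sort sg s (BaseSort (nvar_sort X)) \<and> nvars s \<subseteq> dom \<sigma> \<and> natoms s \<subseteq> set as \<and>
      lconv (M X) (ev M s) \<and> lconv (B X) (ev B s)"
    using has_sort_var[of sg X]
    by (intro exI[of _ "NSus [] X"]) (simp add: ren_id lconv.refl)
qed simp

lemma generates_remove:
  assumes "generates V" "Z \<in> V" "represents V Z v" "Z \<notin> nvars v"
  shows "generates (V - {Z})"
  unfolding generates_def
proof (intro conjI ballI)
  show "V - {Z} \<subseteq> dom \<sigma>" using assms(1) by (auto simp: generates_def)
  fix X assume "X \<in> dom \<sigma>"
  then obtain s where s: "represents V X s" using assms(1) by (auto simp: generates_def)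
  have l: "nlookup [Z \<mapsto> v] Y = (if Y = Z then v else NSus [] Y)" for Y
    by (simp add: nlookup_def)
  have ev: "lconv (ev \<xi> s) (ev \<xi> (napply [Z \<mapsto> v] s))" if "lconv (\<xi> Z) (ev \<xi> v)"
    for \<xi> :: "'c nvar \<Rightarrow> ('a, 'b, 'c) lterm"
    unfolding ev_napply by (rule ev_lconv) (use that in \<open>auto simp: l ren_id lconv.refl\<close>)
  have "represents (V - {Z}) X (napply [Z \<mapsto> v] s)"
    unfolding represents_def
  proof (intro conjI)
    show "has_sort sg (napply [Z \<mapsto> v] s) (BaseSort (nvar_sort X))"
    proof (rule has_sort_napply)
      fix Y show "has_sort sg (nlookup [Z \<mapsto> v] Y) (BaseSort (nvar_sort Y))"
        using assms(3) has_sort_var[of sg Y] by (auto simp: l represents_def)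
    qed (use s in \<open>simp add: represents_def\<close>)
    show "nvars (napply [Z \<mapsto> v] s) \<subseteq> V - {Z}"
      using s assms(3,4) by (auto simp: nvars_napply l represents_def split: if_splits)
    show "natoms (napply [Z \<mapsto> v] s) \<subseteq> set as"
    proof -
      have "natoms (nlookup [Z \<mapsto> v] Y) \<subseteq> set as" for Y
        using assms(3) by (simp add: l represents_def)
      then show ?thesis using natoms_napply[of "[Z \<mapsto> v]" s] s unfolding represents_def by blast
    qed
    show "lconv (M X) (ev M (napply [Z \<mapsto> v] s))" "lconv (B X) (ev B (napply [Z \<mapsto> v] s))"
      using s assms(3) ev[of M] ev[of B] unfolding represents_def by (meson lconv.trans)+
  qed
  then show "\<exists>s. represents (V - {Z}) X s" by blast
qed

definition env :: "'c nvar set \<Rightarrow> ('a, 'c nvar) fenv" where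
  "env V = {(a, Z). a \<in> set as \<and> Z \<in> V \<and> afresh a (M Z) \<and> afresh a (B Z)}"

lemma env_fresh:
  "afresh a (ev M t) \<Longrightarrow> afresh a (ev B t) \<Longrightarrow> a \<in> set as \<Longrightarrow> nvars t \<subseteq> V \<Longrightarrow> natoms t \<subseteq> set as
    \<Longrightarrow> fresh (env V) a t"
proof (induction t)
  case (NFun f ts)
  have "fresh (env V) a t" if t: "t \<in> set ts" for t
  proof (rule NFun.IH[OF t])
    show "afresh a (ev M t)" "afresh a (ev B t)"
      using afresh_lapps_args[of a "LConst f" "map (ev M) ts" "ev M t"]
        afresh_lapps_args[of a "LConst f" "map (ev B) ts" "ev B t"] NFun.prems(1,2) t by simp_all
  qed (use NFun.prems t in auto)
  then show ?case by (auto intro: fresh.intros)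
next
  case (NAtm b)
  then show ?case by (auto simp: afresh_atom_iff intro: fresh.intros)
next
  case (NAbs b t)
  then show ?case by (cases "a = b") (auto simp: afresh_lam_iff intro: fresh.intros)
next
  case (NSus \<pi> X)
  then show ?case using perm_atom_in[of a "set as" "rev \<pi>"]
    by (auto simp: afresh_ren_iff env_def intro!: fresh.intros)
qed

context
  fixes V :: "'c nvar set"
  assumes V: "generates V" and V_min: "\<And>V'. generates V' \<Longrightarrow> card V \<le> card V'"
begin

lemma V_fin: "finite V"
  using V finite_dom finite_subset by (auto simp: generates_def)

lemma free_generator:
  assumes "Z \<in> V" "represents V Z v"
  shows "\<exists>\<pi>. v = NSus \<pi> Z \<and> (\<forall>a. perm_atom \<pi> a \<noteq> a \<longrightarrow> (a, Z) \<in> env V)"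
proof -
  note v = assms(2)[unfolded represents_def]
  have Zv: "Z \<in> nvars v"
  proof (rule ccontr)
    assume "Z \<notin> nvars v"
    then have "card V \<le> card (V - {Z})" by (intro V_min generates_remove[OF V assms])
    moreover have "card (V - {Z}) < card V" using card_Diff1_less[OF V_fin assms(1)] .
    ultimately show False by simp
  qed
  have "neq \<Delta> (napply \<sigma> (NSus [] Z)) (napply \<sigma> v)"
    by (rule B_neq[of _ _ "BaseSort (nvar_sort Z)"])
      (use v has_sort_var[of sg Z] in \<open>auto simp: ren_id\<close>)
  then have "nsize (nlookup \<sigma> Z) = nsize (napply \<sigma> v)" using neq_nsize by fastforce
  then obtain \<pi> where \<pi>: "v = NSus \<pi> Z" using nsize_napply_gt[OF Zv, of \<sigma>] by auto
  have "(a, Z) \<in> env V" if a: "perm_atom \<pi> a \<noteq> a" for a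
  proof -
    have "a \<in> set as" using a v \<pi> perm_atom_fixed[of a \<pi>] by auto
    moreover have "afresh a (\<xi> Z)"
      if "lconv (\<xi> Z) (ev \<xi> v)" "has_type sg [] (\<xi> Z) T" for \<xi> :: "'c nvar \<Rightarrow> ('a, 'b, 'c) lterm" and T
      using lconv_ren_eqD[of "\<xi> Z" "\<lambda>a. a" "perm_atom \<pi>" a] has_type_wn[OF that(2)] that(1) a \<pi>
      by (simp add: ren_id)
    ultimately show ?thesis using v M_type[of Z] B_type[of Z] assms(1) by (auto simp: env_def)
  qed
  with \<pi> show ?thesis by blast
qed

lemma free_suspension:
  assumes "has_sort sg (NSus \<pi> Z) \<tau>" "has_sort sg u \<tau>" "Z \<in> V" "nvars u \<subseteq> V"
    and "patoms \<pi> \<subseteq> set as" "natoms u \<subseteq> set as"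
    and "lconv (ren (perm_atom \<pi>) (M Z)) (ev M u)" "lconv (ren (perm_atom \<pi>) (B Z)) (ev B u)"
  shows "\<exists>\<pi>'. u = NSus \<pi>' Z \<and> (\<forall>a. perm_atom \<pi> a \<noteq> perm_atom \<pi>' a \<longrightarrow> (a, Z) \<in> env V)"
proof -
  let ?v = "perm_term (rev \<pi>) u"
  have conv: "lconv (\<xi> Z) (ev \<xi> ?v)" if "lconv (ren (perm_atom \<pi>) (\<xi> Z)) (ev \<xi> u)"
    for \<xi> :: "'c nvar \<Rightarrow> ('a, 'b, 'c) lterm"
    using lconv_ren[OF that, of "perm_atom (rev \<pi>)"] by (simp add: ev_perm)
  have "represents V Z ?v"
    unfolding represents_def
  proof (intro conjI)
    show "has_sort sg ?v (BaseSort (nvar_sort Z))"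
      by (rule has_sort_perm) (use assms(1,2) in \<open>auto elim!: has_sort_NSusE\<close>)
    show "natoms ?v \<subseteq> set as" using natoms_perm[of "rev \<pi>" u] assms(5,6) by auto
  qed (use assms conv in auto)
  from free_generator[OF assms(3) this] obtain \<rho> where
    \<rho>: "?v = NSus \<rho> Z" "\<And>a. perm_atom \<rho> a \<noteq> a \<Longrightarrow> (a, Z) \<in> env V" by blast
  from \<rho>(1) obtain \<pi>' where u: "u = NSus \<pi>' Z" and r: "\<rho> = rev \<pi> @ \<pi>'" by (cases u) auto
  have "perm_atom \<rho> a \<noteq> a" if "perm_atom \<pi> a \<noteq> perm_atom \<pi>' a" for a
    using that by (metis r perm_atom_append perm_atom_rev')
  with \<rho>(2) u show ?thesis by blast
qed

lemma neq_free:
  assumes "has_sort sg t \<tau>" "has_sort sg u \<tau>" "nvars t \<subseteq> V" "nvars u \<subseteq> V"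
    and "natoms t \<subseteq> set as" "natoms u \<subseteq> set as"
    and "lconv (ev M t) (ev M u)" "lconv (ev B t) (ev B u)"
  shows "neq (env V) t u"
  using assms
proof (induction t arbitrary: u \<tau>)
  case (NSus \<pi> Z)
  obtain \<pi>' where "u = NSus \<pi>' Z" "\<forall>a. perm_atom \<pi> a \<noteq> perm_atom \<pi>' a \<longrightarrow> (a, Z) \<in> env V"
    using free_suspension[OF NSus.prems(1,2) _ NSus.prems(4)] NSus.prems by auto
  then show ?case by (auto intro!: neq.intros)
next
  case (NAtm a)
  have no_sus: "u \<noteq> NSus \<pi> Z" for \<pi> Z
    using free_suspension[of \<pi> Z \<tau> "NAtm a"] NAtm.prems by (auto simp: lconv.sym)
  have "neq \<Delta> (napply \<sigma> (NAtm a)) (napply \<sigma> u)" using B_neq[OF NAtm.prems(8,1,2,5,6)] .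
  then show ?case using no_sus by (cases u) (auto elim: neq.cases intro: neq.intros)
next
  case (NFun f ts)
  have no_sus: "u \<noteq> NSus \<pi> Z" for \<pi> Z
    using free_suspension[of \<pi> Z \<tau> "NFun f ts"] NFun.prems by (auto simp: lconv.sym)
  have "neq \<Delta> (napply \<sigma> (NFun f ts)) (napply \<sigma> u)" using B_neq[OF NFun.prems(8,1,2,5,6)] .
  then obtain us where us: "u = NFun f us" using no_sus by (cases u) (auto elim: neq.cases)
  from NFun.prems(1) have ts: "list_all2 (has_sort sg) ts (arg_sorts sg f)"
    by (auto elim: has_sort_NFunE)
  from NFun.prems(2) us have us': "list_all2 (has_sort sg) us (arg_sorts sg f)"
    by (auto elim: has_sort_NFunE)
  have conv: "list_all2 lconv (map (ev \<xi>) ts) (map (ev \<xi>) us)"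
    if "lconv (ev \<xi> (NFun f ts)) (ev \<xi> u)" for \<xi> :: "'c nvar \<Rightarrow> ('a, 'b, 'c) lterm"
    using lconv_lapps_headD(2)[of "LConst f" "LConst f" "map (ev \<xi>) ts" "map (ev \<xi>) us"] that us by simp
  have len: "length ts = length us" using list_all2_lengthD[OF ts] list_all2_lengthD[OF us'] by simp
  have "neq (env V) (ts ! i) (us ! i)" if i: "i < length ts" for i
  proof (rule NFun.IH)
    show "ts ! i \<in> set ts" using i by simp
    show "has_sort sg (ts ! i) (arg_sorts sg f ! i)" "has_sort sg (us ! i) (arg_sorts sg f ! i)"
      using ts us' i len by (auto simp: list_all2_conv_all_nth)
    have "ts ! i \<in> set ts" "us ! i \<in> set us" using i len by auto
    then show "nvars (ts ! i) \<subseteq> V" "nvars (us ! i) \<subseteq> V" "natoms (ts ! i) \<subseteq> set as" "natoms (us ! i) \<subseteq> set as"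
      using NFun.prems(3-6) us by auto
    show "lconv (ev M (ts ! i)) (ev M (us ! i))" "lconv (ev B (ts ! i)) (ev B (us ! i))"
      using conv[OF NFun.prems(7)] conv[OF NFun.prems(8)] i len by (auto simp: list_all2_conv_all_nth)
  qed
  then show ?case using us len by (simp add: neq.intros list_all2_conv_all_nth)
next
  case (NAbs a t)
  have no_sus: "u \<noteq> NSus \<pi> Z" for \<pi> Z
    using free_suspension[of \<pi> Z \<tau> "NAbs a t"] NAbs.prems by (auto simp: lconv.sym)
  have "neq \<Delta> (napply \<sigma> (NAbs a t)) (napply \<sigma> u)" using B_neq[OF NAbs.prems(8,1,2,5,6)] .
  then obtain b u' where u: "u = NAbs b u'" using no_sus by (cases u) (auto elim: neq.cases)
  from NAbs.prems(1) obtain \<tau>' where \<tau>': "\<tau> = AbsSort (atom_sort sg a) \<tau>'" "has_sort sg t \<tau>'"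
    by (auto elim: has_sort_NAbsE)
  from NAbs.prems(2) u \<tau>' have u': "has_sort sg u' \<tau>'" "atom_sort sg b = atom_sort sg a"
    by (auto elim: has_sort_NAbsE)
  have conv: "lconv (lam a (ev M t)) (lam b (ev M u'))" "lconv (lam a (ev B t)) (lam b (ev B u'))"
    using NAbs.prems(7,8) u by simp_all
  have at: "natoms t \<subseteq> set as" "natoms u' \<subseteq> set as" "a \<in> set as" "b \<in> set as"
    and vs: "nvars t \<subseteq> V" "nvars u' \<subseteq> V"
    using NAbs.prems(3-6) u by auto
  show ?case
  proof (cases "a = b")
    case True
    then have "neq (env V) t u'"
      using NAbs.IH[OF \<tau>'(2) u'(1) vs at(1,2)] conv by (simp add: lconv_lam_same)
    then show ?thesis using u True by (simp add: neq.intros)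
  next
    case False
    let ?u = "perm_term [(a, b)] u'"
    have "fresh (env V) a u'"
      by (rule env_fresh[OF lconv_lam_neqD(1)[OF conv(1) False] lconv_lam_neqD(1)[OF conv(2) False]])
        (use at vs in auto)
    moreover have "neq (env V) t ?u"
    proof (rule NAbs.IH[OF \<tau>'(2) _ vs(1) _ at(1)])
      show "has_sort sg ?u \<tau>'" by (rule has_sort_perm) (use u' in auto)
      show "natoms ?u \<subseteq> set as" using natoms_perm[of "[(a, b)]" u'] at by auto
      show "lconv (ev M t) (ev M ?u)" "lconv (ev B t) (ev B ?u)"
        using lconv_lam_neqD(2)[OF conv(1) False] lconv_lam_neqD(2)[OF conv(2) False]
        by (simp_all only: ev_perm)
    qed (use vs in simp)
    ultimately show ?thesis using u False by (simp add: neq.intros swap_perm_term)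
  qed
qed

end

lemma ex_common_generalization:
  "\<exists>\<Delta>1 \<sigma>1. nsolution sg P \<Delta>1 \<sigma>1 \<and> nmore_general sg \<Delta>1 \<sigma>1 \<Delta> \<sigma> \<and> dom \<sigma>1 = dom \<sigma> \<and> sat M \<Delta>1 \<and>
    (\<forall>X \<in> dom \<sigma>. lconv (M X) (ev M (nlookup \<sigma>1 X)))"
proof -
  obtain V where V: "generates V" "\<And>V'. generates V' \<Longrightarrow> card V \<le> card V'"
    using ex_has_least_nat[of generates, OF generates_dom, of card] by blast
  from V(1) have "\<forall>X. \<exists>s. X \<in> dom \<sigma> \<longrightarrow> represents V X s" by (auto simp: generates_def)
  then obtain s where s: "\<And>X. X \<in> dom \<sigma> \<Longrightarrow> represents V X (s X)" by metis
  define \<sigma>1 where "\<sigma>1 X = (if X \<in> dom \<sigma> then Some (s X) else None)" for X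
  have dom1: "dom \<sigma>1 = dom \<sigma>" by (auto simp: \<sigma>1_def split: if_splits)
  have l1: "nlookup \<sigma>1 X = s X" if "X \<in> dom \<sigma>" for X using that by (simp add: nlookup_def \<sigma>1_def)
  have wf1: "nsubst_wf sg \<sigma>1"
    using s finite_dom by (auto simp: nsubst_wf_def dom1) (auto simp: \<sigma>1_def represents_def split: if_splits)
  have "finite (env V)"
    by (rule finite_subset[of _ "set as \<times> V"]) (use V(1) finite_dom finite_subset in \<open>auto simp: env_def generates_def\<close>)
  moreover have "neq (env V) (napply \<sigma>1 t) (napply \<sigma>1 u)" if tu: "(t, u) \<in> P" for t u
  proof -
    obtain \<tau> where \<tau>: "has_sort sg t \<tau>" "has_sort sg u \<tau>" using P_term(5)[OF tu] by blast
    have vs: "nvars (napply \<sigma>1 r) \<subseteq> V" and at: "natoms (napply \<sigma>1 r) \<subseteq> set as"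
      and e: "lconv (ev M r) (ev M (napply \<sigma>1 r))" "lconv (ev B r) (ev B (napply \<sigma>1 r))"
      if r: "nvars r \<subseteq> dom \<sigma>" "natoms r \<subseteq> set as" for r
    proof -
      have *: "represents V X (nlookup \<sigma>1 X)" if "X \<in> nvars r" for X
        using s[of X] l1[of X] that r(1) by (simp add: subset_iff)
      show "nvars (napply \<sigma>1 r) \<subseteq> V" unfolding nvars_napply using * by (auto simp: represents_def)
      show "natoms (napply \<sigma>1 r) \<subseteq> set as"
        using natoms_napply[of \<sigma>1 r] r(2) * unfolding represents_def by blast
      show "lconv (ev M r) (ev M (napply \<sigma>1 r))" "lconv (ev B r) (ev B (napply \<sigma>1 r))"
        unfolding ev_napply by (rule ev_lconv, use * in \<open>simp add: represents_def\<close>)+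
    qed
    note t = P_term(1,3)[OF tu] and u = P_term(2,4)[OF tu]
    show ?thesis
    proof (rule neq_free[OF V])
      show "has_sort sg (napply \<sigma>1 t) \<tau>" "has_sort sg (napply \<sigma>1 u) \<tau>"
        using \<tau> by (auto intro!: has_sort_napply nlookup_has_sort[OF wf1])
      show "lconv (ev M (napply \<sigma>1 t)) (ev M (napply \<sigma>1 u))"
        using e(1)[OF t] e(1)[OF u] M_unif[OF tu] by (meson lconv.sym lconv.trans)
      show "lconv (ev B (napply \<sigma>1 t)) (ev B (napply \<sigma>1 u))"
        using e(2)[OF t] e(2)[OF u] B_unif[OF tu] by (meson lconv.sym lconv.trans)
    qed (use vs at t u in auto)
  qed
  ultimately have "nsolution sg P (env V) \<sigma>1" using wf1 by (auto simp: nsolution_def)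
  moreover have "nmore_general sg (env V) \<sigma>1 \<Delta> \<sigma>"
    unfolding nmore_general_iff dom1
  proof (intro exI[of _ \<sigma>] conjI ballI wf_\<sigma>)
    show "fenv_entails \<Delta> \<sigma> (env V)"
      unfolding fenv_entails_def
      by (auto simp: env_def B_def intro!: fresh_complete[where as = as, OF _ _ nlookup_natoms])
    fix X assume "X \<in> dom \<sigma> \<union> dom \<sigma>"
    then have X: "X \<in> dom \<sigma>" by simp
    note sX = s[OF X, unfolded represents_def]
    have "neq \<Delta> (napply \<sigma> (s X)) (napply \<sigma> (NSus [] X))"
      by (rule B_neq[of _ _ "BaseSort (nvar_sort X)"])
        (use sX has_sort_var[of sg X] in \<open>auto simp: ren_id lconv.sym\<close>)
    then show "neq \<Delta> (napply \<sigma> (nlookup \<sigma>1 X)) (nlookup \<sigma> X)" by (simp add: l1[OF X])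
  qed
  moreover have "sat M (env V)" by (auto simp: sat_def env_def)
  moreover have "\<forall>X \<in> dom \<sigma>. lconv (M X) (ev M (nlookup \<sigma>1 X))"
    using s by (auto simp: l1 represents_def)
  ultimately show ?thesis using dom1 by blast
qed

end

definition dummy :: "('a, 'f, 's) nsig \<Rightarrow> 'a \<Rightarrow> ('a, 'f, 's) lterm" where
  "dummy sg a = LFree (LUnk (NVar 0 (AtomSort (atom_sort sg a))) (LBase (AtomSort (atom_sort sg a))))"

lemma has_type_dummy: "has_type sg [] (dummy sg a) (LBase (AtomSort (atom_sort sg a)))"
  unfolding dummy_def
  using has_type.intros(2)[of sg "[]" "LUnk (NVar 0 (AtomSort (atom_sort sg a))) (LBase (AtomSort (atom_sort sg a)))"]
  by simp

lemma has_type_clean: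
  assumes "has_type sg [] t T" "\<And>a. a \<in> A \<Longrightarrow> has_type sg [] (d a) (LBase (AtomSort (atom_sort sg a)))"
  shows "has_type sg [] (clean d A t) T"
  unfolding clean_def
proof (rule has_type_sb[OF assms(1)])
  fix x :: "('a, 'c) lvar"
  show "has_type sg [] (case x of LAtm a \<Rightarrow> if a \<in> A then d a else LFree x | LUnk X T \<Rightarrow> LFree x) (lvar_type sg x)"
    using assms(2) has_type.intros(2)[of sg "[]" x] by (auto split: lvar.split)
qed simp

text \<open>
  Atoms that are fresh only up to conversion are replaced by dummies, so that none is captured.
\<close>

definition realize ::
  "('a, 'f, 's) nsig \<Rightarrow> 'a list \<Rightarrow> ('a, 's nvar) fenv \<Rightarrow> ('s nvar \<Rightarrow> ('a, 'f, 's) lterm)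
    \<Rightarrow> 's nvar \<Rightarrow> ('a, 'f, 's) lterm" where
  "realize sg as \<Delta> \<xi> X = lams (nonfresh as \<Delta> X) (clean (dummy sg) {a. (a, X) \<in> \<Delta>} (\<xi> X))"

lemma realize_no_atoms: "a \<in> set as \<Longrightarrow> LAtm a \<notin> fvs (realize sg as \<Delta> \<xi> X)"
  by (auto simp: realize_def nonfresh_def dummy_def image_iff dest!: fvs_lamsD fvs_cleanD)

lemma realize_has_type:
  assumes "has_type sg [] (\<xi> X) (LBase (nvar_sort X))"
  shows "has_type sg [] (realize sg as \<Delta> \<xi> X) (lvar_type sg (trans_var sg as \<Delta> X))"
  unfolding realize_def by (intro has_type_lams_trans_var has_type_clean assms has_type_dummy)

lemma realize_conv:
  assumes "sat \<xi> \<Delta>"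
  shows "lconv (lapps (realize sg as \<Delta> \<xi> X) (map atm (nonfresh as \<Delta> X))) (\<xi> X)"
proof -
  have "lconv (\<xi> X) (clean (dummy sg) {a. (a, X) \<in> \<Delta>} (\<xi> X))"
    by (rule lconv_clean) (use assms in \<open>auto simp: sat_def dummy_def\<close>)
  then show ?thesis unfolding realize_def by (rule lconv.trans[OF lapps_lams lconv.sym])
qed

abbreviation realize_subst ::
  "('a, 'f, 's) nsig \<Rightarrow> 'a list \<Rightarrow> ('a, 's nvar) fenv \<Rightarrow> 's nvar set \<Rightarrow> ('s nvar \<Rightarrow> ('a, 'f, 's) lterm)
    \<Rightarrow> ('a, 'f, 's) lsubst" where
  "realize_subst sg as \<Delta> V \<xi> \<equiv> unk_subst sg as \<Delta> V (realize sg as \<Delta> \<xi>)"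

lemma realize_subst_wf:
  assumes "finite V" "\<And>X. X \<in> V \<Longrightarrow> has_type sg [] (\<xi> X) (LBase (nvar_sort X))"
  shows "lsubst_wf sg (realize_subst sg as \<Delta> V \<xi>)"
  by (rule unk_subst_wf) (use assms in \<open>simp_all add: realize_has_type\<close>)

lemma realize_subst_conv:
  assumes "set bs \<subseteq> set as" "natoms t \<subseteq> set as" "nvars t \<subseteq> V" "sat \<xi> \<Delta>"
  shows "lconv (lapply (realize_subst sg as \<Delta> V \<xi>) (lams bs (ev (tval sg as \<Delta>) t))) (lams bs (ev \<xi> t))"
  unfolding lapply_sb
proof (rule lconv_trans_inst[OF assms(1,2)])
  fix X assume "X \<in> nvars t"
  then have X: "X \<in> V" using assms(3) by blast
  show "LAtm a \<notin> fvs (llookup (realize_subst sg as \<Delta> V \<xi>) (trans_var sg as \<Delta> X))" if "a \<in> set as" for a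
    using realize_no_atoms[OF that] X by (simp add: llookup_unk_subst)
  show "lconv (lapps (llookup (realize_subst sg as \<Delta> V \<xi>) (trans_var sg as \<Delta> X)) (map atm (nonfresh as \<Delta> X))) (\<xi> X)"
    using realize_conv[OF assms(4)] X by (simp add: llookup_unk_subst)
qed (simp add: llookup_unk_subst)

context nominal_solution
begin

lemma nmost_general_imp_lmost_general:
  assumes RV_dom: "RV \<subseteq> dom \<sigma>" and mg: "nmost_general sg P \<Delta> \<sigma>"
  shows "lmost_general sg (trans_problem sg as P) (trans_subst sg as \<Delta> \<sigma>)"
  unfolding lmost_general_def
proof (intro conjI allI impI)
  let ?\<sigma> = "trans_subst sg as \<Delta> \<sigma>"
  show "lunifier sg (trans_problem sg as P) ?\<sigma>"
  proof (rule lunifier_transI[OF trans_subst_wf[OF wf_\<sigma>] P_atoms])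
    show "llookup ?\<sigma> (LAtm a) = atm a" for a by (simp add: trans_subst_unk llookup_unk_subst)
    show "llookup ?\<sigma> (trans_var sg as {} X) = lams as (ev tv (nlookup \<sigma> X))" if "X \<in> problem_vars P" for X
      using that P_vars by (intro llookup_trans_subst) blast
  qed (rule P_ev[OF _ tval_sat])
  fix \<theta>1
  assume unif: "lunifier sg (trans_problem sg as P) \<theta>1" and compat: "compatible_names (dom ?\<sigma>) (dom \<theta>1)"
  have wf1: "lsubst_wf sg \<theta>1" using unif by (simp add: lunifier_def)
  let ?L = "\<lambda>X. llookup \<theta>1 (trans_var sg as {} X)"

  text \<open>
    Free atoms of the unifier that are in \<open>as\<close> are renamed to fresh unknowns, since they must not
    be captured by the abstractions of nominal terms.
  \<close>
  define S where "S = (\<Union>X \<in> dom \<sigma>. fvs (?L X))"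
  have "finite S" by (simp add: S_def finite_dom)
  obtain idx :: "'a \<Rightarrow> nat" where idx: "inj_on idx (set as)"
    using finite_imp_inj_to_nat_seg[of "set as"] by auto
  have "finite {n. \<exists>s T. LUnk (NVar n s) T \<in> S}"
  proof (rule finite_subset)
    show "{n. \<exists>s T. LUnk (NVar n s) T \<in> S} \<subseteq> (\<lambda>x. case x of LAtm a \<Rightarrow> 0 | LUnk X T \<Rightarrow> nvar_name X) ` S"
      by (force simp: image_iff)
  qed (simp add: \<open>finite S\<close>)
  then obtain N where N: "\<And>n s T. LUnk (NVar n s) T \<in> S \<Longrightarrow> n < N"
    unfolding finite_nat_set_iff_bounded by blast
  define w :: "'a \<Rightarrow> ('a, 's) lvar" where
    "w a = LUnk (NVar (N + idx a) (AtomSort (atom_sort sg a))) (LBase (AtomSort (atom_sort sg a)))" for a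
  have w_S: "w a \<notin> S" for a
    using N[of "N + idx a"] by (auto simp: w_def)
  have w_inj: "inj_on w (set as)" using idx by (auto simp: inj_on_def w_def)
  define \<kappa> :: "('a, 'f, 's) lterm \<Rightarrow> ('a, 'f, 's) lterm" where "\<kappa> = clean (\<lambda>a. LFree (w a)) (set as)"
  define unw :: "('a, 'f, 's) lterm \<Rightarrow> ('a, 'f, 's) lterm" where
    "unw = sb LBound (\<lambda>x. if x \<in> w ` set as then atm (inv_into (set as) w x) else LFree x)"
  have w_type: "has_type sg [] (LFree (w a)) (LBase (AtomSort (atom_sort sg a)))" for a
    using has_type.intros(2)[of sg "[]" "w a"] by (simp add: w_def)
  have unw_type: "has_type sg [] (unw t) T" if "has_type sg [] t T" for t T
    unfolding unw_def
  proof (rule has_type_sb[OF that])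
    fix x
    have "has_type sg [] (atm a) (lvar_type sg (w a))" for a
      using has_type.intros(2)[of sg "[]" "LAtm a"] by (simp add: w_def)
    then show "has_type sg [] (if x \<in> w ` set as then atm (inv_into (set as) w x) else LFree x) (lvar_type sg x)"
      using inv_into_f_f[OF w_inj] has_type.intros(2)[of sg "[]" x] by auto
  qed simp
  have unw_\<kappa>: "unw (\<kappa> (?L X)) = ?L X" if "X \<in> dom \<sigma>" for X
  proof -
    have "unw (\<kappa> (?L X)) = sb LBound LFree (?L X)"
      unfolding unw_def \<kappa>_def clean_def sb_sb
    proof (simp only: sb.simps, rule sb_cong)
      fix x assume "x \<in> fvs (?L X)"
      then have "x \<notin> w ` set as" using w_S that by (auto simp: S_def)
      then show "sb LBound (\<lambda>x. if x \<in> w ` set as then atm (inv_into (set as) w x) else LFree x)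
          (case x of LAtm a \<Rightarrow> if a \<in> set as then LFree (w a) else LFree x | LUnk X T \<Rightarrow> LFree x) = LFree x"
        using inv_into_f_f[OF w_inj] by (auto split: lvar.split)
    qed
    then show ?thesis by simp
  qed
  define M where "M X = lapps (\<kappa> (?L X)) (map atm as)" for X
  have \<kappa>_atoms: "fvs (\<kappa> t) \<inter> LAtm ` set as = {}" for t
    by (auto simp: \<kappa>_def w_def dest!: fvs_cleanD)

  interpret lambda_unifier sg as P \<Delta> \<sigma> M
  proof
    fix X
    have "has_type sg [] (\<kappa> (?L X)) (lvar_type sg (trans_var sg as {} X))"
      unfolding \<kappa>_def by (intro has_type_clean llookup_has_type[OF wf1] w_type)
    then show "has_type sg [] (M X) (LBase (nvar_sort X))"
      unfolding M_def by (intro has_type_lapps[OF _ has_type_atms]) (simp add: trans_var_def)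
  next
    fix t u assume tu: "(t, u) \<in> P"
    have "lconv (lapply \<theta>1 (lams as (ev (tval sg as {}) t))) (lapply \<theta>1 (lams as (ev (tval sg as {}) u)))"
      using unif tu by (fastforce simp: lunifier_def trans_problem_def trans_term_ev)
    then have "lconv (\<kappa> (lapply \<theta>1 (lams as (ev (tval sg as {}) t)))) (\<kappa> (lapply \<theta>1 (lams as (ev (tval sg as {}) u))))"
      unfolding \<kappa>_def by (rule lconv_clean_cong)
    moreover have "\<kappa> (lapply \<theta>1 (lams as (ev (tval sg as {}) s))) = lams as (ev M s)"
      if "natoms s \<subseteq> set as" for s
      unfolding \<kappa>_def lapply_sb
      by (subst clean_sb_trans[OF that]) (simp_all add: w_def M_def[abs_def] \<kappa>_def)
    ultimately show "lconv (ev M t) (ev M u)"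
      using P_term(3,4)[OF tu] by (simp add: lconv_lams)
  qed

  obtain \<Delta>1 \<sigma>1 where s1: "nsolution sg P \<Delta>1 \<sigma>1" "nmore_general sg \<Delta>1 \<sigma>1 \<Delta> \<sigma>" "dom \<sigma>1 = dom \<sigma>"
    "sat M \<Delta>1" "\<And>X. X \<in> dom \<sigma> \<Longrightarrow> lconv (M X) (ev M (nlookup \<sigma>1 X))"
    using ex_common_generalization by blast
  then have "nmore_general sg \<Delta> \<sigma> \<Delta>1 \<sigma>1" using mg by (simp add: nmost_general_def)
  then obtain \<sigma>' where \<sigma>': "nsubst_wf sg \<sigma>'" "fenv_entails \<Delta>1 \<sigma>' \<Delta>"
    "\<And>X. X \<in> dom \<sigma> \<Longrightarrow> neq \<Delta>1 (napply \<sigma>' (nlookup \<sigma> X)) (nlookup \<sigma>1 X)"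
    unfolding nmore_general_iff s1(3) by blast
  define \<xi> where "\<xi> Y = ev M (nlookup \<sigma>' Y)" for Y
  have sat_\<xi>: "sat \<xi> \<Delta>"
    using \<sigma>'(2) fresh_sound[OF s1(4)] by (auto simp: sat_def fenv_entails_def \<xi>_def)
  have \<xi>_type: "has_type sg [] (\<xi> Y) (LBase (nvar_sort Y))" for Y
    using ev_has_type[OF nlookup_has_sort[OF \<sigma>'(1)] M_type] by (simp add: \<xi>_def)
  have \<xi>_conv: "lconv (ev \<xi> (nlookup \<sigma> X)) (M X)" if "X \<in> dom \<sigma>" for X
  proof -
    have "ev \<xi> (nlookup \<sigma> X) = ev M (napply \<sigma>' (nlookup \<sigma> X))"
      unfolding ev_napply \<xi>_def[abs_def] ..
    then show ?thesis
      using neq_sound[OF s1(4) \<sigma>'(3)[OF that]] s1(5)[OF that] by (metis lconv.sym lconv.trans)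
  qed
  let ?\<eta> = "realize_subst sg as \<Delta> RV \<xi>"
  define \<theta> where "\<theta> x = (if x \<in> dom ?\<eta> then Some (unw (llookup ?\<eta> x))
    else if x \<in> dom ?\<sigma> then None else \<theta>1 x)" for x
  have \<theta>_\<eta>: "llookup \<theta> x = unw (llookup ?\<eta> x)" if "x \<in> dom ?\<eta>" for x
    using that by (auto simp: llookup_def[of \<theta>] \<theta>_def)
  have dom_\<theta>: "dom \<theta> \<subseteq> dom ?\<eta> \<union> dom \<theta>1" by (auto simp: \<theta>_def split: if_splits)
  have wf_\<eta>: "lsubst_wf sg ?\<eta>" by (rule realize_subst_wf) (simp_all add: finite_RV \<xi>_type)
  have "lsubst_wf sg \<theta>"
  proof (rule lsubst_wfI)
    show "finite (dom \<theta>)"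
      using finite_subset[OF dom_\<theta>] wf1 wf_\<eta> by (simp add: lsubst_wf_def)
    fix x assume "x \<in> dom \<theta>"
    show "has_type sg [] (llookup \<theta> x) (lvar_type sg x)"
    proof (cases "x \<in> dom ?\<eta>")
      case True
      then show ?thesis using unw_type[OF llookup_has_type[OF wf_\<eta>]] by (simp add: \<theta>_\<eta>)
    next
      case False
      then have "llookup \<theta> x = llookup \<theta>1 x"
        using \<open>x \<in> dom \<theta>\<close> by (auto simp: llookup_def \<theta>_def split: if_splits)
      then show ?thesis using llookup_has_type[OF wf1] by simp
    qed
  qed
  moreover have "lconv (lapply \<theta> (llookup ?\<sigma> x)) (llookup \<theta>1 x)" if x: "x \<in> dom ?\<sigma> \<union> dom \<theta>1" for x
  proof (cases "x \<in> dom ?\<sigma>")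
    case True
    then obtain X where X: "X \<in> dom \<sigma>" "x = trans_var sg as {} X" by (auto simp: dom_trans_subst)
    let ?T = "lams as (ev tv (nlookup \<sigma> X))"
    have vars: "nvars (nlookup \<sigma> X) \<subseteq> RV" using X(1) by (auto simp: RV_def)
    have "lconv (lapply ?\<eta> ?T) (lams as (ev \<xi> (nlookup \<sigma> X)))"
      by (rule realize_subst_conv) (use nlookup_natoms vars sat_\<xi> in auto)
    also have "lconv \<dots> (lams as (M X))" using \<xi>_conv[OF X(1)] by (simp add: lconv_lams)
    also have "lconv \<dots> (\<kappa> (?L X))"
      unfolding M_def by (rule lams_lapps[OF as_distinct \<kappa>_atoms])
    finally have "lconv (unw (lapply ?\<eta> ?T)) (unw (\<kappa> (?L X)))"
      unfolding unw_def by (rule lconv_sb)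
    moreover have "unw (lapply ?\<eta> ?T) = lapply \<theta> ?T"
      unfolding unw_def lapply_sb sb_sb
    proof (simp only: sb.simps, rule sb_cong)
      fix y assume y: "y \<in> fvs ?T"
      obtain Z T where "y = LUnk Z T"
        using y fvs_trans_atm[OF _ nlookup_natoms] by (cases y) (auto dest!: fvs_lamsD)
      then obtain Y where "Y \<in> nvars (nlookup \<sigma> X)" "y = trans_var sg as \<Delta> Y"
        using y fvs_trans_unk by (blast dest: fvs_lamsD)
      then have "y \<in> dom ?\<eta>" using vars by (auto simp: dom_unk_subst)
      then show "sb LBound (\<lambda>x. if x \<in> w ` set as then atm (inv_into (set as) w x) else LFree x) (llookup ?\<eta> y)
          = llookup \<theta> y"
        by (simp add: \<theta>_\<eta> unw_def)
    qed
    ultimately show ?thesis using X by (simp add: unw_\<kappa> llookup_trans_subst)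
  next
    case False
    then have x1: "x \<in> dom \<theta>1" using x by blast
    have "x \<notin> dom ?\<eta>"
    proof
      assume "x \<in> dom ?\<eta>"
      then obtain Y where Y: "Y \<in> RV" "x = trans_var sg as \<Delta> Y" by (auto simp: dom_unk_subst)
      then have "trans_var sg as {} Y \<in> dom ?\<sigma>" using RV_dom by (auto simp: dom_trans_subst)
      moreover obtain T where T: "trans_var sg as {} Y = LUnk Y T" by (simp add: trans_var_def)
      moreover obtain T' where T': "trans_var sg as \<Delta> Y = LUnk Y T'" by (simp add: trans_var_def)
      ultimately have "T = T'" using compat x1 Y(2) unfolding compatible_names_def by simp
      then have "x = trans_var sg as {} Y" using Y(2) T T' by simp
      moreover note \<open>trans_var sg as {} Y \<in> dom ?\<sigma>\<close>
      ultimately show False using False by simp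
    qed
    then have "llookup \<theta> x = llookup \<theta>1 x" using False by (simp add: llookup_def \<theta>_def)
    moreover have "llookup ?\<sigma> x = LFree x" using False by (auto simp: llookup_def split: option.split)
    ultimately show ?thesis by (simp add: lapply_sb lconv.refl)
  qed
  ultimately show "lmore_general sg ?\<sigma> \<theta>1" unfolding lmore_general_def by blast
qed

lemma lmost_general_imp_nmost_general:
  assumes RV_dom: "RV \<subseteq> dom \<sigma>"
    and mg: "lmost_general sg (trans_problem sg as P) (trans_subst sg as \<Delta> \<sigma>)"
  shows "nmost_general sg P \<Delta> \<sigma>"
  unfolding nmost_general_def
proof (intro conjI allI impI sol)
  let ?\<sigma> = "trans_subst sg as \<Delta> \<sigma>"
  fix \<Delta>1 \<sigma>1
  assume sol1: "nsolution sg P \<Delta>1 \<sigma>1" and "nmore_general sg \<Delta>1 \<sigma>1 \<Delta> \<sigma>"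
  then obtain \<sigma>' where \<sigma>': "nsubst_wf sg \<sigma>'" "fenv_entails \<Delta> \<sigma>' \<Delta>1"
    "\<And>X. X \<in> dom \<sigma>1 \<union> dom \<sigma> \<Longrightarrow> neq \<Delta> (napply \<sigma>' (nlookup \<sigma>1 X)) (nlookup \<sigma> X)"
    unfolding nmore_general_iff by blast
  have wf1: "nsubst_wf sg \<sigma>1" using sol1 by (simp add: nsolution_def)
  define A where "A = (\<Union>X \<in> dom \<sigma>. natoms (nlookup \<sigma>1 X)) - set as"
  have "finite A" by (simp add: A_def finite_dom)
  then obtain extra where extra: "set extra = A" using finite_list by blast
  define as' where "as' = as @ extra"
  have as': "set as \<subseteq> set as'" "\<And>X. X \<in> dom \<sigma> \<Longrightarrow> natoms (nlookup \<sigma>1 X) \<subseteq> set as'"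
    by (auto simp: as'_def extra A_def)
  let ?tv1 = "tval sg as' \<Delta>1"
  define \<theta>1 where "\<theta>1 = unk_subst sg as {} (dom \<sigma>) (\<lambda>X. lams as (ev ?tv1 (nlookup \<sigma>1 X)))"
  have dom1: "dom \<theta>1 = dom ?\<sigma>" by (simp add: \<theta>1_def dom_unk_subst dom_trans_subst)
  have l1: "llookup \<theta>1 (trans_var sg as {} X) = lams as (ev ?tv1 (nlookup \<sigma>1 X))" if "X \<in> dom \<sigma>" for X
    unfolding \<theta>1_def using that by (rule llookup_unk_subst)
  have wf_\<theta>1: "lsubst_wf sg \<theta>1"
    unfolding \<theta>1_def by (rule unk_subst_lams_wf[OF finite_dom nlookup_has_type[OF wf1]])
  have "lunifier sg (trans_problem sg as P) \<theta>1"
  proof (rule lunifier_transI[OF wf_\<theta>1 P_atoms, where \<xi> = "\<lambda>X. ev ?tv1 (nlookup \<sigma>1 X)"])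
    show "llookup \<theta>1 (LAtm a) = atm a" for a by (simp add: \<theta>1_def llookup_unk_subst)
    show "llookup \<theta>1 (trans_var sg as {} X) = lams as (ev ?tv1 (nlookup \<sigma>1 X))" if "X \<in> problem_vars P" for X
      using l1 that P_vars by blast
    fix t u assume "(t, u) \<in> P"
    then have "neq \<Delta>1 (napply \<sigma>1 t) (napply \<sigma>1 u)" using sol1 by (auto simp: nsolution_def)
    from neq_sound[OF tval_sat this]
    show "lconv (ev (\<lambda>X. ev ?tv1 (nlookup \<sigma>1 X)) t) (ev (\<lambda>X. ev ?tv1 (nlookup \<sigma>1 X)) u)"
      by (simp add: ev_napply)
  qed
  moreover have "compatible_names (dom ?\<sigma>) (dom \<theta>1)"
    by (auto simp: compatible_names_def dom1 dom_trans_subst trans_var_def)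
  moreover have "lmore_general sg \<theta>1 ?\<sigma>"
  proof -
    define \<xi> where "\<xi> Z = ev tv (nlookup \<sigma>' Z)" for Z
    define V where "V = (\<Union>X \<in> dom \<sigma>. nvars (nlookup \<sigma>1 X))"
    have "sat \<xi> \<Delta>1"
      using \<sigma>'(2) by (auto simp: sat_def fenv_entails_def \<xi>_def intro!: fresh_sound[OF tval_sat])
    have "lsubst_wf sg (realize_subst sg as' \<Delta>1 V \<xi>)"
    proof (rule realize_subst_wf)
      show "finite V" by (simp add: V_def finite_dom)
      show "has_type sg [] (\<xi> X) (LBase (nvar_sort X))" for X
        using ev_has_type[OF nlookup_has_sort[OF \<sigma>'(1)] tval_has_type] by (simp add: \<xi>_def)
    qed
    moreover have "lconv (lapply (realize_subst sg as' \<Delta>1 V \<xi>) (llookup \<theta>1 x)) (llookup ?\<sigma> x)"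
      if "x \<in> dom \<theta>1 \<union> dom ?\<sigma>" for x
    proof -
      from that obtain X where X: "X \<in> dom \<sigma>" "x = trans_var sg as {} X"
        by (auto simp: dom1 dom_trans_subst)
      have "lconv (lapply (realize_subst sg as' \<Delta>1 V \<xi>) (lams as (ev ?tv1 (nlookup \<sigma>1 X))))
        (lams as (ev \<xi> (nlookup \<sigma>1 X)))"
        by (rule realize_subst_conv[OF as'(1) as'(2)[OF X(1)] _ \<open>sat \<xi> \<Delta>1\<close>]) (use X(1) in \<open>auto simp: V_def\<close>)
      also have "ev \<xi> (nlookup \<sigma>1 X) = ev tv (napply \<sigma>' (nlookup \<sigma>1 X))"
        unfolding ev_napply \<xi>_def[abs_def] ..
      also have "lconv (lams as (ev tv (napply \<sigma>' (nlookup \<sigma>1 X)))) (lams as (ev tv (nlookup \<sigma> X)))"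
        unfolding lconv_lams by (rule neq_sound[OF tval_sat \<sigma>'(3)]) (use X(1) in blast)
      finally show ?thesis using X by (simp add: l1 llookup_trans_subst)
    qed
    ultimately show ?thesis unfolding lmore_general_def by blast
  qed
  ultimately have "lmore_general sg ?\<sigma> \<theta>1" using mg by (simp add: lmost_general_def)
  then obtain \<theta> where \<theta>: "\<And>x. x \<in> dom ?\<sigma> \<Longrightarrow> lconv (lapply \<theta> (llookup ?\<sigma> x)) (llookup \<theta>1 x)"
    unfolding lmore_general_def by blast
  define \<phi> where "\<phi> X = lapps (clean (\<lambda>_. LConst undefined) (set as) (llookup \<theta> (trans_var sg as \<Delta> X)))
    (map atm (nonfresh as \<Delta> X))" for X
  have \<phi>_conv: "lconv (ev \<phi> (nlookup \<sigma> X)) (ev ?tv1 (nlookup \<sigma>1 X))" if X: "X \<in> dom \<sigma>" for X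
  proof -
    have "lconv (sb LBound (llookup \<theta>) (lams as (ev tv (nlookup \<sigma> X)))) (lams as (ev ?tv1 (nlookup \<sigma>1 X)))"
      using \<theta>[of "trans_var sg as {} X"] X by (simp add: dom_trans_subst lapply_sb l1 llookup_trans_subst)
    from lconv_trans_instD[OF nlookup_natoms this] show ?thesis unfolding \<phi>_def[abs_def] .
  qed
  have \<phi>_sat: "afresh a (\<phi> Y)" if "(a, Y) \<in> \<Delta>" for a Y
  proof (rule afresh_notin)
    have "a \<in> set as" using that \<Delta>_atoms by force
    then show "LAtm a \<notin> fvs (\<phi> Y)"
      using that by (auto simp: \<phi>_def nonfresh_def dest!: fvs_cleanD)
  qed
  have "\<exists>v. has_sort sg v (BaseSort (nvar_sort Y)) \<and> lconv (\<phi> Y) (ev ?tv1 v) \<and> natoms v \<subseteq> set as'"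
    if "Y \<in> RV" for Y
  proof -
    obtain X where X: "X \<in> dom \<sigma>" "Y \<in> nvars (nlookup \<sigma> X)" using \<open>Y \<in> RV\<close> by (auto simp: RV_def)
    have "skel (nlookup \<sigma>1 X) (nlookup \<sigma> X)" using neq_skel[OF \<sigma>'(3)] X(1) by blast
    from lconv_ev_extract[OF this nlookup_sort nlookup_has_sort[OF wf1] \<phi>_conv[OF X(1)] X(2)]
    show ?thesis using as' nlookup_natoms X(1) by blast
  qed
  then have "\<forall>Y. \<exists>v. Y \<in> RV \<longrightarrow>
      has_sort sg v (BaseSort (nvar_sort Y)) \<and> lconv (\<phi> Y) (ev ?tv1 v) \<and> natoms v \<subseteq> set as'"
    by blast
  from choice[OF this] obtain v where v: "\<And>Y. Y \<in> RV \<Longrightarrow> has_sort sg (v Y) (BaseSort (nvar_sort Y))"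
    "\<And>Y. Y \<in> RV \<Longrightarrow> lconv (\<phi> Y) (ev ?tv1 (v Y))" "\<And>Y. Y \<in> RV \<Longrightarrow> natoms (v Y) \<subseteq> set as'"
    by blast
  define \<sigma>2 where "\<sigma>2 X = (if X \<in> RV then Some (v X) else if X \<in> dom \<sigma> then None else \<sigma>1 X)" for X
  have l2: "nlookup \<sigma>2 Y = v Y" if "Y \<in> RV" for Y using that by (simp add: nlookup_def \<sigma>2_def)
  have "nsubst_wf sg \<sigma>2"
    unfolding nsubst_wf_def
  proof (intro conjI allI impI)
    have "dom \<sigma>2 \<subseteq> RV \<union> dom \<sigma>1" by (auto simp: \<sigma>2_def split: if_splits)
    then show "finite (dom \<sigma>2)" using finite_RV wf1 by (auto simp: nsubst_wf_def intro: finite_subset)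
    fix X t assume "\<sigma>2 X = Some t"
    then show "has_sort sg t (BaseSort (nvar_sort X))"
      using v(1)[of X] wf1 by (auto simp: \<sigma>2_def nsubst_wf_def split: if_splits)
  qed
  note wf2 = this
  moreover have "fenv_entails \<Delta>1 \<sigma>2 \<Delta>"
    unfolding fenv_entails_def
  proof clarify
    fix a Y assume aY: "(a, Y) \<in> \<Delta>"
    then have Y: "Y \<in> RV" using \<Delta>_vars RV_ran by force
    have "a \<in> set as'" using aY \<Delta>_atoms as'(1) by force
    with afresh_lconv[OF v(2)[OF Y] \<phi>_sat[OF aY]] v(3)[OF Y] show "fresh \<Delta>1 a (nlookup \<sigma>2 Y)"
      by (simp add: l2[OF Y] fresh_complete[where as = as'])
  qed
  moreover have "neq \<Delta>1 (napply \<sigma>2 (nlookup \<sigma> X)) (nlookup \<sigma>1 X)" if "X \<in> dom \<sigma> \<union> dom \<sigma>1" for X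
  proof (cases "X \<in> dom \<sigma>")
    case True
    have vars: "Y \<in> RV" if "Y \<in> nvars (nlookup \<sigma> X)" for Y using that True by (auto simp: RV_def)
    show ?thesis
    proof (rule neq_complete[where as = as'])
      show "has_sort sg (napply \<sigma>2 (nlookup \<sigma> X)) (BaseSort (nvar_sort X))"
        by (intro has_sort_napply nlookup_has_sort wf2 nlookup_sort)
      show "has_sort sg (nlookup \<sigma>1 X) (BaseSort (nvar_sort X))" by (rule nlookup_has_sort[OF wf1])
      show "natoms (napply \<sigma>2 (nlookup \<sigma> X)) \<subseteq> set as'"
      proof -
        have "natoms (nlookup \<sigma>2 Y) \<subseteq> set as'" if "Y \<in> nvars (nlookup \<sigma> X)" for Y
          using v(3)[OF vars[OF that]] by (simp add: l2[OF vars[OF that]])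
        then show ?thesis
          using natoms_napply[of \<sigma>2 "nlookup \<sigma> X"] nlookup_natoms[of X] as'(1) by blast
      qed
      show "natoms (nlookup \<sigma>1 X) \<subseteq> set as'" by (rule as'(2)[OF True])
      have "lconv (ev \<phi> (nlookup \<sigma> X)) (ev ?tv1 (napply \<sigma>2 (nlookup \<sigma> X)))"
        unfolding ev_napply by (rule ev_lconv) (simp add: vars l2 v(2))
      then show "lconv (ev ?tv1 (napply \<sigma>2 (nlookup \<sigma> X))) (ev ?tv1 (nlookup \<sigma>1 X))"
        using \<phi>_conv[OF True] by (meson lconv.sym lconv.trans)
    qed
  next
    case False
    then have "X \<notin> RV" using RV_dom by blast
    then have "nlookup \<sigma>2 X = nlookup \<sigma>1 X" using False by (simp add: nlookup_def \<sigma>2_def)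
    moreover have "nlookup \<sigma> X = NSus [] X" using False by (auto simp: nlookup_def split: option.split)
    ultimately show ?thesis by (simp add: neq_refl)
  qed
  ultimately show "nmore_general sg \<Delta> \<sigma> \<Delta>1 \<sigma>1" unfolding nmore_general_iff by blast
qed

lemma nmost_general_iff_lmost_general:
  "nmost_general sg P \<Delta> \<sigma> \<longleftrightarrow> lmost_general sg (trans_problem sg as P) (trans_subst sg as \<Delta> \<sigma>)"
proof (cases "RV \<subseteq> dom \<sigma>")
  case True
  then show ?thesis
    using nmost_general_imp_lmost_general lmost_general_imp_nmost_general by blast
next
  case False
  then obtain W W' where "escaping_variable sg as P \<Delta> \<sigma> W W'" using ex_renaming by blast
  then show ?thesis
    using escaping_variable.not_nmost_general escaping_variable.not_lmost_general by blast
qed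

end

theorem theorem8p7:
  fixes sg :: "('a, 'f, 's) nsig"
    and as :: "'a list"
    and P :: "('a, 'f, 's nvar) nproblem"
    and \<Delta> :: "('a, 's nvar) fenv"
    and \<sigma> :: "('a, 'f, 's nvar) nsubst"
  assumes "nproblem_wf sg P"
    and "nsolution sg P \<Delta> \<sigma>"
    and "problem_vars P \<subseteq> dom \<sigma>"
    and "snd ` \<Delta> \<subseteq> (\<Union>t \<in> ran \<sigma>. nvars t)"
    and "distinct as"
    and "problem_atoms P \<subseteq> set as"
    and "fst ` \<Delta> \<subseteq> set as"
    and "(\<Union>t \<in> ran \<sigma>. natoms t) \<subseteq> set as"
  shows "nmost_general sg P \<Delta> \<sigma> \<longleftrightarrow>
         lmost_general sg (trans_problem sg as P) (trans_subst sg as \<Delta> \<sigma>)"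
proof -
  interpret nominal_solution sg as P \<Delta> \<sigma>
    by (rule nominal_solution.intro) (fact assms)+
  show ?thesis by (rule nmost_general_iff_lmost_general)
qed

end
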